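(* Let $\overline M=M\cup\partial M$ be a smooth manifold with boundary and let $g$ be a pseudo-Riemannian metric on $M$ which is projectively pre-compact and asymptotically tangentially Ricci flat. Then locally around each point of $\partial M_\pm$ there is a local defining function $\hat\rho:U\to\mathbb R$ for $\partial M$ with respect to which $g$ can be expressed on $U\cap M$ as $$g=\frac{C}{\hat\rho^4}d\hat\rho^2+\frac{h}{\hat\rho^2},$$ where $C\in C^\infty(U,\mathbb R)$ satisfies $C=\pm1+\mathcal O(\hat\rho)$ (sign $+$ for points of $\partial M_+$, $-$ for points of $\partial M_-$) and $h\in\Gamma(S^2T^*U)$ is smooth up to the boundary with boundary value non-degenerate on $T\partial M\times T\partial M$.
   Context: Setting. $\overline M$ is a smooth manifold with boundary $\partial M$ and interior $M$, $\dim\overline M=n+1$ (with $n\ge2$ so that tractors on $\partial M$ are defined as usual). An object on $U\cap M$ ($U\subset\overline M$ open) "admits a smooth extension to the boundary" (is "smooth up to the boundary") if it is the restriction of a smooth object on $U$. A local defining function for $\partial M$ is a smooth $\rho:U\to\mathbb R$, $U\subset\overline M$ open, with $\rho^{-1}(0)=U\cap\partial M$ and $d\rho$ nowhere zero on $U\cap\partial M$. $f=\mathcal O(\rho)$ means $f=\rho f_1$ with $f_1$ smooth on $U$. $\mathfrak X_\partial(U)\subset\mathfrak X(U)$ is the space of vector fields tangent to $\partial M$ along $U\cap\partial M$. Pre-compactness. For a connection $\nabla$ on $TM$ put $\nabla^\rho_\xi\eta:=\nabla_\xi\eta+\frac{d\rho(\xi)}{\rho}\eta+\frac{d\rho(\eta)}{\rho}\xi$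 on $U\cap M$. A torsion-free connection $\nabla$ preserving a volume density is projectively pre-compact (of order $1$) if for each $U$ and each local defining function $\rho:U\to\mathbb R$: (i) $d\rho(\nabla^\rho_\xi\eta)$ is smooth up to the boundary for all $\xi,\eta\in\mathfrak X(U)$; (ii) $\rho\nabla^\rho_\xi\eta$ is smooth up to the boundary for all $\xi,\eta\in\mathfrak X(U)$; (iii) $\nabla^\rho_\xi\eta$ is smooth up to the boundary if at least one of $\xi,\eta\in\mathfrak X(U)$ lies in $\mathfrak X_\partial(U)$. A pseudo-Riemannian metric $g$ is projectively pre-compact if its Levi-Civita connection $\nabla$ is. Such $g$ is asymptotically tangentially Ricci flat if $\mathrm{Ric}(\xi,\eta)$ admits a smooth extension to the boundary whenever at least one of $\xi,\eta\in\mathfrak X(\overline M)$ lies in $\mathfrak X_\partial(\overline M)$, and vanishes along the boundary if both do. The sets $\partial M_\pm$. $\mathcal E(w)$ is the oriented line bundle of projective densities of weight $w$, normalized so that $\mathcal E(-n-2)$ is the bundle of volume densities of $\overline M$; $B(w)=B\otimes\mathcal E(w)$. Let $\sigma=(\mathrm{vol}_g)^{-1/(n+2)}\in\Gamma(\mathcal E(1)|_M)$ be the volume scale. $T^b\overline M$ is Melrose's b-tangent bundle, the vector bundle whose sheaf of smooth sections is $\mathfrak X_\partial$. Then $\sigma^2g$ extends smoothly to a section of $S^2(T^b\overline M)^*(2)$ over $\overline M$ whose boundary value is a non-degenerate bundle metric on $T^b\overline M(-1)|_{\partial M}$, parallel for the connection induced by $\nabla$. This bundle with its connection is the projective standard tractor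 bundle of $\partial M$ (for the projective structure on $\partial M$ induced by the connections $\nabla^\rho$) with the normal tractor connection, with canonical line subbundle $\mathcal E(-1)|_{\partial M}$ spanned by the boundary value of $\rho\nu$ (tensored with $\mathcal E(-1)$), where $d\rho(\nu)|_{\partial M}\equiv1$. The resulting holonomy reduction decomposes $\partial M=\partial M_+\sqcup\partial M_0\sqcup\partial M_-$ into curved orbits: $\partial M_+$, $\partial M_0$, $\partial M_-$ are the sets of points where the bundle metric restricted to this line subbundle is positive, zero, negative, respectively. *)

theory Defs
  imports "HOL-Analysis.Analysis"
begin

section \<open>Smooth maps and manifolds with boundary\<close>

text \<open>
  Smoothness on a set \<open>S\<close> is meant for relatively open subsets of a closed half-space: all iterated
  derivatives, taken within \<open>S\<close> (hence one-sided at the boundary), exist and are continuous on \<open>S\<close>.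
  Derivatives within such a set are unique.  By the extension theorems of Whitney and Seeley this
  agrees with local extendability to a smooth map on an open subset of the whole space.
\<close>

primrec Ck_on :: "nat \<Rightarrow> 'a set \<Rightarrow> ('a::real_normed_vector \<Rightarrow> 'b::real_normed_vector) \<Rightarrow> bool" where
  "Ck_on 0 S f \<longleftrightarrow> continuous_on S f"
| "Ck_on (Suc k) S f \<longleftrightarrow> f differentiable_on S \<and>
     (\<forall>v. Ck_on k S (\<lambda>x. frechet_derivative f (at x within S) v))"

definition smooth_on :: "'a set \<Rightarrow> ('a::real_normed_vector \<Rightarrow> 'b::real_normed_vector) \<Rightarrow> bool" where
  "smooth_on S f \<longleftrightarrow> (\<forall>k. Ck_on k S f)"

text \<open>
  The model space is \<open>\<real>\<^sup>n\<^sup>+\<^sup>1\<close> with \<open>n = CARD('n)\<close>; the coordinates are indexed by \<open>'n option\<close>,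
  and the index \<open>None\<close> is the one transversal to the boundary.
\<close>

type_synonym 'n coords = "(real, 'n option) vec"
type_synonym ('a, 'n) chart = "'a set \<times> ('a \<Rightarrow> 'n coords)"

definition half_space :: "('n::finite) coords set" where
  "half_space = {x. 0 \<le> x $ None}"

abbreviation bderiv :: "(('n::finite) coords \<Rightarrow> 'b::real_normed_vector) \<Rightarrow> 'n coords \<Rightarrow> 'n coords \<Rightarrow> 'b" where
  "bderiv f x \<equiv> frechet_derivative f (at x within half_space)"

definition coord :: "('a, 'n::finite) chart \<Rightarrow> 'a set \<Rightarrow> 'n coords set" where
  "coord c U = snd c ` (U \<inter> fst c)"

definition coord_inv :: "('a, 'n::finite) chart \<Rightarrow> 'n coords \<Rightarrow> 'a" where
  "coord_inv c = inv_into (fst c) (snd c)"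

definition transition :: "('a, 'n::finite) chart \<Rightarrow> ('a, 'n) chart \<Rightarrow> 'n coords \<Rightarrow> 'n coords" where
  "transition c c' = snd c' \<circ> coord_inv c"

definition manifold_with_boundary :: "'a topology \<Rightarrow> ('a, 'n::finite) chart set \<Rightarrow> bool" where
  "manifold_with_boundary X A \<longleftrightarrow>
     Hausdorff_space X \<and> second_countable X \<and> topspace X = \<Union> (fst ` A) \<and>
     (\<forall>c\<in>A. openin X (fst c) \<and>
        openin (top_of_set half_space) (snd c ` fst c) \<and>
        homeomorphic_map (subtopology X (fst c)) (top_of_set (snd c ` fst c)) (snd c)) \<and>
     (\<forall>c\<in>A. \<forall>c'\<in>A. smooth_on (coord c (fst c')) (transition c c'))"

definition bdry :: "('a, 'n::finite) chart set \<Rightarrow> 'a set" where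
  "bdry A = {p. \<exists>c\<in>A. p \<in> fst c \<and> snd c p $ None = 0}"

definition mint :: "'a topology \<Rightarrow> ('a, 'n::finite) chart set \<Rightarrow> 'a set" where
  "mint X A = topspace X - bdry A"


section \<open>Functions, densities and tensor fields\<close>

text \<open>
  Geometric objects other than functions are families of local representatives: for each chart \<open>c\<close>
  a function of the coordinates of \<open>c\<close>, subject to the transformation law of the object on the
  overlaps.  Values outside the region under consideration are irrelevant.
\<close>

type_synonym ('a, 'n) density = "('a, 'n) chart \<Rightarrow> 'n coords \<Rightarrow> real"
type_synonym ('a, 'n) vfield = "('a, 'n) chart \<Rightarrow> 'n coords \<Rightarrow> 'n coords"
type_synonym ('a, 'n) bform = "('a, 'n) chart \<Rightarrow> 'n coords \<Rightarrow> 'n coords \<Rightarrow> 'n coords \<Rightarrow> real"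
type_synonym ('a, 'n) christoffel = "('a, 'n) chart \<Rightarrow> 'n coords \<Rightarrow> 'n coords \<Rightarrow> 'n coords \<Rightarrow> 'n coords"

definition smooth_fun :: "('a, 'n::finite) chart set \<Rightarrow> 'a set \<Rightarrow> ('a \<Rightarrow> real) \<Rightarrow> bool" where
  "smooth_fun A U f \<longleftrightarrow> (\<forall>c\<in>A. smooth_on (coord c U) (f \<circ> coord_inv c))"

definition differential :: "('a \<Rightarrow> real) \<Rightarrow> ('a, 'n::finite) chart \<Rightarrow> 'n coords \<Rightarrow> 'n coords \<Rightarrow> real" where
  "differential f c x = bderiv (f \<circ> coord_inv c) x"

text \<open>
  Sections of \<open>\<E>(w)\<close>, normalized such that \<open>\<E>(-n-2)\<close> is the bundle of volume densities of the
  \<open>(n+1)\<close>-dimensional manifold.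
\<close>

definition density_field :: "('a, 'n::finite) chart set \<Rightarrow> 'a set \<Rightarrow> real \<Rightarrow> ('a, 'n) density \<Rightarrow> bool" where
  "density_field A U w s \<longleftrightarrow>
     (\<forall>c\<in>A. smooth_on (coord c U) (s c)) \<and>
     (\<forall>c\<in>A. \<forall>c'\<in>A. \<forall>x\<in>coord c (U \<inter> fst c').
        s c x = \<bar>det (matrix (bderiv (transition c c') x))\<bar> powr (- w / (real CARD('n) + 2))
                * s c' (transition c c' x))"

definition vector_field :: "('a, 'n::finite) chart set \<Rightarrow> 'a set \<Rightarrow> ('a, 'n) vfield \<Rightarrow> bool" where
  "vector_field A U \<xi> \<longleftrightarrow>
     (\<forall>c\<in>A. smooth_on (coord c U) (\<xi> c)) \<and>
     (\<forall>c\<in>A. \<forall>c'\<in>A. \<forall>x\<in>coord c (U \<inter> fst c').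
        \<xi> c' (transition c c' x) = bderiv (transition c c') x (\<xi> c x))"

definition vector_field_tangent :: "('a, 'n::finite) chart set \<Rightarrow> 'a set \<Rightarrow> ('a, 'n) vfield \<Rightarrow> bool" where
  "vector_field_tangent A U \<xi> \<longleftrightarrow> vector_field A U \<xi> \<and>
     (\<forall>c\<in>A. \<forall>x\<in>coord c (U \<inter> bdry A). \<xi> c x $ None = 0)"

definition sym_form_field :: "('a, 'n::finite) chart set \<Rightarrow> 'a set \<Rightarrow> ('a, 'n) bform \<Rightarrow> bool" where
  "sym_form_field A U h \<longleftrightarrow>
     (\<forall>c\<in>A. (\<forall>x\<in>coord c U. bilinear (h c x) \<and> (\<forall>v w. h c x v w = h c x w v)) \<and>
        (\<forall>v w. smooth_on (coord c U) (\<lambda>x. h c x v w))) \<and>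
     (\<forall>c\<in>A. \<forall>c'\<in>A. \<forall>x\<in>coord c (U \<inter> fst c'). \<forall>v w.
        h c x v w = h c' (transition c c' x) (bderiv (transition c c') x v) (bderiv (transition c c') x w))"

definition pseudo_metric :: "('a, 'n::finite) chart set \<Rightarrow> 'a set \<Rightarrow> ('a, 'n) bform \<Rightarrow> bool" where
  "pseudo_metric A U g \<longleftrightarrow> sym_form_field A U g \<and>
     (\<forall>c\<in>A. \<forall>x\<in>coord c U. \<forall>v. (\<forall>w. g c x v w = 0) \<longrightarrow> v = 0)"

definition scale_field :: "('a \<Rightarrow> real) \<Rightarrow> ('a, 'n::finite) vfield \<Rightarrow> ('a, 'n) vfield" where
  "scale_field f \<xi> = (\<lambda>c x. f (coord_inv c x) *\<^sub>R \<xi> c x)"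

definition local_defining :: "'a topology \<Rightarrow> ('a, 'n::finite) chart set \<Rightarrow> 'a set \<Rightarrow> ('a \<Rightarrow> real) \<Rightarrow> bool" where
  "local_defining X A U \<rho> \<longleftrightarrow> openin X U \<and> smooth_fun A U \<rho> \<and>
     (\<forall>p\<in>U. \<rho> p = 0 \<longleftrightarrow> p \<in> bdry A) \<and>
     (\<forall>c\<in>A. \<forall>x\<in>coord c (U \<inter> bdry A). \<exists>v. differential \<rho> c x v \<noteq> 0)"

text \<open>
  Objects on \<open>U \<inter> M\<close> which are restrictions of smooth objects on \<open>U\<close>; here \<open>f\<close> and \<open>\<zeta>\<close> are given by
  their local representatives.
\<close>

definition extends_fun ::
  "'a topology \<Rightarrow> ('a, 'n::finite) chart set \<Rightarrow> 'a set \<Rightarrow> ('a, 'n) density \<Rightarrow> ('a \<Rightarrow> real) \<Rightarrow> bool" where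
  "extends_fun X A U f F \<longleftrightarrow> smooth_fun A U F \<and>
     (\<forall>c\<in>A. \<forall>x\<in>coord c (U \<inter> mint X A). F (coord_inv c x) = f c x)"

definition smooth_up_to_bdry_fun ::
  "'a topology \<Rightarrow> ('a, 'n::finite) chart set \<Rightarrow> 'a set \<Rightarrow> ('a, 'n) density \<Rightarrow> bool" where
  "smooth_up_to_bdry_fun X A U f \<longleftrightarrow> (\<exists>F. extends_fun X A U f F)"

definition smooth_up_to_bdry_vf ::
  "'a topology \<Rightarrow> ('a, 'n::finite) chart set \<Rightarrow> 'a set \<Rightarrow> ('a, 'n) vfield \<Rightarrow> bool" where
  "smooth_up_to_bdry_vf X A U \<zeta> \<longleftrightarrow> (\<exists>Z. vector_field A U Z \<and>
     (\<forall>c\<in>A. \<forall>x\<in>coord c (U \<inter> mint X A). Z c x = \<zeta> c x))"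


section \<open>Connections and curvature\<close>

text \<open>
  A linear connection is given by its Christoffel symbols \<open>\<Gamma> c x v w\<close>, where \<open>v\<close> is the direction of
  differentiation.  Their transformation law is expressed by the requirement that covariant
  derivatives of vector fields are vector fields.
\<close>

definition cov :: "('a, 'n::finite) christoffel \<Rightarrow> ('a, 'n) vfield \<Rightarrow> ('a, 'n) vfield \<Rightarrow> ('a, 'n) vfield" where
  "cov \<Gamma> \<xi> \<eta> = (\<lambda>c x. bderiv (\<eta> c) x (\<xi> c x) + \<Gamma> c x (\<xi> c x) (\<eta> c x))"

definition lie_bracket :: "('a, 'n::finite) vfield \<Rightarrow> ('a, 'n) vfield \<Rightarrow> ('a, 'n) vfield" where
  "lie_bracket \<xi> \<eta> = (\<lambda>c x. bderiv (\<eta> c) x (\<xi> c x) - bderiv (\<xi> c) x (\<eta> c x))"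

definition connection :: "'a topology \<Rightarrow> ('a, 'n::finite) chart set \<Rightarrow> ('a, 'n) christoffel \<Rightarrow> bool" where
  "connection X A \<Gamma> \<longleftrightarrow>
     (\<forall>c\<in>A. (\<forall>x\<in>coord c (mint X A). bilinear (\<Gamma> c x)) \<and>
        (\<forall>v w. smooth_on (coord c (mint X A)) (\<lambda>x. \<Gamma> c x v w))) \<and>
     (\<forall>V \<xi> \<eta>. openin X V \<and> V \<subseteq> mint X A \<and> vector_field A V \<xi> \<and> vector_field A V \<eta> \<longrightarrow>
        vector_field A V (cov \<Gamma> \<xi> \<eta>))"

definition torsion_free :: "'a topology \<Rightarrow> ('a, 'n::finite) chart set \<Rightarrow> ('a, 'n) christoffel \<Rightarrow> bool" where
  "torsion_free X A \<Gamma> \<longleftrightarrow>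
     (\<forall>V \<xi> \<eta>. openin X V \<and> V \<subseteq> mint X A \<and> vector_field A V \<xi> \<and> vector_field A V \<eta> \<longrightarrow>
        (\<forall>c\<in>A. \<forall>x\<in>coord c V. cov \<Gamma> \<xi> \<eta> c x - cov \<Gamma> \<eta> \<xi> c x = lie_bracket \<xi> \<eta> c x))"

text \<open>
  In a chart, the covariant derivative of a volume density \<open>\<mu>\<close> in direction \<open>v\<close> is
  \<open>bderiv \<mu> v - tr (\<Gamma> v) \<mu>\<close>.
\<close>

definition preserves_volume_density ::
  "'a topology \<Rightarrow> ('a, 'n::finite) chart set \<Rightarrow> ('a, 'n) christoffel \<Rightarrow> bool" where
  "preserves_volume_density X A \<Gamma> \<longleftrightarrow>
     (\<exists>\<mu>. density_field A (mint X A) (- real CARD('n) - 2) \<mu> \<and>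
        (\<forall>c\<in>A. \<forall>x\<in>coord c (mint X A). 0 < \<mu> c x \<and>
           (\<forall>v. bderiv (\<mu> c) x v - trace (matrix (\<Gamma> c x v)) * \<mu> c x = 0)))"

definition nabla_rho ::
  "('a, 'n::finite) christoffel \<Rightarrow> ('a \<Rightarrow> real) \<Rightarrow> ('a, 'n) vfield \<Rightarrow> ('a, 'n) vfield \<Rightarrow> ('a, 'n) vfield" where
  "nabla_rho \<Gamma> \<rho> \<xi> \<eta> = (\<lambda>c x. cov \<Gamma> \<xi> \<eta> c x
     + (differential \<rho> c x (\<xi> c x) / \<rho> (coord_inv c x)) *\<^sub>R \<eta> c x
     + (differential \<rho> c x (\<eta> c x) / \<rho> (coord_inv c x)) *\<^sub>R \<xi> c x)"

definition precompact_connection ::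
  "'a topology \<Rightarrow> ('a, 'n::finite) chart set \<Rightarrow> ('a, 'n) christoffel \<Rightarrow> bool" where
  "precompact_connection X A \<Gamma> \<longleftrightarrow>
     connection X A \<Gamma> \<and> torsion_free X A \<Gamma> \<and> preserves_volume_density X A \<Gamma> \<and>
     (\<forall>U \<rho>. local_defining X A U \<rho> \<longrightarrow>
        (\<forall>\<xi> \<eta>. vector_field A U \<xi> \<and> vector_field A U \<eta> \<longrightarrow>
           smooth_up_to_bdry_fun X A U (\<lambda>c x. differential \<rho> c x (nabla_rho \<Gamma> \<rho> \<xi> \<eta> c x)) \<and>
           smooth_up_to_bdry_vf X A U (scale_field \<rho> (nabla_rho \<Gamma> \<rho> \<xi> \<eta>)) \<and>
           (vector_field_tangent A U \<xi> \<or> vector_field_tangent A U \<eta> \<longrightarrow>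
              smooth_up_to_bdry_vf X A U (nabla_rho \<Gamma> \<rho> \<xi> \<eta>))))"

definition levi_civita ::
  "'a topology \<Rightarrow> ('a, 'n::finite) chart set \<Rightarrow> ('a, 'n) bform \<Rightarrow> ('a, 'n) christoffel \<Rightarrow> bool" where
  "levi_civita X A g \<Gamma> \<longleftrightarrow> connection X A \<Gamma> \<and> torsion_free X A \<Gamma> \<and>
     (\<forall>V \<xi> \<eta> \<zeta>. openin X V \<and> V \<subseteq> mint X A \<and>
        vector_field A V \<xi> \<and> vector_field A V \<eta> \<and> vector_field A V \<zeta> \<longrightarrow>
        (\<forall>c\<in>A. \<forall>x\<in>coord c V.
           bderiv (\<lambda>y. g c y (\<eta> c y) (\<zeta> c y)) x (\<xi> c x)
             = g c x (cov \<Gamma> \<xi> \<eta> c x) (\<zeta> c x) + g c x (\<eta> c x) (cov \<Gamma> \<xi> \<zeta> c x)))"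

definition precompact_metric :: "'a topology \<Rightarrow> ('a, 'n::finite) chart set \<Rightarrow> ('a, 'n) bform \<Rightarrow> bool" where
  "precompact_metric X A g \<longleftrightarrow> (\<exists>\<Gamma>. levi_civita X A g \<Gamma> \<and> precompact_connection X A \<Gamma>)"

definition riemann ::
  "('a, 'n::finite) christoffel \<Rightarrow> ('a, 'n) vfield \<Rightarrow> ('a, 'n) vfield \<Rightarrow> ('a, 'n) vfield \<Rightarrow> ('a, 'n) vfield" where
  "riemann \<Gamma> \<xi> \<eta> \<zeta> = (\<lambda>c x. cov \<Gamma> \<xi> (cov \<Gamma> \<eta> \<zeta>) c x - cov \<Gamma> \<eta> (cov \<Gamma> \<xi> \<zeta>) c x
     - cov \<Gamma> (lie_bracket \<xi> \<eta>) \<zeta> c x)"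

text \<open>
  \<open>Ric(\<xi>, \<eta>)\<close> is the trace of \<open>\<zeta> \<mapsto> R(\<zeta>, \<xi>) \<eta>\<close>.  All operators above act chart by chart, so the trace
  can be computed in the chart \<open>c\<close> by inserting local fields with constant representatives \<open>w\<close>.
\<close>

definition ricci ::
  "('a, 'n::finite) christoffel \<Rightarrow> ('a, 'n) vfield \<Rightarrow> ('a, 'n) vfield \<Rightarrow> ('a, 'n) density" where
  "ricci \<Gamma> \<xi> \<eta> = (\<lambda>c x. trace (matrix (\<lambda>w. riemann \<Gamma> (\<lambda>_ _. w) \<xi> \<eta> c x)))"

definition asym_tangentially_ricci_flat ::
  "'a topology \<Rightarrow> ('a, 'n::finite) chart set \<Rightarrow> ('a, 'n) bform \<Rightarrow> bool" where
  "asym_tangentially_ricci_flat X A g \<longleftrightarrow> (\<exists>\<Gamma>. levi_civita X A g \<Gamma> \<and>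
     (\<forall>\<xi> \<eta>. vector_field A (topspace X) \<xi> \<and> vector_field A (topspace X) \<eta> \<and>
        (vector_field_tangent A (topspace X) \<xi> \<or> vector_field_tangent A (topspace X) \<eta>) \<longrightarrow>
        (\<exists>F. extends_fun X A (topspace X) (ricci \<Gamma> \<xi> \<eta>) F \<and>
           (vector_field_tangent A (topspace X) \<xi> \<and> vector_field_tangent A (topspace X) \<eta> \<longrightarrow>
              (\<forall>p\<in>bdry A. F p = 0)))))"


section \<open>The tractor metric and the curved orbits in the boundary\<close>

text \<open>The section \<open>\<sigma>\<close> of \<open>\<E>(1)\<close> over \<open>M\<close>, i.e. the power \<open>-1/(n+2)\<close> of the volume density of \<open>g\<close>.\<close>

definition vol_scale :: "('a, 'n::finite) bform \<Rightarrow> ('a, 'n) density" where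
  "vol_scale g = (\<lambda>c x.
     sqrt \<bar>det (\<chi> i j. g c x (axis i 1) (axis j 1))\<bar> powr (- 1 / (real CARD('n) + 2)))"

text \<open>
  A smooth section of \<open>S\<^sup>2(T\<^sup>b)\<^sup>*(2)\<close> is a symmetric pairing on the sheaf of sections of \<open>T\<^sup>b\<close>, that is,
  of vector fields tangent to the boundary, which has values in smooth sections of \<open>\<E>(2)\<close> and is
  bilinear over smooth functions.  For a pairing \<open>B\<close> that restricts to \<open>\<sigma>\<^sup>2 g\<close> on \<open>M\<close>, symmetry,
  bilinearity and compatibility with restrictions follow, since \<open>M\<close> is dense.
\<close>

definition extends_to_b_metric ::
  "'a topology \<Rightarrow> ('a, 'n::finite) chart set \<Rightarrow> ('a, 'n) bform \<Rightarrow>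
    (('a, 'n) vfield \<Rightarrow> ('a, 'n) vfield \<Rightarrow> ('a, 'n) density) \<Rightarrow> bool" where
  "extends_to_b_metric X A g B \<longleftrightarrow>
     (\<forall>U \<xi> \<eta>. openin X U \<and> vector_field_tangent A U \<xi> \<and> vector_field_tangent A U \<eta> \<longrightarrow>
        density_field A U 2 (B \<xi> \<eta>) \<and>
        (\<forall>c\<in>A. \<forall>x\<in>coord c (U \<inter> mint X A).
           B \<xi> \<eta> c x = (vol_scale g c x)\<^sup>2 * g c x (\<xi> c x) (\<eta> c x)))"

text \<open>
  The extension of \<open>\<sigma>\<^sup>2 g\<close>, whose boundary value is the tractor metric.  It is unique, again by density
  of \<open>M\<close>, up to values of local representatives outside the domains of the arguments.
\<close>

definition tractor_metric ::
  "'a topology \<Rightarrow> ('a, 'n::finite) chart set \<Rightarrow> ('a, 'n) bform \<Rightarrow>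
    ('a, 'n) vfield \<Rightarrow> ('a, 'n) vfield \<Rightarrow> ('a, 'n) density" where
  "tractor_metric X A g = (SOME B. extends_to_b_metric X A g B)"

text \<open>
  The canonical line in the tractor bundle over \<open>p\<close> is spanned by the boundary value of \<open>\<rho> \<nu>\<close>, tensored
  with \<open>\<E>(-1)\<close>, for \<open>\<rho>\<close> and \<open>\<nu>\<close> as follows.  As \<open>\<E>(2)\<close> is oriented, the sign of the tractor metric on
  this line is the sign of any representative of its value on \<open>(\<rho> \<nu>, \<rho> \<nu>)\<close>.
\<close>

definition transversal_pair ::
  "'a topology \<Rightarrow> ('a, 'n::finite) chart set \<Rightarrow> 'a \<Rightarrow> 'a set \<Rightarrow> ('a \<Rightarrow> real) \<Rightarrow> ('a, 'n) vfield \<Rightarrow> bool" where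
  "transversal_pair X A p U \<rho> \<nu> \<longleftrightarrow> p \<in> U \<and> local_defining X A U \<rho> \<and> vector_field A U \<nu> \<and>
     (\<forall>c\<in>A. \<forall>x\<in>coord c (U \<inter> bdry A). differential \<rho> c x (\<nu> c x) = 1)"

definition bdry_plus :: "'a topology \<Rightarrow> ('a, 'n::finite) chart set \<Rightarrow> ('a, 'n) bform \<Rightarrow> 'a set" where
  "bdry_plus X A g = {p \<in> bdry A. \<exists>U \<rho> \<nu>. transversal_pair X A p U \<rho> \<nu> \<and>
     (\<forall>c\<in>A. p \<in> fst c \<longrightarrow>
        tractor_metric X A g (scale_field \<rho> \<nu>) (scale_field \<rho> \<nu>) c (snd c p) > 0)}"

definition bdry_minus :: "'a topology \<Rightarrow> ('a, 'n::finite) chart set \<Rightarrow> ('a, 'n) bform \<Rightarrow> 'a set" where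
  "bdry_minus X A g = {p \<in> bdry A. \<exists>U \<rho> \<nu>. transversal_pair X A p U \<rho> \<nu> \<and>
     (\<forall>c\<in>A. p \<in> fst c \<longrightarrow>
        tractor_metric X A g (scale_field \<rho> \<nu>) (scale_field \<rho> \<nu>) c (snd c p) < 0)}"

definition nondegenerate_on_bdry ::
  "('a, 'n::finite) chart set \<Rightarrow> 'a set \<Rightarrow> ('a, 'n) bform \<Rightarrow> bool" where
  "nondegenerate_on_bdry A U h \<longleftrightarrow>
     (\<forall>c\<in>A. \<forall>x\<in>coord c (U \<inter> bdry A). \<forall>v. v $ None = 0 \<and>
        (\<forall>w. w $ None = 0 \<longrightarrow> h c x v w = 0) \<longrightarrow> v = 0)"

end

theory Submission
  imports Defs
begin

text \<open>
  Near a boundary point take a chart with transversal coordinate \<open>x\<^sub>0\<close> and put \<open>E\<^sub>0 = x\<^sub>0 \<partial>\<^sub>0\<close>, \<open>E\<^sub>i = \<partial>\<^sub>i\<close>; this is a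
  frame of the b-tangent bundle. Let \<open>G\<^sub>a\<^sub>b = x\<^sub>0\<^sup>2 g(E\<^sub>a, E\<^sub>b)\<close>, a matrix of functions on the interior. The whole
  proof rests on the fact that \<open>G\<close> extends smoothly and invertibly to the boundary.

  Pre-compactness controls the symbols of \<open>\<nabla>\<^sup>\<rho>\<close> for \<open>\<rho> = x\<^sub>0\<close>. It makes the symbols of \<open>\<nabla>\<close> in the frame
  \<open>x\<^sub>0 E\<^sub>a\<close> smooth up to the boundary, except for those which are the quotients by \<open>x\<^sub>0\<close> of the transversal
  components \<open>\<nu>\<close> of \<open>\<nabla>\<^sup>\<rho>\<^sub>a \<partial>\<^sub>i\<close>. The functions \<open>x\<^sub>0 Ric(\<partial>\<^sub>a, \<partial>\<^sub>i)\<close> extend to the boundary, and their values there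
  are an invertible linear expression in \<open>\<nu>\<close> (\<open>scaled_ricci\<close>). So \<open>\<nu>\<close> vanishes on the boundary if these
  components of the Ricci tensor extend
  (\<open>\<nu>_boundary\<close>) and can be divided by \<open>x\<^sub>0\<close>. Now \<open>\<nabla> g = 0\<close> is an overdetermined linear system
  \<open>\<partial>\<^sub>c G = \<Theta>\<^sub>c G + G \<Theta>\<^sub>c\<^sup>T\<close> with smooth coefficients. Interior solutions of such systems extend smoothly
  (\<open>linear_system_extends\<close>), and the inverse of \<open>G\<close> solves a system of the same kind, whence \<open>det G\<close> does not
  vanish on the boundary. On the boundary the system says in particular that \<open>\<partial>\<^sub>j G\<^sub>0\<^sub>0 = - 2 G\<^sub>0\<^sub>j\<close>
  (\<open>bderiv_G_boundary\<close>). This is what parallelism of the tractor metric amounts to here.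

  Since \<open>\<sigma>\<^sup>2 g(\<xi>, \<eta>)\<close> is \<open>\<bar>det G\<bar> powr (-1/(n+2))\<close> times the value of \<open>G\<close> on the frame coefficients of \<open>\<xi>\<close> and
  \<open>\<eta>\<close>, the extension exists globally, and on the canonical line it has the sign of \<open>G\<^sub>0\<^sub>0\<close>
  (\<open>tractor_metric_canonical_line\<close>). So \<open>\<epsilon> G\<^sub>0\<^sub>0 > 0\<close> near the given point.

  The defining function is \<open>\<phi> x\<^sub>0\<close> with \<open>\<phi> = \<bar>G\<^sub>0\<^sub>0\<bar> powr (-1/2)\<close>. It normalizes the leading coefficient of \<open>g\<close>
  to \<open>\<epsilon>\<close>, and \<open>C\<close> can be chosen such that \<open>h\<^sub>0\<^sub>0 = 0\<close>. The residue of \<open>h\<^sub>0\<^sub>i\<close> is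
  \<open>\<phi>\<^sup>2 G\<^sub>0\<^sub>i - \<epsilon> \<partial>\<^sub>i \<phi> / \<phi>\<close>, which is zero because of \<open>\<partial>\<^sub>i G\<^sub>0\<^sub>0 = - 2 G\<^sub>0\<^sub>i\<close>. Finally the tangential part of \<open>h\<close> on the
  boundary is \<open>\<phi>\<^sup>2\<close> times the Schur complement of \<open>G\<^sub>0\<^sub>0\<close> in \<open>G\<close>, hence non-degenerate (\<open>normal_form\<close>).
\<close>

section \<open>Calculus of iteratively differentiable maps\<close>

text \<open>A condition under which derivatives within a set are unique. It covers open sets as well as relatively
  open subsets of the half-space, so that the calculus is developed for both at once.\<close>

definition thick :: "'a::euclidean_space set \<Rightarrow> bool" where
  "thick S \<longleftrightarrow> (\<forall>x\<in>S. \<forall>i\<in>Basis. \<forall>e>0. \<exists>d. 0 < \<bar>d\<bar> \<and> \<bar>d\<bar> < e \<and> x + d *\<^sub>R i \<in> S)"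

lemma thick_open:
  assumes "open S"
  shows "thick S"
  unfolding thick_def
proof (intro ballI allI impI)
  fix x i :: 'a and e :: real
  assume x: "x \<in> S" and i: "i \<in> Basis" and e: "0 < e"
  obtain r where r: "r > 0" "ball x r \<subseteq> S"
    using assms x openE by blast
  have "x + (min e r / 2) *\<^sub>R i \<in> ball x r"
    using r e i by (auto simp: dist_norm)
  then show "\<exists>d. 0 < \<bar>d\<bar> \<and> \<bar>d\<bar> < e \<and> x + d *\<^sub>R i \<in> S"
    using r e by (intro exI[of _ "min e r / 2"]) auto
qed

lemma frechet_derivative_thick:
  assumes "thick S" "x \<in> S" "(f has_derivative f') (at x within S)"
  shows "frechet_derivative f (at x within S) = f'"
proof -
  have "(f has_derivative frechet_derivative f (at x within S)) (at x within S)"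
    using assms(3) frechet_derivative_works differentiable_def by blast
  then show ?thesis
    using assms unfolding thick_def
    by (intro frechet_derivative_unique_within[OF _ assms(3)]) auto
qed

lemma frechet_derivative_cong_on:
  assumes "x \<in> S" "\<And>y. y \<in> S \<Longrightarrow> f y = g y"
  shows "frechet_derivative f (at x within S) = frechet_derivative g (at x within S)"
proof -
  have "(f has_derivative D) (at x within S) \<longleftrightarrow> (g has_derivative D) (at x within S)" for D
    using assms has_derivative_transform[of x S f g] has_derivative_transform[of x S g f] by auto
  then show ?thesis unfolding frechet_derivative_def by presburger
qed

declare Ck_on.simps(2) [simp del]
lemmas Ck_on_Suc = Ck_on.simps(2)

lemma Ck_on_cong:
  assumes "\<And>x. x \<in> S \<Longrightarrow> f x = g x"
  shows "Ck_on k S f \<longleftrightarrow> Ck_on k S g"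
  using assms
proof (induction k arbitrary: f g)
  case 0
  then show ?case by (auto cong: continuous_on_cong)
next
  case (Suc k)
  have d: "f differentiable_on S \<longleftrightarrow> g differentiable_on S"
    unfolding differentiable_on_def differentiable_def
    using Suc.prems by (metis has_derivative_transform)
  have "Ck_on k S (\<lambda>x. frechet_derivative f (at x within S) v) \<longleftrightarrow>
        Ck_on k S (\<lambda>x. frechet_derivative g (at x within S) v)" for v
    by (rule Suc.IH) (use Suc.prems frechet_derivative_cong_on in metis)
  then show ?case using d by (simp add: Ck_on_Suc)
qed

lemma Ck_on_eq: "Ck_on k S f \<Longrightarrow> (\<And>x. x \<in> S \<Longrightarrow> f x = g x) \<Longrightarrow> Ck_on k S g"
  using Ck_on_cong[of S f g k] by blast

lemma smooth_on_eq: "smooth_on S f \<Longrightarrow> (\<And>x. x \<in> S \<Longrightarrow> f x = g x) \<Longrightarrow> smooth_on S g"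
  unfolding smooth_on_def using Ck_on_eq by blast

lemma Ck_on_Suc_derivative:
  "Ck_on (Suc k) S f \<Longrightarrow> x \<in> S \<Longrightarrow>
    (f has_derivative frechet_derivative f (at x within S)) (at x within S)"
  by (auto simp: differentiable_on_def frechet_derivative_works Ck_on_Suc)

lemma Ck_on_SucI:
  assumes "thick S" "\<And>x. x \<in> S \<Longrightarrow> (f has_derivative f' x) (at x within S)"
    and "\<And>v. Ck_on k S (\<lambda>x. f' x v)"
  shows "Ck_on (Suc k) S f"
proof -
  have "Ck_on k S (\<lambda>x. frechet_derivative f (at x within S) v) \<longleftrightarrow> Ck_on k S (\<lambda>x. f' x v)" for v
    by (rule Ck_on_cong) (simp add: frechet_derivative_thick[OF assms(1) _ assms(2)])
  moreover have "f differentiable_on S"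
    using assms(2) unfolding differentiable_on_def differentiable_def by blast
  ultimately show ?thesis using assms(3) by (simp add: Ck_on_Suc)
qed

lemma Ck_on_Suc_derivative_Ck:
  "Ck_on (Suc k) S f \<Longrightarrow> Ck_on k S (\<lambda>x. frechet_derivative f (at x within S) v)"
  by (simp add: Ck_on_Suc)

lemma Ck_on_Suc_imp: "Ck_on (Suc k) S f \<Longrightarrow> Ck_on k S f"
proof (induction k arbitrary: f)
  case 0
  then show ?case by (simp add: differentiable_imp_continuous_on Ck_on_Suc)
next
  case (Suc k)
  then show ?case by (auto simp: Ck_on_Suc[of k] Ck_on_Suc[of "Suc k"])
qed

lemma Ck_on_const [simp]: "thick S \<Longrightarrow> Ck_on k S (\<lambda>x. c)"
proof (induction k arbitrary: c)
  case (Suc k)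
  show ?case by (rule Ck_on_SucI[where f' = "\<lambda>_ _. 0"]) (use Suc in auto)
qed simp

lemma Ck_on_linear_image:
  assumes "thick S" "bounded_linear L" "Ck_on k S f"
  shows "Ck_on k S (\<lambda>x. L (f x))"
  using assms(3)
proof (induction k arbitrary: f)
  case 0
  then show ?case
    using assms(2) by (auto intro: bounded_linear.continuous_on)
next
  case (Suc k)
  show ?case
  proof (rule Ck_on_SucI[OF assms(1), where f' = "\<lambda>x v. L (frechet_derivative f (at x within S) v)"])
    show "((\<lambda>x. L (f x)) has_derivative (\<lambda>v. L (frechet_derivative f (at x within S) v))) (at x within S)"
      if "x \<in> S" for x
      by (rule bounded_linear.has_derivative[OF assms(2) Ck_on_Suc_derivative[OF Suc.prems that]])
    show "Ck_on k S (\<lambda>x. L (frechet_derivative f (at x within S) v))" for v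
      by (rule Suc.IH[OF Ck_on_Suc_derivative_Ck[OF Suc.prems]])
  qed
qed

lemma Ck_on_add:
  assumes "thick S" "Ck_on k S f" "Ck_on k S g"
  shows "Ck_on k S (\<lambda>x. f x + g x)"
  using assms(2,3)
proof (induction k arbitrary: f g)
  case 0
  then show ?case by (auto intro: continuous_on_add)
next
  case (Suc k)
  show ?case
  proof (rule Ck_on_SucI[OF assms(1), where f' = "\<lambda>x v. frechet_derivative f (at x within S) v
        + frechet_derivative g (at x within S) v"])
    show "Ck_on k S (\<lambda>x. frechet_derivative f (at x within S) v + frechet_derivative g (at x within S) v)" for v
      by (rule Suc.IH; rule Ck_on_Suc_derivative_Ck; rule Suc.prems)
  qed (intro has_derivative_add Ck_on_Suc_derivative[OF Suc.prems(1)] Ck_on_Suc_derivative[OF Suc.prems(2)])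
qed

lemma Ck_on_bilinear:
  assumes "thick S" "bounded_bilinear B" "Ck_on k S f" "Ck_on k S g"
  shows "Ck_on k S (\<lambda>x. B (f x) (g x))"
  using assms(3,4)
proof (induction k arbitrary: f g)
  case 0
  then show ?case using assms(2) by (auto intro: bounded_bilinear.continuous_on)
next
  case (Suc k)
  show ?case
  proof (rule Ck_on_SucI[OF assms(1), where f' = "\<lambda>x v. B (f x) (frechet_derivative g (at x within S) v)
       + B (frechet_derivative f (at x within S) v) (g x)"])
    show "Ck_on k S (\<lambda>x. B (f x) (frechet_derivative g (at x within S) v)
       + B (frechet_derivative f (at x within S) v) (g x))" for v
      by (intro Ck_on_add[OF assms(1)] Suc.IH Ck_on_Suc_imp[OF Suc.prems(1)] Ck_on_Suc_imp[OF Suc.prems(2)]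
          Ck_on_Suc_derivative_Ck[OF Suc.prems(1)] Ck_on_Suc_derivative_Ck[OF Suc.prems(2)])
  qed (intro bounded_bilinear.FDERIV[OF assms(2)] Ck_on_Suc_derivative[OF Suc.prems(1)] Ck_on_Suc_derivative[OF Suc.prems(2)])
qed

lemma Ck_on_sum:
  assumes "thick S" "\<And>i. i \<in> I \<Longrightarrow> Ck_on k S (f i)"
  shows "Ck_on k S (\<lambda>x. \<Sum>i\<in>I. f i x)"
  using assms(2)
  by (induction I rule: infinite_finite_induct) (auto intro!: Ck_on_add Ck_on_const assms(1))

lemma linear_Basis_expansion:
  fixes f :: "'a::euclidean_space \<Rightarrow> 'b::real_vector"
  assumes "linear f"
  shows "f v = (\<Sum>b\<in>Basis. (v \<bullet> b) *\<^sub>R f b)"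
proof -
  have "f v = f (\<Sum>b\<in>Basis. (v \<bullet> b) *\<^sub>R b)" by (simp add: euclidean_representation)
  then show ?thesis using assms by (simp add: linear_sum linear_scale)
qed

lemma Ck_on_SucI_Basis:
  fixes f :: "'a::euclidean_space \<Rightarrow> 'b::real_normed_vector"
  assumes "thick S" and d: "\<And>x. x \<in> S \<Longrightarrow> (f has_derivative f' x) (at x within S)"
    and "\<And>b. b \<in> Basis \<Longrightarrow> Ck_on k S (\<lambda>x. f' x b)"
  shows "Ck_on (Suc k) S f"
proof (rule Ck_on_SucI[where f' = f'])
  fix v
  have "Ck_on k S (\<lambda>x. \<Sum>b\<in>Basis. (v \<bullet> b) *\<^sub>R f' x b)"
    by (intro Ck_on_sum Ck_on_linear_image[OF _ bounded_linear_scaleR_right] assms(1,3))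
  then show "Ck_on k S (\<lambda>x. f' x v)"
  proof (rule Ck_on_eq)
    fix x assume "x \<in> S"
    then have "linear (f' x)" by (rule has_derivative_linear[OF d])
    then show "(\<Sum>b\<in>Basis. (v \<bullet> b) *\<^sub>R f' x b) = f' x v"
      using linear_Basis_expansion[of "f' x" v] by simp
  qed
qed (use assms in blast)+

lemma Ck_on_compose:
  fixes g :: "'a::euclidean_space \<Rightarrow> 'b::euclidean_space" and f :: "'b \<Rightarrow> 'c::real_normed_vector"
  assumes "thick S" "Ck_on k S g" "g ` S \<subseteq> T" "Ck_on k T f"
  shows "Ck_on k S (\<lambda>x. f (g x))"
  using assms(2,4)
proof (induction k arbitrary: f)
  case 0
  then show ?case using assms(3) by (auto intro: continuous_on_compose2)
next
  case (Suc k)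
  define D where "D x = frechet_derivative g (at x within S)" for x
  define E where "E y = frechet_derivative f (at y within T)" for y
  have D: "(g has_derivative D x) (at x within S)" if "x \<in> S" for x
    using Ck_on_Suc_derivative[OF Suc.prems(1) that] unfolding D_def .
  have E: "(f has_derivative E y) (at y within T)" if "y \<in> T" for y
    using Ck_on_Suc_derivative[OF Suc.prems(2) that] unfolding E_def .
  have c: "((\<lambda>x. f (g x)) has_derivative (\<lambda>v. E (g x) (D x v))) (at x within S)" if "x \<in> S" for x
    using has_derivative_in_compose[OF D[OF that], of f "E (g x)"] E[of "g x"] that assms(3)
    by (meson has_derivative_subset image_subset_iff)
  \<comment> \<open>The induction hypothesis concerns derivatives in a fixed direction. So the direction \<open>D x v\<close>,
    which varies with \<open>x\<close>, is expanded in a basis.\<close>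
  have Ck: "Ck_on k S (\<lambda>x. \<Sum>b\<in>Basis. (D x v \<bullet> b) *\<^sub>R E (g x) b)" for v
  proof (intro Ck_on_sum Ck_on_bilinear[OF _ bounded_bilinear_scaleR] assms(1))
    fix b :: 'b
    have "Ck_on k S (\<lambda>x. D x v)" using Suc.prems(1) by (simp add: D_def Ck_on_Suc)
    then show "Ck_on k S (\<lambda>x. D x v \<bullet> b)"
      by (rule Ck_on_linear_image[OF assms(1) bounded_linear_inner_left])
    show "Ck_on k S (\<lambda>x. E (g x) b)"
      unfolding E_def by (intro Suc.IH Ck_on_Suc_imp[OF Suc.prems(1)] Ck_on_Suc_derivative_Ck[OF Suc.prems(2)])
  qed
  have eq: "(\<Sum>b\<in>Basis. (D x v \<bullet> b) *\<^sub>R E (g x) b) = E (g x) (D x v)" if "x \<in> S" for x v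
  proof -
    have "linear (E (g x))" 
      by (rule has_derivative_linear[OF E]) (use that assms(3) in auto)
    then show ?thesis using linear_Basis_expansion[of "E (g x)" "D x v"] by simp
  qed
  show ?case
  proof (rule Ck_on_SucI[where f' = "\<lambda>x v. E (g x) (D x v)"])
    show "Ck_on k S (\<lambda>x. E (g x) (D x v))" for v
      by (rule Ck_on_eq[OF Ck]) (rule eq)
  qed (use assms(1) c in auto)
qed

lemma at_within_openin:
  assumes "openin (top_of_set S) V" "x \<in> V"
  shows "at x within V = at x within S"
proof -
  obtain O' where "open O'" "V = S \<inter> O'" using assms(1) by (auto simp: openin_open)
  then show ?thesis using assms(2) by (intro at_within_nhd[of x O']) auto
qed

lemma Ck_on_openin:
  assumes "openin (top_of_set S) V" "Ck_on k S f"
  shows "Ck_on k V f"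
  using assms(2)
proof (induction k arbitrary: f)
  case 0
  then show ?case using assms(1) by (auto intro: continuous_on_subset dest: openin_imp_subset)
next
  case (Suc k)
  have "V \<subseteq> S" using assms(1) openin_imp_subset by blast
  then have "f differentiable_on V"
    using Suc.prems differentiable_on_subset by (auto simp: Ck_on_Suc)
  moreover have "Ck_on k V (\<lambda>x. frechet_derivative f (at x within V) v)" for v
    using Suc Ck_on_cong[of V "\<lambda>x. frechet_derivative f (at x within V) v"
        "\<lambda>x. frechet_derivative f (at x within S) v"] at_within_openin[OF assms(1)] by (auto simp: Ck_on_Suc)
  ultimately show ?case by (simp add: Ck_on_Suc)
qed

lemma Ck_on_local:
  assumes "\<And>x. x \<in> S \<Longrightarrow> \<exists>V. x \<in> V \<and> openin (top_of_set S) V \<and> Ck_on k V f"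
  shows "Ck_on k S f"
  using assms
proof (induction k arbitrary: f)
  case 0
  show ?case unfolding Ck_on.simps continuous_on_eq_continuous_within
  proof
    fix x assume "x \<in> S"
    then obtain V where V: "x \<in> V" "openin (top_of_set S) V" "Ck_on 0 V f" using 0 by blast
    then have "continuous (at x within V) f" by (simp add: continuous_on_eq_continuous_within)
    then show "continuous (at x within S) f" using at_within_openin[OF V(2) V(1)] by simp
  qed
next
  case (Suc k)
  have "f differentiable_on S" unfolding differentiable_on_def
  proof
    fix x assume "x \<in> S"
    then obtain V where V: "x \<in> V" "openin (top_of_set S) V" "Ck_on (Suc k) V f" using Suc.prems by blast
    then have "f differentiable (at x within V)" by (simp add: differentiable_on_def Ck_on_Suc)
    then show "f differentiable (at x within S)" using at_within_openin[OF V(2) V(1)] by simp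
  qed
  moreover have "Ck_on k S (\<lambda>x. frechet_derivative f (at x within S) v)" for v
  proof (rule Suc.IH)
    fix x assume "x \<in> S"
    then obtain V where V: "x \<in> V" "openin (top_of_set S) V" "Ck_on (Suc k) V f" using Suc.prems by blast
    then have "Ck_on k V (\<lambda>x. frechet_derivative f (at x within V) v)" by (simp add: Ck_on_Suc)
    then have "Ck_on k V (\<lambda>x. frechet_derivative f (at x within S) v)"
      using Ck_on_cong[of V "\<lambda>x. frechet_derivative f (at x within V) v"
        "\<lambda>x. frechet_derivative f (at x within S) v"] at_within_openin[OF V(2)] by auto
    then show "\<exists>V. x \<in> V \<and> openin (top_of_set S) V \<and>
        Ck_on k V (\<lambda>x. frechet_derivative f (at x within S) v)"
      using V(1,2) by (intro exI[of _ V] conjI)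
  qed
  ultimately show ?case by (simp add: Ck_on_Suc)
qed

subsection \<open>Smooth maps\<close>

named_theorems smooth_intros

lemma smooth_on_continuous: "smooth_on S f \<Longrightarrow> continuous_on S f"
  unfolding smooth_on_def by (metis Ck_on.simps(1))

lemma smooth_on_has_derivative:
  "smooth_on S f \<Longrightarrow> x \<in> S \<Longrightarrow>
    (f has_derivative frechet_derivative f (at x within S)) (at x within S)"
  unfolding smooth_on_def using Ck_on_Suc_derivative by blast

lemma smooth_on_derivative:
  "smooth_on S f \<Longrightarrow> smooth_on S (\<lambda>x. frechet_derivative f (at x within S) v)"
  unfolding smooth_on_def using Ck_on_Suc_derivative_Ck by blast

lemma smooth_on_openin: "openin (top_of_set S) V \<Longrightarrow> smooth_on S f \<Longrightarrow> smooth_on V f"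
  unfolding smooth_on_def using Ck_on_openin by blast

lemma smooth_on_local:
  "(\<And>x. x \<in> S \<Longrightarrow> \<exists>V. x \<in> V \<and> openin (top_of_set S) V \<and> smooth_on V f) \<Longrightarrow> smooth_on S f"
  unfolding smooth_on_def using Ck_on_local by metis

lemma smooth_on_const [smooth_intros]: "thick S \<Longrightarrow> smooth_on S (\<lambda>x. c)"
  unfolding smooth_on_def by simp

lemma smooth_on_linear_image:
  "bounded_linear L \<Longrightarrow> thick S \<Longrightarrow> smooth_on S f \<Longrightarrow> smooth_on S (\<lambda>x. L (f x))"
  unfolding smooth_on_def using Ck_on_linear_image by blast

lemma smooth_on_id [smooth_intros]:
  assumes "thick S" shows "smooth_on S (\<lambda>x. x)"
  unfolding smooth_on_def
proof
  fix k show "Ck_on k S (\<lambda>x. x)"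
  proof (cases k)
    case (Suc k)
    show ?thesis unfolding Suc
      by (rule Ck_on_SucI[OF assms, where f' = "\<lambda>_ v. v"]) (auto simp: assms)
  qed (auto intro: continuous_on_id)
qed

lemma smooth_on_bilinear:
  "bounded_bilinear B \<Longrightarrow> thick S \<Longrightarrow> smooth_on S f \<Longrightarrow> smooth_on S g \<Longrightarrow>
    smooth_on S (\<lambda>x. B (f x) (g x))"
  unfolding smooth_on_def using Ck_on_bilinear by blast

lemma smooth_on_add [smooth_intros]:
  "thick S \<Longrightarrow> smooth_on S f \<Longrightarrow> smooth_on S g \<Longrightarrow> smooth_on S (\<lambda>x. f x + g x)"
  unfolding smooth_on_def using Ck_on_add by blast

lemma smooth_on_sum [smooth_intros]:
  "thick S \<Longrightarrow> (\<And>i. i \<in> I \<Longrightarrow> smooth_on S (f i)) \<Longrightarrow> smooth_on S (\<lambda>x. \<Sum>i\<in>I. f i x)"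
  unfolding smooth_on_def by (intro allI Ck_on_sum) simp_all

lemma smooth_on_minus [smooth_intros]: "thick S \<Longrightarrow> smooth_on S f \<Longrightarrow> smooth_on S (\<lambda>x. - f x)"
  by (rule smooth_on_linear_image[OF bounded_linear_minus[OF bounded_linear_ident]])

lemma smooth_on_diff [smooth_intros]:
  "thick S \<Longrightarrow> smooth_on S f \<Longrightarrow> smooth_on S g \<Longrightarrow> smooth_on S (\<lambda>x. f x - g x)"
  using smooth_on_add[of S f "\<lambda>x. - g x"] smooth_on_minus[of S g] by simp

lemmas smooth_on_scaleR [smooth_intros] = smooth_on_bilinear[OF bounded_bilinear_scaleR]
lemmas smooth_on_inner [smooth_intros] = smooth_on_bilinear[OF bounded_bilinear_inner]

lemma smooth_on_mult [smooth_intros]: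
  fixes f g :: "'a::euclidean_space \<Rightarrow> real"
  shows "thick S \<Longrightarrow> smooth_on S f \<Longrightarrow> smooth_on S g \<Longrightarrow> smooth_on S (\<lambda>x. f x * g x)"
  by (rule smooth_on_bilinear[OF bounded_bilinear_mult])

lemma smooth_on_power [smooth_intros]:
  fixes f :: "'a::euclidean_space \<Rightarrow> real"
  shows "thick S \<Longrightarrow> smooth_on S f \<Longrightarrow> smooth_on S (\<lambda>x. f x ^ m)"
  by (induction m) (simp_all add: smooth_on_const smooth_on_mult)

lemma smooth_on_prod [smooth_intros]:
  fixes f :: "'i \<Rightarrow> 'a::euclidean_space \<Rightarrow> real"
  assumes "thick S" "\<And>i. i \<in> I \<Longrightarrow> smooth_on S (f i)"
  shows "smooth_on S (\<lambda>x. \<Prod>i\<in>I. f i x)"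
  using assms(2)
  by (induction I rule: infinite_finite_induct) (simp_all add: smooth_on_mult smooth_on_const assms(1))

lemma smooth_on_compose:
  fixes g :: "'a::euclidean_space \<Rightarrow> 'b::euclidean_space"
  shows "thick S \<Longrightarrow> smooth_on S g \<Longrightarrow> g ` S \<subseteq> T \<Longrightarrow> smooth_on T f \<Longrightarrow> smooth_on S (\<lambda>x. f (g x))"
  unfolding smooth_on_def by (intro allI Ck_on_compose[where f = f and g = g and T = T]) simp_all

lemma smooth_on_nth [smooth_intros]:
  fixes f :: "'a::euclidean_space \<Rightarrow> 'b::real_normed_vector ^ 'm"
  shows "thick S \<Longrightarrow> smooth_on S f \<Longrightarrow> smooth_on S (\<lambda>x. f x $ i)"
  by (rule smooth_on_linear_image[OF bounded_linear_vec_nth])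

lemma smooth_on_vec_lambda [smooth_intros]:
  fixes f :: "'a::euclidean_space \<Rightarrow> 'm::finite \<Rightarrow> 'b::real_normed_vector"
  assumes "thick S" "\<And>i. smooth_on S (\<lambda>x. f x i)"
  shows "smooth_on S (\<lambda>x. \<chi> i. f x i)"
proof -
  have lin: "bounded_linear (\<lambda>y. (axis i y :: 'b ^ 'm))" for i
  proof
    show "\<exists>K. \<forall>x. norm (axis i x :: 'b ^ 'm) \<le> norm x * K"
      by (intro exI[of _ 1]) (simp add: norm_vec_def L2_set_def axis_def if_distrib[of norm]
        if_distrib[of "\<lambda>x. x ^ 2"] cong: if_cong)
  qed (auto simp: vec_eq_iff axis_def)
  have "(\<chi> i. f x i) = (\<Sum>i\<in>UNIV. axis i (f x i))" for x
    by (auto simp: vec_eq_iff axis_def if_distrib cong: if_cong)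
  then show ?thesis
    by (simp only:) (intro smooth_on_sum smooth_on_linear_image[OF lin] assms)
qed

lemma smooth_on_vec_iff:
  fixes f :: "'a::euclidean_space \<Rightarrow> 'b::real_normed_vector ^ 'm"
  assumes "thick S"
  shows "smooth_on S f \<longleftrightarrow> (\<forall>i. smooth_on S (\<lambda>x. f x $ i))"
  using smooth_on_vec_lambda[OF assms, of "\<lambda>x i. f x $ i"] smooth_on_nth[OF assms, of f] by auto

lemma smooth_on_det [smooth_intros]:
  fixes f :: "'a::euclidean_space \<Rightarrow> real ^ 'm ^ 'm"
  assumes "thick S" "\<And>i j. smooth_on S (\<lambda>x. f x $ i $ j)"
  shows "smooth_on S (\<lambda>x. det (f x))"
  unfolding det_def by (intro smooth_on_sum smooth_on_mult smooth_on_prod smooth_on_const assms)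

text \<open>For a function of one variable it suffices to name all derivatives.\<close>

lemma smooth_on_iterated_derivative:
  fixes F :: "nat \<Rightarrow> real \<Rightarrow> real"
  assumes "open T" and d: "\<And>k x. x \<in> T \<Longrightarrow> (F k has_real_derivative F (Suc k) x) (at x)"
  shows "smooth_on T (F k)"
  unfolding smooth_on_def
proof
  fix m show "Ck_on m T (F k)"
  proof (induction m arbitrary: k)
    case 0
    then show ?case
      using d by (auto intro!: continuous_at_imp_continuous_on DERIV_isCont)
  next
    case (Suc m)
    show ?case
    proof (rule Ck_on_SucI[OF thick_open[OF assms(1)], where f' = "\<lambda>x v. F (Suc k) x * v"])
      show "(F k has_derivative (*) (F (Suc k) x)) (at x within T)" if "x \<in> T" for x
        by (rule has_derivative_at_withinI) (use d[OF that, of k] in \<open>simp add: has_field_derivative_def\<close>)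
      show "Ck_on m T (\<lambda>x. F (Suc k) x * v)" for v
        by (rule Ck_on_linear_image[OF thick_open[OF assms(1)] bounded_linear_mult_left Suc])
    qed
  qed
qed

lemma smooth_on_powr_real: "smooth_on {0<..} (\<lambda>x::real. x powr a)"
proof -
  define F where "F k x = (\<Prod>i<k. a - real i) * x powr (a - real k)" for k and x :: real
  have "smooth_on {0<..} (F 0)"
  proof (rule smooth_on_iterated_derivative)
    fix k and x :: real assume "x \<in> {0<..}"
    then show "(F k has_real_derivative F (Suc k) x) (at x)"
      unfolding F_def
      by (auto intro!: derivative_eq_intros simp: algebra_simps)
  qed simp
  then show ?thesis by (rule smooth_on_eq) (simp add: F_def)
qed

lemma smooth_on_powr [smooth_intros]:
  fixes f :: "'a::euclidean_space \<Rightarrow> real"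
  assumes "thick S" "smooth_on S f" "\<And>x. x \<in> S \<Longrightarrow> 0 < f x"
  shows "smooth_on S (\<lambda>x. f x powr a)"
  by (rule smooth_on_compose[OF assms(1,2) _ smooth_on_powr_real]) (use assms(3) in auto)

lemma smooth_on_inverse [smooth_intros]:
  fixes f :: "'a::euclidean_space \<Rightarrow> real"
  assumes "thick S" "smooth_on S f" "\<And>x. x \<in> S \<Longrightarrow> f x \<noteq> 0"
  shows "smooth_on S (\<lambda>x. inverse (f x))"
proof -
  \<comment> \<open>Negative values of \<open>f\<close> are covered by powers of the positive function \<open>f\<^sup>2\<close>.\<close>
  have "smooth_on S (\<lambda>x. f x * (f x ^ 2) powr (-1))"
    using assms by (intro smooth_intros) auto
  moreover have "f x * (f x ^ 2) powr (-1) = inverse (f x)" if "x \<in> S" for x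
    using assms(3)[OF that] by (simp add: powr_minus_divide power2_eq_square field_simps)
  ultimately show ?thesis by (rule smooth_on_eq)
qed

lemma smooth_on_divide [smooth_intros]:
  fixes f :: "'a::euclidean_space \<Rightarrow> real"
  assumes "thick S" "smooth_on S f" "smooth_on S g" "\<And>x. x \<in> S \<Longrightarrow> g x \<noteq> 0"
  shows "smooth_on S (\<lambda>x. f x / g x)"
  unfolding divide_inverse by (intro smooth_on_mult smooth_on_inverse assms)

lemma smooth_on_abs_powr [smooth_intros]:
  fixes f :: "'a::euclidean_space \<Rightarrow> real"
  assumes "thick S" "smooth_on S f" "\<And>x. x \<in> S \<Longrightarrow> f x \<noteq> 0"
  shows "smooth_on S (\<lambda>x. \<bar>f x\<bar> powr a)"
proof -
  have "smooth_on S (\<lambda>x. (f x ^ 2) powr (a / 2))"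
    using assms by (intro smooth_intros) auto
  moreover have "(f x ^ 2) powr (a / 2) = \<bar>f x\<bar> powr a" if "x \<in> S" for x
  proof -
    have "(f x ^ 2) powr (a / 2) = (\<bar>f x\<bar> powr 2) powr (a / 2)"
      using assms(3)[OF that] by (simp add: powr_numeral)
    then show ?thesis by (simp only: powr_powr) simp
  qed
  ultimately show ?thesis by (rule smooth_on_eq)
qed

section \<open>Functions on the half-space up to its boundary\<close>

abbreviation hopen :: "('n::finite) coords set \<Rightarrow> bool" where
  "hopen S \<equiv> openin (top_of_set half_space) S"

abbreviation e\<^sub>0 :: "('n::finite) coords" where
  "e\<^sub>0 \<equiv> axis None 1"

definition pos :: "('n::finite) coords set \<Rightarrow> 'n coords set" where
  "pos S = {x \<in> S. 0 < x $ None}"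

definition hball :: "('n::finite) coords \<Rightarrow> real \<Rightarrow> 'n coords set" where
  "hball x r = ball x r \<inter> half_space"

lemma hopen_half_space [simp]: "hopen half_space"
  by simp

lemma hopenD: "hopen S \<Longrightarrow> x \<in> S \<Longrightarrow> 0 \<le> x $ None"
  using openin_imp_subset by (fastforce simp: half_space_def)

lemma convex_half_space: "convex (half_space :: ('n::finite) coords set)"
  unfolding half_space_def convex_def by auto

lemma hopen_hball: "hopen (hball x r)"
  unfolding hball_def by (simp add: openin_open_Int inf_commute)

lemma convex_hball: "convex (hball x r)"
  unfolding hball_def by (intro convex_Int convex_ball convex_half_space)

lemma hopen_contains_hcball:
  assumes "hopen S" "x \<in> S"
  obtains r where "0 < r" "cball x r \<inter> half_space \<subseteq> S"
proof -
  obtain O' where O: "open O'" "S = half_space \<inter> O'" using assms(1) by (auto simp: openin_open)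
  then obtain r where "0 < r" "cball x r \<subseteq> O'" using assms(2) open_contains_cball by blast
  then show ?thesis using that O by blast
qed

lemma hopen_contains_hball:
  assumes "hopen S" "x \<in> S"
  obtains r where "0 < r" "hball x r \<subseteq> S"
proof -
  obtain r where r: "0 < r" "cball x r \<inter> half_space \<subseteq> S" using hopen_contains_hcball[OF assms] .
  moreover have "hball x r \<subseteq> cball x r \<inter> half_space"
    using ball_subset_cball[of x r] unfolding hball_def by auto
  ultimately show ?thesis using that by blast
qed

lemma thick_hopen:
  fixes S :: "('n::finite) coords set"
  assumes "hopen S"
  shows "thick S"
  unfolding thick_def
proof (intro ballI allI impI)
  fix x i :: "'n coords" and e :: real
  assume x: "x \<in> S" and i: "i \<in> Basis" and e: "0 < e"
  obtain r where r: "r > 0" "hball x r \<subseteq> S"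
    using hopen_contains_hball[OF assms x] .
  obtain a where a: "i = axis a 1" using i by (auto simp: Basis_vec_def)
  define d where "d = min e r / 2"
  have d: "0 < d" "d < e" "d < r" using r e by (auto simp: d_def)
  have "x + d *\<^sub>R i \<in> hball x r"
    using hopenD[OF assms x] d i unfolding hball_def half_space_def
    by (auto simp: a dist_norm axis_def)
  then show "\<exists>d. 0 < \<bar>d\<bar> \<and> \<bar>d\<bar> < e \<and> x + d *\<^sub>R i \<in> S"
    using r d by (intro exI[of _ d]) auto
qed

lemma at_within_hopen: "hopen S \<Longrightarrow> x \<in> S \<Longrightarrow> at x within S = at x within half_space"
  by (rule at_within_openin)

lemma bderiv_eqI:
  "x \<in> half_space \<Longrightarrow> (f has_derivative D) (at x within half_space) \<Longrightarrow> bderiv f x = D"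
  by (rule frechet_derivative_thick[OF thick_hopen[OF hopen_half_space]])

lemma smooth_on_bderiv [smooth_intros]:
  assumes "hopen S" "smooth_on S f"
  shows "smooth_on S (\<lambda>x. bderiv f x v)"
  by (rule smooth_on_eq[OF smooth_on_derivative[OF assms(2)]]) (simp add: at_within_hopen[OF assms(1)])

lemma has_bderiv:
  assumes "hopen S" "smooth_on S f" "x \<in> S"
  shows "(f has_derivative bderiv f x) (at x within half_space)"
  using smooth_on_has_derivative[OF assms(2,3)] at_within_hopen[OF assms(1,3)] by simp

lemma linear_bderiv: "hopen S \<Longrightarrow> smooth_on S f \<Longrightarrow> x \<in> S \<Longrightarrow> linear (bderiv f x)"
  using has_bderiv has_derivative_linear by blast

lemma smooth_on_hopen_subset:
  assumes "hopen S" "hopen T" "T \<subseteq> S" "smooth_on S f"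
  shows "smooth_on T f"
  by (rule smooth_on_openin[OF openin_subset_trans[OF assms(2,3) openin_imp_subset[OF assms(1)]] assms(4)])

lemma bderiv_cong:
  assumes "hopen S" "x \<in> S" "\<And>y. y \<in> S \<Longrightarrow> f y = g y"
  shows "bderiv f x = bderiv g x"
  using frechet_derivative_cong_on[OF assms(2,3)] at_within_hopen[OF assms(1,2)] by simp

lemma pos_subset: "pos S \<subseteq> S" and pos_mono: "S \<subseteq> T \<Longrightarrow> pos S \<subseteq> pos T"
  and pos_pos: "x \<in> pos S \<Longrightarrow> 0 < x $ None"
  and posI: "x \<in> S \<Longrightarrow> 0 < x $ None \<Longrightarrow> x \<in> pos S"
  by (auto simp: pos_def)

lemma open_pos:
  assumes "hopen S" shows "open (pos S)"
proof -
  obtain O' where O: "open O'" "S = half_space \<inter> O'" using assms by (auto simp: openin_open)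
  then have "pos S = O' \<inter> {x. 0 < x $ None}" by (auto simp: pos_def half_space_def)
  then show ?thesis using O(1) by (simp add: open_Int open_halfspace_component_gt_cart)
qed

lemma hopen_pos:
  assumes "hopen S" shows "hopen (pos S)"
  using open_pos[OF assms] openin_imp_subset[OF assms] pos_subset
  by (metis open_subset order_trans)

lemma at_within_pos: "hopen S \<Longrightarrow> x \<in> pos S \<Longrightarrow> at x within half_space = at x"
  using at_within_hopen[OF hopen_pos] at_within_open[OF _ open_pos] by metis

lemma convex_pos: "convex S \<Longrightarrow> convex (pos S)"
proof -
  have "convex {x :: 'a coords. 0 < x $ None}"
    using convex_halfspace_gt[of 0 e\<^sub>0] by (simp add: inner_axis')
  then show "convex S \<Longrightarrow> convex (pos S)"
    unfolding pos_def by (simp add: convex_Int Collect_conj_eq)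
qed

text \<open>The interior is dense: from any point one can move a little in the direction of \<open>e\<^sub>0\<close>.\<close>

lemma islimpt_pos:
  fixes S :: "('n::finite) coords set"
  assumes "hopen S" "x \<in> S"
  shows "x islimpt pos S"
  unfolding islimpt_approachable
proof (intro allI impI)
  fix e :: real assume "0 < e"
  obtain r where r: "r > 0" "hball x r \<subseteq> S" using hopen_contains_hball[OF assms] .
  define d where "d = min e r / 2"
  have d: "0 < d" "d < e" "d < r" using r \<open>0 < e\<close> by (auto simp: d_def)
  define y where "y = x + d *\<^sub>R (e\<^sub>0 :: 'n coords)"
  have y: "y $ None = x $ None + d" by (simp add: y_def axis_def)
  have y': "dist y x = d" using d by (simp add: y_def dist_norm)
  have "y \<in> hball x r"
    using y y' d hopenD[OF assms] by (simp add: hball_def half_space_def dist_commute)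
  then have "y \<in> pos S" using r y d hopenD[OF assms] by (auto simp: pos_def)
  then show "\<exists>x'\<in>pos S. x' \<noteq> x \<and> dist x' x < e" using y' d by (intro bexI[of _ y]) auto
qed

lemma nonneg_from_pos:
  fixes f :: "('n::finite) coords \<Rightarrow> real"
  assumes "hopen S" "continuous_on S f" "\<And>y. y \<in> pos S \<Longrightarrow> 0 \<le> f y" "x \<in> S"
  shows "0 \<le> f x"
proof -
  have "(f \<longlongrightarrow> f x) (at x within pos S)"
    using assms(2,4) pos_subset unfolding continuous_on_def by (meson tendsto_within_subset)
  moreover have "eventually (\<lambda>y. 0 \<le> f y) (at x within pos S)"
    using assms(3) by (simp add: eventually_at_filter)
  moreover have "at x within pos S \<noteq> bot"
    using islimpt_pos[OF assms(1,4)] by (simp add: trivial_limit_within)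
  ultimately show ?thesis by (metis tendsto_lowerbound)
qed

lemma eq_from_pos:
  fixes f g :: "('n::finite) coords \<Rightarrow> 'b::real_normed_vector"
  assumes "hopen S" "continuous_on S f" "continuous_on S g" "\<And>y. y \<in> pos S \<Longrightarrow> f y = g y" "x \<in> S"
  shows "f x = g x"
proof -
  have "0 \<le> - norm (f x - g x)"
    by (rule nonneg_from_pos[OF assms(1) _ _ assms(5)]) (auto intro!: continuous_intros assms)
  then show ?thesis by simp
qed

text \<open>The mean value inequality bounds the increments of \<open>u - D x\<close> in the interior near \<open>x\<close>. By continuity the
  bound holds up to the boundary.\<close>

lemma has_derivative_up_to_boundary:
  fixes u :: "('n::finite) coords \<Rightarrow> 'b::real_normed_vector"
  assumes S: "hopen S" and u: "continuous_on S u"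
    and D: "\<And>x. x \<in> pos S \<Longrightarrow> (u has_derivative D x) (at x)"
    and cD: "\<And>v. continuous_on S (\<lambda>x. D x v)" and lin: "\<And>x. x \<in> S \<Longrightarrow> linear (D x)"
    and x: "x \<in> S"
  shows "(u has_derivative D x) (at x within S)"
  unfolding has_derivative_within_alt
proof (intro conjI allI impI)
  show "bounded_linear (D x)" using lin[OF x] linear_conv_bounded_linear by blast
  fix \<epsilon> :: real assume \<epsilon>: "0 < \<epsilon>"
  define N where "N = real (card (Basis :: 'n coords set))"
  have N: "0 < N" by (simp add: N_def card_gt_0_iff)
  have "eventually (\<lambda>y. \<forall>b\<in>Basis. norm (D y b - D x b) < \<epsilon> / N) (at x within S)"
  proof (rule eventually_ball_finite[OF finite_Basis], intro ballI)
    fix b :: "'n coords"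
    have "((\<lambda>y. D y b) \<longlongrightarrow> D x b) (at x within S)" using cD x by (simp add: continuous_on_def)
    then show "eventually (\<lambda>y. norm (D y b - D x b) < \<epsilon> / N) (at x within S)"
      using \<epsilon> N by (simp add: tendsto_iff dist_norm)
  qed
  then obtain d0 where d0: "0 < d0"
      "\<And>y. y \<in> S \<Longrightarrow> y \<noteq> x \<Longrightarrow> dist y x < d0 \<Longrightarrow> \<forall>b\<in>Basis. norm (D y b - D x b) < \<epsilon> / N"
    unfolding eventually_at by blast
  obtain r where r: "r > 0" "hball x r \<subseteq> S" using hopen_contains_hball[OF S x] .
  define d where "d = min d0 r"
  define H where "H = hball x d"
  have H: "H \<subseteq> S" "hopen H" "convex H" "x \<in> H" "\<And>y. y \<in> H \<Longrightarrow> dist y x < d0"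
    using r d0 hopenD[OF S x] hopen_hball convex_hball
    by (auto simp: d_def H_def hball_def half_space_def dist_commute)
  have small: "norm (D y v - D x v) \<le> norm v * \<epsilon>" if "y \<in> H" for y v
  proof (cases "y = x")
    case False
    have l: "linear (\<lambda>v. D y v - D x v)"
      using lin H that x by (intro linear_compose_sub) auto
    have "norm (D y v - D x v) = norm (\<Sum>b\<in>Basis. (v \<bullet> b) *\<^sub>R (D y b - D x b))"
      using linear_Basis_expansion[OF l, of v] by simp
    also have "\<dots> \<le> (\<Sum>b\<in>(Basis :: 'n coords set). norm v * (\<epsilon> / N))"
    proof (rule order_trans[OF norm_sum sum_mono])
      fix b :: "'n coords" assume b: "b \<in> Basis"
      have "norm (D y b - D x b) < \<epsilon> / N" using d0(2)[of y] H that False b by auto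
      then show "norm ((v \<bullet> b) *\<^sub>R (D y b - D x b)) \<le> norm v * (\<epsilon> / N)"
        using mult_mono[OF Basis_le_norm[OF b, of v], of "norm (D y b - D x b)" "\<epsilon> / N"] by simp
    qed
    also have "\<dots> = norm v * \<epsilon>" using N by (simp only: sum_constant N_def[symmetric]) simp
    finally show ?thesis .
  qed (use \<epsilon> in simp)
  define w where "w y = u y - D x y" for y
  have cw: "continuous_on H w"
    unfolding w_def using u H(1) lin[OF x]
    by (intro continuous_intros) (auto intro: continuous_on_subset linear_continuous_on
        simp: linear_conv_bounded_linear)
  have mvt: "norm (w y - w z) \<le> \<epsilon> * norm (y - z)" if "y \<in> pos H" "z \<in> pos H" for y z
  proof (rule differentiable_bound[OF convex_pos[OF H(3)] _ _ that])
    fix y assume y: "y \<in> pos H"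
    then have "y \<in> pos S" using H(1) pos_mono by blast
    then have "(u has_derivative D y) (at y within pos H)" using D has_derivative_at_withinI by blast
    moreover have "(D x has_derivative D x) (at y within pos H)"
      using lin[OF x] by (simp add: linear_imp_has_derivative)
    ultimately show "(w has_derivative (\<lambda>v. D y v - D x v)) (at y within pos H)"
      unfolding w_def by (rule has_derivative_diff)
    show "onorm (\<lambda>v. D y v - D x v) \<le> \<epsilon>"
      by (rule onorm_le) (use small[of y] y pos_subset in \<open>auto simp: mult.commute\<close>)
  qed
  have 1: "0 \<le> \<epsilon> * norm (y - z) - norm (w y - w z)" if "y \<in> pos H" "z \<in> H" for y z
    by (rule nonneg_from_pos[OF H(2) _ _ that(2)])
      (use mvt[OF that(1)] in \<open>auto intro!: continuous_intros cw\<close>)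
  have 2: "0 \<le> \<epsilon> * norm (y - z) - norm (w y - w z)" if "y \<in> H" "z \<in> H" for y z
    by (rule nonneg_from_pos[OF H(2) _ _ that(1), of "\<lambda>y. \<epsilon> * norm (y - z) - norm (w y - w z)"])
      (use 1[OF _ that(2)] in \<open>auto intro!: continuous_intros cw\<close>)
  show "\<exists>d>0. \<forall>y\<in>S. norm (y - x) < d \<longrightarrow> norm (u y - u x - D x (y - x)) \<le> \<epsilon> * norm (y - x)"
  proof (intro exI[of _ d] conjI ballI impI)
    show "0 < d" using d0 r by (simp add: d_def)
    fix y assume y: "y \<in> S" "norm (y - x) < d"
    then have "y \<in> H" using hopenD[OF S] by (auto simp: H_def hball_def half_space_def dist_norm norm_minus_commute)
    moreover have "w y - w x = u y - u x - D x (y - x)"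
      using lin[OF x] by (simp add: w_def linear_diff)
    ultimately show "norm (u y - u x - D x (y - x)) \<le> \<epsilon> * norm (y - x)"
      using 2[of y x] H(4) by simp
  qed
qed

subsection \<open>Boundary values\<close>

text \<open>The boundary value is a limit that does not refer to a domain. So local extensions
  automatically fit together.\<close>

definition bval :: "(('n::finite) coords \<Rightarrow> 'b::real_normed_vector) \<Rightarrow> 'n coords \<Rightarrow> 'b" where
  "bval u x = Lim (at x within {y. 0 < y $ None}) u"

lemma bval_eq:
  fixes u :: "('n::finite) coords \<Rightarrow> 'b::real_normed_vector"
  assumes V: "hopen V" "x \<in> V" and U: "continuous_on V U" "\<And>y. y \<in> pos V \<Longrightarrow> U y = u y"
  shows "bval u x = U x"
proof -
  obtain O' where O: "open O'" "V = half_space \<inter> O'" using V(1) by (auto simp: openin_open)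
  have at: "at x within {y. 0 < y $ None} = at x within pos V"
    by (rule at_within_nhd[of x O']) (use O V in \<open>auto simp: pos_def half_space_def\<close>)
  have "(U \<longlongrightarrow> U x) (at x within pos V)"
    using U(1) V(2) pos_subset unfolding continuous_on_def by (meson tendsto_within_subset)
  then have "(u \<longlongrightarrow> U x) (at x within pos V)"
    by (rule Lim_transform_eventually) (use U(2) in \<open>auto simp: eventually_at_filter\<close>)
  moreover have "at x within pos V \<noteq> bot"
    using islimpt_pos[OF V] by (simp add: trivial_limit_within)
  ultimately show ?thesis unfolding bval_def at by (rule tendsto_Lim[rotated])
qed

lemma smooth_on_bval:
  fixes u :: "('n::finite) coords \<Rightarrow> 'b::real_normed_vector"
  assumes S: "hopen S"
    and ex: "\<And>x. x \<in> S \<Longrightarrow> \<exists>V U. hopen V \<and> x \<in> V \<and> smooth_on V U \<and> (\<forall>y\<in>pos V. U y = u y)"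
  shows "smooth_on S (bval u)" and "x \<in> pos S \<Longrightarrow> bval u x = u x"
proof -
  show "smooth_on S (bval u)"
  proof (rule smooth_on_local)
    fix x assume x: "x \<in> S"
    obtain V U where V: "hopen V" "x \<in> V" "smooth_on V U" "\<forall>y\<in>pos V. U y = u y"
      using ex[OF x] by blast
    have o: "hopen (V \<inter> S)" "openin (top_of_set V) (V \<inter> S)" "openin (top_of_set S) (V \<inter> S)"
      using V(1) S by (auto simp: openin_open)
    have "U y = bval u y" if "y \<in> V \<inter> S" for y
      using bval_eq[OF V(1) _ smooth_on_continuous[OF V(3)], of y u] V(4) that by simp
    then have "smooth_on (V \<inter> S) (bval u)"
      using smooth_on_eq[OF smooth_on_openin[OF o(2) V(3)]] by blast
    then show "\<exists>V. x \<in> V \<and> openin (top_of_set S) V \<and> smooth_on V (bval u)"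
      using x V(2) o(3) by (intro exI[of _ "V \<inter> S"]) auto
  qed
next
  assume x: "x \<in> pos S"
  then obtain V U where V: "hopen V" "x \<in> V" "smooth_on V U" "\<forall>y\<in>pos V. U y = u y"
    using ex[of x] pos_subset by blast
  then show "bval u x = u x"
    using bval_eq[OF V(1,2) smooth_on_continuous[OF V(3)], of u] x by (auto simp: pos_def)
qed

subsection \<open>Linear differential systems\<close>

text \<open>The squared norm, multiplied by \<open>exp (- 2 c t)\<close>, is decreasing.\<close>

lemma linear_growth_bound:
  fixes w :: "real \<Rightarrow> 'b::real_inner"
  assumes d: "\<And>t. 0 \<le> t \<Longrightarrow> t \<le> 1 \<Longrightarrow> (w has_vector_derivative w' t) (at t)"
    and b: "\<And>t. 0 \<le> t \<Longrightarrow> t \<le> 1 \<Longrightarrow> norm (w' t) \<le> c * norm (w t)"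
  shows "norm (w 1) \<le> exp c * norm (w 0)"
proof -
  define \<phi> where "\<phi> t = exp (- 2 * c * t) * (w t \<bullet> w t)" for t
  have "\<phi> 1 \<le> \<phi> 0"
  proof (rule DERIV_nonpos_imp_nonincreasing[where f = \<phi> and a = 0 and b = 1])
    fix t :: real assume t: "0 \<le> t" "t \<le> 1"
    have "((\<lambda>t. w t \<bullet> w t) has_real_derivative 2 * (w t \<bullet> w' t)) (at t)"
      using bounded_bilinear.has_vector_derivative[OF bounded_bilinear_inner d[OF t] d[OF t]]
      by (simp add: has_real_derivative_iff_has_vector_derivative inner_commute)
    then have "(\<phi> has_real_derivative
        exp (- 2 * c * t) * (2 * (w t \<bullet> w' t)) + exp (- 2 * c * t) * (- 2 * c) * (w t \<bullet> w t)) (at t)"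
      unfolding \<phi>_def by (auto intro!: derivative_eq_intros)
    moreover have "w t \<bullet> w' t \<le> c * (w t \<bullet> w t)"
    proof -
      have "w t \<bullet> w' t \<le> norm (w t) * norm (w' t)" by (rule norm_cauchy_schwarz)
      also have "\<dots> \<le> norm (w t) * (c * norm (w t))" using b[OF t] by (simp add: mult_left_mono)
      finally show ?thesis by (simp add: dot_square_norm power2_eq_square mult_ac)
    qed
    then have "0 \<le> 2 * exp (- 2 * c * t) * (c * (w t \<bullet> w t) - w t \<bullet> w' t)"
      by (intro mult_nonneg_nonneg) auto
    then have "exp (- 2 * c * t) * (2 * (w t \<bullet> w' t)) + exp (- 2 * c * t) * (- 2 * c) * (w t \<bullet> w t) \<le> 0"
      by (simp add: algebra_simps)
    ultimately show "\<exists>y. (\<phi> has_real_derivative y) (at t) \<and> y \<le> 0" by (intro exI conjI)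
  qed simp
  then have "exp (- 2 * c) * (norm (w 1))\<^sup>2 \<le> (norm (w 0))\<^sup>2"
    by (simp add: \<phi>_def dot_square_norm)
  then have "exp (2 * c) * (exp (- 2 * c) * (norm (w 1))\<^sup>2) \<le> exp (2 * c) * (norm (w 0))\<^sup>2"
    by (simp add: mult_left_mono)
  then have "(norm (w 1))\<^sup>2 \<le> exp (2 * c) * (norm (w 0))\<^sup>2"
    by (simp add: mult.assoc[symmetric] exp_add[symmetric])
  also have "\<dots> = (exp c * norm (w 0))\<^sup>2"
    by (simp add: power_mult_distrib exp_double)
  finally show ?thesis by (rule power2_le_imp_le) simp
qed


lemma smooth_bounded_near:
  fixes f :: "('n::finite) coords \<Rightarrow> 'b::real_normed_vector"
  assumes "smooth_on S f" "cball p r \<inter> half_space \<subseteq> S"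
  shows "\<exists>K. \<forall>x \<in> hball p r. norm (f x) \<le> K"
proof -
  have "closed (half_space :: 'n coords set)"
    unfolding half_space_def by (rule closed_halfspace_component_ge_cart)
  then have "compact (cball p r \<inter> half_space)" by (simp add: compact_Int_closed)
  moreover have "continuous_on (cball p r \<inter> half_space) f"
    using smooth_on_continuous[OF assms(1)] assms(2) continuous_on_subset by blast
  ultimately have "bounded (f ` (cball p r \<inter> half_space))"
    by (simp add: compact_continuous_image compact_imp_bounded)
  then obtain K where "\<forall>x \<in> cball p r \<inter> half_space. norm (f x) \<le> K"
    unfolding bounded_iff by blast
  moreover have "hball p r \<subseteq> cball p r \<inter> half_space"
    using ball_subset_cball[of p r] unfolding hball_def by auto
  ultimately show ?thesis by blast
qed

text \<open>The growth estimate along segments bounds the solution. By the system its derivative is then bounded too,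
  so that it is Lipschitz and extends continuously. Finally the system expresses the derivatives through
  the function and thereby improves regularity step by step.\<close>

lemma linear_system_extends_local:
  fixes u :: "('n::finite) coords \<Rightarrow> 'b::euclidean_space"
    and M :: "'n option \<Rightarrow> 'n coords \<Rightarrow> 'b \<Rightarrow> 'b"
  assumes S: "hopen S" and p: "p \<in> S"
    and lin: "\<And>a x. x \<in> S \<Longrightarrow> linear (M a x)"
    and sm: "\<And>a w. smooth_on S (\<lambda>x. M a x w)"
    and u: "\<And>x. x \<in> pos S \<Longrightarrow> (u has_derivative (\<lambda>v. \<Sum>a\<in>UNIV. (v $ a) *\<^sub>R M a x (u x))) (at x)"
  shows "\<exists>V U. hopen V \<and> p \<in> V \<and> smooth_on V U \<and> (\<forall>y\<in>pos V. U y = u y)"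
proof -
  obtain r where r: "0 < r" "cball p r \<inter> half_space \<subseteq> S"
    using hopen_contains_hcball[OF S p] .
  define H where "H = hball p r"
  have H: "hopen H" "convex H" "p \<in> H" "H \<subseteq> S"
    using r p hopenD[OF S p] hopen_hball convex_hball ball_subset_cball[of p r]
    by (auto simp: H_def hball_def half_space_def)
  have "\<exists>K. \<forall>x\<in>H. norm (M a x b) \<le> K" for a b
    unfolding H_def by (rule smooth_bounded_near[OF sm r(2)])
  then obtain K where K: "\<And>a b x. x \<in> H \<Longrightarrow> norm (M a x b) \<le> K a b" by metis
  define L where "L = (\<Sum>a\<in>UNIV. \<Sum>b\<in>Basis. K a b)"
  have K0: "0 \<le> K a b" for a b using K[OF H(3)] norm_ge_zero order_trans by blast
  have Mb: "norm (M a x w) \<le> (\<Sum>b\<in>Basis. K a b) * norm w" if "x \<in> H" for a x w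
  proof -
    have "linear (M a x)" using lin H(4) that by blast
    then have "norm (M a x w) = norm (\<Sum>b\<in>Basis. (w \<bullet> b) *\<^sub>R M a x b)"
      using linear_Basis_expansion by metis
    also have "\<dots> \<le> (\<Sum>b\<in>Basis. norm w * K a b)"
    proof (rule order_trans[OF norm_sum sum_mono])
      fix b :: 'b assume "b \<in> Basis"
      then show "norm ((w \<bullet> b) *\<^sub>R M a x b) \<le> norm w * K a b"
        using K[OF that] by (simp add: mult_mono Basis_le_norm)
    qed
    finally show ?thesis by (simp add: sum_distrib_left mult.commute)
  qed
  define D where "D w x v = (\<Sum>a\<in>UNIV. (v $ a) *\<^sub>R M a x w)" for w x v
  have Db: "norm (D w x v) \<le> L * norm v * norm w" if "x \<in> H" for w x v
  proof -
    have "norm (D w x v) \<le> (\<Sum>a\<in>UNIV. norm v * ((\<Sum>b\<in>Basis. K a b) * norm w))"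
      unfolding D_def
    proof (rule order_trans[OF norm_sum sum_mono])
      fix a :: "'n option"
      show "norm ((v $ a) *\<^sub>R M a x w) \<le> norm v * ((\<Sum>b\<in>Basis. K a b) * norm w)"
        using Mb[OF that] component_le_norm_cart[of v a] by (simp add: mult_mono)
    qed
    also have "\<dots> = L * norm v * norm w"
      unfolding L_def by (simp add: sum_distrib_left sum_distrib_right mult_ac)
    finally show ?thesis .
  qed
  have L0: "0 \<le> L" unfolding L_def by (intro sum_nonneg K0)
  have du: "(u has_derivative D (u x) x) (at x)" if "x \<in> pos H" for x
    using u[of x] that H(4) pos_mono unfolding D_def by blast
  have cp: "convex (pos H)" by (rule convex_pos[OF H(2)])
  obtain y where y: "y \<in> pos H"
    using islimpt_pos[OF H(1,3)] unfolding islimpt_approachable by (meson zero_less_one)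
  define B where "B = exp (L * (2 * r)) * norm (u y)"
  have bound: "norm (u x) \<le> B" if x: "x \<in> pos H" for x
  proof -
    define \<gamma> where "\<gamma> t = y + t *\<^sub>R (x - y)" for t :: real
    have \<gamma>: "\<gamma> t \<in> pos H" if "0 \<le> t" "t \<le> 1" for t
      using convexD_alt[OF cp y x that] by (simp add: \<gamma>_def algebra_simps)
    have "norm ((u \<circ> \<gamma>) 1) \<le> exp (L * norm (x - y)) * norm ((u \<circ> \<gamma>) 0)"
    proof (rule linear_growth_bound[where w' = "\<lambda>t. D (u (\<gamma> t)) (\<gamma> t) (x - y)"])
      fix t :: real assume t: "0 \<le> t" "t \<le> 1"
      have "(\<gamma> has_vector_derivative (x - y)) (at t)"
        unfolding \<gamma>_def by (auto intro!: derivative_eq_intros)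
      then show "(u \<circ> \<gamma> has_vector_derivative D (u (\<gamma> t)) (\<gamma> t) (x - y)) (at t)"
        using du[OF \<gamma>[OF t]] has_derivative_at_withinI by (blast intro: vector_derivative_diff_chain_within)
      show "norm (D (u (\<gamma> t)) (\<gamma> t) (x - y)) \<le> L * norm (x - y) * norm ((u \<circ> \<gamma>) t)"
        using Db \<gamma>[OF t] pos_subset by fastforce
    qed
    also have "\<dots> \<le> B"
    proof -
      have "norm (x - y) \<le> norm (x - p) + norm (y - p)"
        using dist_triangle2[of x y p] by (simp add: dist_norm)
      also have "\<dots> \<le> 2 * r"
        using x y by (auto simp: pos_def H_def hball_def dist_norm norm_minus_commute)
      finally have "L * norm (x - y) \<le> L * (2 * r)" using L0 by (rule mult_left_mono)
      then show ?thesis by (simp add: B_def \<gamma>_def mult_right_mono)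
    qed
    finally show ?thesis by (simp add: \<gamma>_def)
  qed
  have "norm (u x - u z) \<le> (L * B) * norm (x - z)" if "x \<in> pos H" "z \<in> pos H" for x z
  proof (rule differentiable_bound[OF cp _ _ that])
    show "(u has_derivative D (u x) x) (at x within pos H)" if "x \<in> pos H" for x
      using du[OF that] has_derivative_at_withinI by blast
    show "onorm (D (u x) x) \<le> L * B" if "x \<in> pos H" for x
    proof (rule onorm_le)
      fix v :: "'n coords"
      have "L * norm v * norm (u x) \<le> L * norm v * B"
        using bound[OF that] L0 by (intro mult_left_mono) auto
      then show "norm (D (u x) x v) \<le> L * B * norm v"
        using Db[of x "u x" v] that pos_subset by (fastforce simp: mult_ac)
    qed
  qed
  then have "(L * B)-lipschitz_on (pos H) u"
    using L0 order_trans[OF norm_ge_zero bound[OF y]] by (intro lipschitz_onI) (auto simp: dist_norm)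
  then have "uniformly_continuous_on (pos H) u" by (rule lipschitz_on_uniformly_continuous)
  then obtain U where U: "uniformly_continuous_on (closure (pos H)) U" "\<And>x. x \<in> pos H \<Longrightarrow> u x = U x"
    by (rule uniformly_continuous_on_extension_on_closure) (rule that; assumption)
  have "H \<subseteq> closure (pos H)"
    using islimpt_pos[OF H(1)] by (auto simp: closure_def)
  then have cU: "continuous_on H U"
    using uniformly_continuous_imp_continuous[OF U(1)] continuous_on_subset by blast
  have smH: "smooth_on H (\<lambda>x. M a x w)" for a w
    using sm smooth_on_openin[of S H] H S by (metis openin_subset_trans openin_imp_subset)
  have CkD: "Ck_on k H (\<lambda>x. D (U x) x v)" if "Ck_on k H U" for k v
  proof -
    have tH: "thick H" by (rule thick_hopen[OF H(1)])
    have "Ck_on k H (\<lambda>x. \<Sum>a\<in>UNIV. (v $ a) *\<^sub>R (\<Sum>b\<in>Basis. (U x \<bullet> b) *\<^sub>R M a x b))"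
      using smH unfolding smooth_on_def
      by (intro Ck_on_sum[OF tH] Ck_on_linear_image[OF tH bounded_linear_scaleR_right]
          Ck_on_bilinear[OF tH bounded_bilinear_scaleR]
          Ck_on_linear_image[OF tH bounded_linear_inner_left that]) auto
    then show ?thesis
    proof (rule Ck_on_eq)
      fix x assume "x \<in> H"
      then have "linear (M a x)" for a using lin H(4) by blast
      then show "(\<Sum>a\<in>UNIV. (v $ a) *\<^sub>R (\<Sum>b\<in>Basis. (U x \<bullet> b) *\<^sub>R M a x b)) = D (U x) x v"
        unfolding D_def using linear_Basis_expansion[of "M a x" "U x" for a] by simp
    qed
  qed
  have dU: "(U has_derivative D (U x) x) (at x within H)" if "x \<in> H" for x
  proof (rule has_derivative_up_to_boundary[OF H(1) cU _ _ _ that, where D = "\<lambda>x. D (U x) x"])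
    fix x assume x: "x \<in> pos H"
    have "(U has_derivative D (u x) x) (at x)"
      by (rule has_derivative_transform_within_open[OF du[OF x] open_pos[OF H(1)] x]) (rule U(2))
    then show "(U has_derivative D (U x) x) (at x)" using U(2)[OF x] by simp
  next
    show "continuous_on H (\<lambda>x. D (U x) x v)" for v
      using CkD[of 0] cU by simp
    show "linear (D (U x) x)" for x
      unfolding D_def by (rule linearI) (simp_all add: scaleR_add_left sum.distrib scaleR_sum_right)
  qed
  have "Ck_on k H U" for k
  proof (induction k)
    case (Suc k)
    show ?case by (rule Ck_on_SucI[OF thick_hopen[OF H(1)] dU CkD[OF Suc]])
  qed (simp add: cU)
  then have "smooth_on H U" unfolding smooth_on_def by blast
  then show ?thesis using H U(2) by (intro exI[of _ H] exI[of _ U]) auto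
qed

lemma linear_system_extends:
  fixes u :: "('n::finite) coords \<Rightarrow> 'b::euclidean_space"
    and M :: "'n option \<Rightarrow> 'n coords \<Rightarrow> 'b \<Rightarrow> 'b"
  assumes S: "hopen S" 
    and lin: "\<And>a x. x \<in> S \<Longrightarrow> linear (M a x)"
    and sm: "\<And>a w. smooth_on S (\<lambda>x. M a x w)"
    and u: "\<And>x. x \<in> pos S \<Longrightarrow> (u has_derivative (\<lambda>v. \<Sum>a\<in>UNIV. (v $ a) *\<^sub>R M a x (u x))) (at x)"
  shows "smooth_on S (bval u)" and "\<And>x. x \<in> pos S \<Longrightarrow> bval u x = u x"
  using smooth_on_bval[OF S] linear_system_extends_local[OF S _ lin sm u] by blast+

subsection \<open>Division by the transversal coordinate\<close>

text \<open>The value on the boundary is the limit of \<open>f / x\<^sub>0\<close> in case that \<open>f\<close> vanishes on the boundary.\<close>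

definition normal_quotient :: "(('n::finite) coords \<Rightarrow> real) \<Rightarrow> 'n coords \<Rightarrow> real" where
  "normal_quotient f x = (if x $ None = 0 then bderiv f x e\<^sub>0 else f x / x $ None)"

definition contract :: "real \<Rightarrow> ('n::finite) coords \<Rightarrow> 'n coords" where
  "contract t x = x + ((t - 1) * x $ None) *\<^sub>R e\<^sub>0"

lemma contract_nth: "contract t x $ a = (if a = None then t * x $ None else x $ a)"
  by (simp add: contract_def axis_def algebra_simps)

lemma bounded_linear_contract: "bounded_linear (contract t)"
  unfolding linear_conv_bounded_linear[symmetric]
  by (rule linearI) (auto simp: vec_eq_iff contract_nth algebra_simps)

lemma contract_hball:
  assumes "p $ None = 0" "x \<in> hball p r" "0 \<le> t" "t \<le> 1"
  shows "contract t x \<in> hball p r"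
proof -
  have "norm (contract t x - p) \<le> norm (x - p)"
  proof (rule norm_le_componentwise_cart)
    fix a
    have "\<bar>t * x $ None\<bar> \<le> \<bar>x $ None\<bar>" using assms(3,4) by (simp add: abs_mult mult_left_le_one_le)
    then show "norm ((contract t x - p) $ a) \<le> norm ((x - p) $ a)"
      using assms(1) by (simp add: contract_nth)
  qed
  then show ?thesis
    using assms by (auto simp: hball_def half_space_def contract_nth dist_norm norm_minus_commute)
qed

text \<open>The integrals \<open>\<integral>\<^sub>0\<^sup>1 t\<^sup>m f(t x\<^sub>0, x') dt\<close> form a family that is closed under partial derivatives.
  For \<open>m = 0\<close> and \<open>\<partial>\<^sub>0 f\<close> in place of \<open>f\<close> the integral is the quotient \<open>f / x\<^sub>0\<close>.\<close>

definition contract_integral :: "nat \<Rightarrow> (('n::finite) coords \<Rightarrow> real) \<Rightarrow> 'n coords \<Rightarrow> real" where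
  "contract_integral m f x = integral (cbox 0 1) (\<lambda>t. t ^ m * f (contract t x))"

lemma continuous_contract: "continuous_on S (\<lambda>(x, t). contract t x)"
  unfolding contract_def case_prod_beta by (intro continuous_intros)

lemma continuous_contract_integrand:
  fixes h :: "('n::finite) coords \<Rightarrow> real"
  assumes p: "p $ None = 0" and h: "smooth_on (hball p r) h"
  shows "continuous_on (hball p r \<times> cbox 0 1) (\<lambda>(x, t). t ^ m * h (contract t x))"
proof -
  have "continuous_on (hball p r \<times> cbox 0 1) (\<lambda>z. h ((\<lambda>(x, t). contract t x) z))"
    by (rule continuous_on_compose2[OF smooth_on_continuous[OF h] continuous_contract])
      (auto intro: contract_hball[OF p])
  then show ?thesis unfolding case_prod_beta by (intro continuous_intros) auto
qed

lemma Ck_on_contract_integral: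
  fixes f :: "('n::finite) coords \<Rightarrow> real"
  assumes p: "p $ None = 0" and f: "smooth_on (hball p r) f"
  shows "Ck_on k (hball p r) (contract_integral m f)"
  using f
proof (induction k arbitrary: f m)
  case 0
  then show ?case
    unfolding contract_integral_def using integral_continuous_on_param[OF continuous_contract_integrand[OF p 0]] by simp
next
  let ?H = "hball p r"
  case (Suc k)
  note cont = continuous_contract_integrand[OF p]
  define fx where "fx x t = Blinfun (\<lambda>v. t ^ m * bderiv f (contract t x) (contract t v))" for x t
  have bl: "bounded_linear (\<lambda>v. t ^ m * bderiv f (contract t x) (contract t v))"
    and der: "((\<lambda>x. t ^ m * f (contract t x)) has_derivative
        (\<lambda>v. t ^ m * bderiv f (contract t x) (contract t v))) (at x within ?H)"
    if "x \<in> ?H" "t \<in> cbox 0 1" for x t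
  proof -
    have c: "contract t x \<in> ?H" using contract_hball[OF p] that by auto
    have "(f has_derivative bderiv f (contract t x)) (at (contract t x) within ?H)"
      using has_bderiv[OF hopen_hball Suc.prems c] at_within_hopen[OF hopen_hball c] by simp
    then have "(f has_derivative bderiv f (contract t x)) (at (contract t x) within contract t ` ?H)"
      by (rule has_derivative_subset) (use contract_hball[OF p] that in auto)
    from has_derivative_in_compose[OF bounded_linear_imp_has_derivative[OF bounded_linear_contract] this]
    have "((\<lambda>x. f (contract t x)) has_derivative (\<lambda>v. bderiv f (contract t x) (contract t v))) (at x within ?H)"
      .
    then show "((\<lambda>x. t ^ m * f (contract t x)) has_derivative
        (\<lambda>v. t ^ m * bderiv f (contract t x) (contract t v))) (at x within ?H)"
      by (rule has_derivative_mult_right)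
    then show "bounded_linear (\<lambda>v. t ^ m * bderiv f (contract t x) (contract t v))"
      by (rule has_derivative_bounded_linear)
  qed
  have fx: "blinfun_apply (fx x t) = (\<lambda>v. t ^ m * bderiv f (contract t x) (contract t v))"
    if "x \<in> ?H" "t \<in> cbox 0 1" for x t
    unfolding fx_def by (rule bounded_linear_Blinfun_apply[OF bl[OF that]])
  have basis: "fx x t (axis a 1) = t ^ (if a = None then Suc m else m) * bderiv f (contract t x) (axis a 1)"
    if "x \<in> ?H" "t \<in> cbox 0 1" for x t a
  proof -
    have l: "linear (bderiv f (contract t x))"
      using linear_bderiv[OF hopen_hball Suc.prems] contract_hball[OF p] that by auto
    have "contract t (axis a 1) = (if a = None then t *\<^sub>R e\<^sub>0 else axis a 1)"
      by (auto simp: vec_eq_iff contract_nth axis_def)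
    then show ?thesis using l unfolding fx[OF that] by (simp add: linear_scale)
  qed
  have sd: "smooth_on ?H (\<lambda>x. bderiv f x v)" for v
    by (rule smooth_on_bderiv[OF hopen_hball Suc.prems])
  have cfx: "continuous_on (?H \<times> cbox 0 1) (\<lambda>(x, t). fx x t)"
  proof (rule continuous_on_blinfun_componentwise)
    fix i :: "'n coords" assume "i \<in> Basis"
    then obtain a where a: "i = axis a 1" by (auto simp: Basis_vec_def)
    show "continuous_on (?H \<times> cbox 0 1) (\<lambda>z. blinfun_apply ((\<lambda>(x, t). fx x t) z) i)"
      by (rule continuous_on_eq[OF cont[OF sd[of i], of "if a = None then Suc m else m"]])
        (auto simp: a basis)
  qed
  have D: "(contract_integral m f has_derivative integral (cbox 0 1) (fx x)) (at x within ?H)"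
    if "x \<in> ?H" for x
    unfolding contract_integral_def
  proof (rule leibniz_rule[OF _ _ cfx that convex_hball])
    show "((\<lambda>x. t ^ m * f (contract t x)) has_derivative blinfun_apply (fx x t)) (at x within ?H)"
      if "x \<in> ?H" "t \<in> cbox 0 1" for x t
      using der[OF that] fx[OF that] by simp
    show "(\<lambda>t. t ^ m * f (contract t x)) integrable_on cbox 0 1" if "x \<in> ?H" for x
    proof (rule integrable_continuous)
      have "continuous_on (cbox 0 1) (\<lambda>t. (\<lambda>(x, t). t ^ m * f (contract t x)) (x, t))"
        by (rule continuous_on_compose2[OF cont[OF Suc.prems]]) (use that in \<open>auto intro!: continuous_intros\<close>)
      then show "continuous_on (cbox 0 1) (\<lambda>t. t ^ m * f (contract t x))" by simp
    qed
  qed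
  have val: "blinfun_apply (integral (cbox 0 1) (fx x)) (axis a 1)
      = contract_integral (if a = None then Suc m else m) (\<lambda>x. bderiv f x (axis a 1)) x"
    if "x \<in> ?H" for x a
  proof -
    have "continuous_on (cbox 0 1) (\<lambda>t. (\<lambda>(x, t). fx x t) (x, t))"
      by (rule continuous_on_compose2[OF cfx]) (use that in \<open>auto intro!: continuous_intros\<close>)
    then have "fx x integrable_on cbox 0 1" by (intro integrable_continuous) simp
    from integral_linear[OF this blinfun.bounded_linear_left]
    have "blinfun_apply (integral (cbox 0 1) (fx x)) (axis a 1) = integral (cbox 0 1) (\<lambda>t. fx x t (axis a 1))"
      by (simp add: o_def)
    also have "\<dots> = contract_integral (if a = None then Suc m else m) (\<lambda>x. bderiv f x (axis a 1)) x"
      unfolding contract_integral_def by (rule integral_cong) (rule basis[OF that])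
    finally show ?thesis .
  qed
  show ?case
  proof (rule Ck_on_SucI_Basis[OF thick_hopen[OF hopen_hball] D])
    fix b :: "'n coords" assume "b \<in> Basis"
    then obtain a where a: "b = axis a 1" by (auto simp: Basis_vec_def)
    show "Ck_on k ?H (\<lambda>x. blinfun_apply (integral (cbox 0 1) (fx x)) b)"
      by (rule Ck_on_eq[OF Suc.IH[OF sd[of b], of "if a = None then Suc m else m"]]) (simp only: a val)
  qed
qed

text \<open>The fundamental theorem of calculus on the segment from \<open>(0, x')\<close> to \<open>x\<close>.\<close>

lemma normal_quotient_eq_integral:
  fixes f :: "('n::finite) coords \<Rightarrow> real"
  assumes p: "p $ None = 0" and f: "smooth_on (hball p r) f"
    and z: "\<And>x. x \<in> hball p r \<Longrightarrow> x $ None = 0 \<Longrightarrow> f x = 0" and x: "x \<in> hball p r"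
  shows "normal_quotient f x = contract_integral 0 (\<lambda>x. bderiv f x e\<^sub>0) x"
proof (cases "x $ None = 0")
  case True
  then have "contract t x = x" for t by (simp add: contract_def)
  then show ?thesis using True by (simp add: normal_quotient_def contract_integral_def)
next
  case False
  let ?H = "hball p r"
  have "((\<lambda>t. x $ None * bderiv f (contract t x) e\<^sub>0) has_integral (f (contract 1 x) - f (contract 0 x))) {0..1}"
  proof (rule fundamental_theorem_of_calculus)
    fix t :: real assume t: "t \<in> {0..1}"
    have c: "contract t x \<in> ?H" using contract_hball[OF p x] t by auto
    have "(\<lambda>t. contract t x) ` {0..1} \<subseteq> half_space"
      using contract_hball[OF p x] by (auto simp: hball_def)
    then have "(f has_derivative bderiv f (contract t x)) (at (contract t x) within (\<lambda>t. contract t x) ` {0..1})"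
      by (rule has_derivative_subset[OF has_bderiv[OF hopen_hball f c]])
    moreover have "((\<lambda>t. contract t x) has_vector_derivative (x $ None *\<^sub>R e\<^sub>0)) (at t within {0..1})"
      unfolding contract_def by (auto intro!: derivative_eq_intros)
    ultimately have "(f \<circ> (\<lambda>t. contract t x) has_vector_derivative bderiv f (contract t x) (x $ None *\<^sub>R e\<^sub>0)) (at t within {0..1})"
      by (intro vector_derivative_diff_chain_within)
    then show "((\<lambda>t. f (contract t x)) has_vector_derivative (x $ None * bderiv f (contract t x) e\<^sub>0)) (at t within {0..1})"
      using linear_scale[OF linear_bderiv[OF hopen_hball f c]] by (simp add: o_def)
  qed simp
  moreover have "contract 1 x = x" "f (contract 0 x) = 0"
    using z[OF contract_hball[OF p x, of 0]] by (auto simp: contract_def contract_nth)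
  ultimately have "integral {0..1} (\<lambda>t. x $ None * bderiv f (contract t x) e\<^sub>0) = f x"
    by (metis diff_zero integral_unique)
  then show ?thesis using False
    by (simp add: normal_quotient_def contract_integral_def field_simps)
qed

lemma normal_quotient:
  fixes f :: "('n::finite) coords \<Rightarrow> real"
  assumes S: "hopen S" and f: "smooth_on S f"
    and z: "\<And>x. x \<in> S \<Longrightarrow> x $ None = 0 \<Longrightarrow> f x = 0"
  shows smooth_on_normal_quotient: "smooth_on S (normal_quotient f)"
    and normal_quotient_mult: "x \<in> S \<Longrightarrow> f x = x $ None * normal_quotient f x"
proof -
  show "smooth_on S (normal_quotient f)"
  proof (rule smooth_on_local)
    fix x assume x: "x \<in> S"
    show "\<exists>V. x \<in> V \<and> openin (top_of_set S) V \<and> smooth_on V (normal_quotient f)"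
    proof (cases "x $ None = 0")
      case True
      obtain r where r: "0 < r" "hball x r \<subseteq> S" using hopen_contains_hball[OF S x] .
      have o: "openin (top_of_set S) (hball x r)"
        using r S hopen_hball openin_imp_subset by (metis openin_subset_trans)
      have fH: "smooth_on (hball x r) f" by (rule smooth_on_openin[OF o f])
      have "smooth_on (hball x r) (contract_integral 0 (\<lambda>x. bderiv f x e\<^sub>0))"
        unfolding smooth_on_def
        using Ck_on_contract_integral[OF True smooth_on_bderiv[OF hopen_hball fH]] by blast
      then have "smooth_on (hball x r) (normal_quotient f)"
      proof (rule smooth_on_eq)
        fix y assume "y \<in> hball x r"
        then show "contract_integral 0 (\<lambda>x. bderiv f x e\<^sub>0) y = normal_quotient f y"
          by (intro normal_quotient_eq_integral[OF True fH, symmetric]) (use z r in auto)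
      qed
      moreover have "x \<in> hball x r" using r hopenD[OF S x] by (simp add: hball_def half_space_def)
      ultimately show ?thesis using o by blast
    next
      case False
      have o: "openin (top_of_set S) (pos S)"
        using S hopen_pos[OF S] pos_subset openin_imp_subset by (metis openin_subset_trans)
      have t: "thick (pos S)" by (rule thick_hopen[OF hopen_pos[OF S]])
      have "smooth_on (pos S) (\<lambda>x. f x / x $ None)"
        by (rule smooth_on_divide[OF t smooth_on_openin[OF o f] smooth_on_nth[OF t smooth_on_id[OF t]]])
          (auto simp: pos_def)
      then have "smooth_on (pos S) (normal_quotient f)"
        by (rule smooth_on_eq) (auto simp: pos_def normal_quotient_def)
      moreover have "x \<in> pos S" using x False hopenD[OF S x] by (simp add: pos_def)
      ultimately show ?thesis using o by blast
    qed
  qed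
  show "f x = x $ None * normal_quotient f x" if "x \<in> S"
    using z[OF that] by (simp add: normal_quotient_def)
qed

section \<open>The metric in a boundary chart\<close>

abbreviation ax :: "'n option \<Rightarrow> ('n::finite) coords" where
  "ax a \<equiv> axis a 1"

text \<open>The symbols of the modified connection \<open>\<nabla>\<^sup>\<rho>\<close> for \<open>\<rho> = x\<^sub>0\<close>.\<close>

definition rho_symbol :: "(('n::finite) coords \<Rightarrow> 'n coords \<Rightarrow> 'n coords \<Rightarrow> 'n coords)
    \<Rightarrow> 'n coords \<Rightarrow> 'n coords \<Rightarrow> 'n coords \<Rightarrow> 'n coords" where
  "rho_symbol \<Gamma> x v w = \<Gamma> x v w + (v $ None / x $ None) *\<^sub>R w + (w $ None / x $ None) *\<^sub>R v"

text \<open>\<open>Ric(v, u)\<close>, computed with vector fields whose representatives in the chart are constant.\<close>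

definition chart_ricci :: "(('n::finite) coords \<Rightarrow> 'n coords \<Rightarrow> 'n coords \<Rightarrow> 'n coords)
    \<Rightarrow> 'n coords \<Rightarrow> 'n coords \<Rightarrow> 'n coords \<Rightarrow> real" where
  "chart_ricci \<Gamma> x v u = (\<Sum>a\<in>UNIV. bderiv (\<lambda>y. \<Gamma> y v u) x (ax a) $ a + \<Gamma> x (ax a) (\<Gamma> x v u) $ a
     - bderiv (\<lambda>y. \<Gamma> y (ax a) u) x v $ a - \<Gamma> x v (\<Gamma> x (ax a) u) $ a)"

lemma sum_option: "(\<Sum>a\<in>(UNIV :: ('n::finite) option set). f a) = f None + (\<Sum>i\<in>UNIV. f (Some i))"
  by (simp add: UNIV_option_conv sum.reindex)

lemma prod_option: "(\<Prod>a\<in>(UNIV :: ('n::finite) option set). f a) = f None * (\<Prod>i\<in>UNIV. f (Some i))"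
  by (simp add: UNIV_option_conv prod.reindex)

lemma vec_expansion: "v = (\<Sum>a\<in>UNIV. v $ a *\<^sub>R (ax a :: ('n::finite) coords))"
  by (simp add: vec_eq_iff axis_def if_distrib cong: if_cong)

lemma linear_ax_expansion:
  fixes f :: "('n::finite) coords \<Rightarrow> 'b::real_vector"
  assumes "linear f"
  shows "f v = (\<Sum>a\<in>UNIV. v $ a *\<^sub>R f (ax a))"
proof -
  have "f v = f (\<Sum>a\<in>UNIV. v $ a *\<^sub>R ax a)" using vec_expansion[of v] by simp
  then show ?thesis using assms by (simp add: linear_sum linear_scale)
qed

lemma bilinear_ax_expansion:
  fixes f :: "('n::finite) coords \<Rightarrow> 'n coords \<Rightarrow> real"
  assumes "bilinear f"
  shows "f v w = (\<Sum>a\<in>UNIV. \<Sum>b\<in>UNIV. v $ a * w $ b * f (ax a) (ax b))"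
proof -
  have lin: "linear (f v)" "linear (\<lambda>v. f v w)" for v w using assms by (auto simp: bilinear_def)
  have 1: "f (ax a) w = (\<Sum>b\<in>UNIV. w $ b * f (ax a) (ax b))" for a
    using linear_ax_expansion[OF lin(1)[of "ax a"], of w] by simp
  have "f v w = (\<Sum>a\<in>UNIV. v $ a * f (ax a) w)"
    using linear_ax_expansion[OF lin(2)[of w], of v] by simp
  then show ?thesis unfolding 1 by (simp add: sum_distrib_left mult_ac)
qed

lemma sum_ax_None: "(\<Sum>a\<in>UNIV. ax a $ None * f a) = f None"
  by (simp add: axis_def if_distrib[of "\<lambda>x. x * _"] cong: if_cong)

lemma sum_ax: "(\<Sum>a\<in>UNIV. ax c $ a * f a) = f c"
  by (simp add: axis_def if_distrib[of "\<lambda>x. x * _"] cong: if_cong)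

text \<open>The part of the Ricci tensor that is quadratic in the symbols, in terms of the symbols \<open>L\<close> of \<open>\<nabla>\<^sup>\<rho>\<close>. Of the
  explicit poles only the one with the factor \<open>n\<close> survives.\<close>

lemma ricci_quadratic_part:
  fixes G L :: "('n::finite) coords \<Rightarrow> 'n coords \<Rightarrow> 'n coords" and r :: real
  assumes G: "\<And>v w. G v w = L v w - (v $ None / r) *\<^sub>R w - (w $ None / r) *\<^sub>R v"
    and L: "bilinear L" and r: "r \<noteq> 0"
  defines "\<tau> \<equiv> \<lambda>d. \<Sum>a\<in>UNIV. L (ax a) (ax d) $ a"
  shows "(\<Sum>a\<in>UNIV. G (ax a) (G (ax c) (ax (Some i))) $ a - G (ax c) (G (ax a) (ax (Some i))) $ a)
    = L (ax c) (ax (Some i)) $ None * \<tau> None + (\<Sum>k\<in>UNIV. L (ax c) (ax (Some i)) $ Some k * \<tau> (Some k))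
      - CARD('n) * L (ax c) (ax (Some i)) $ None / r
      - (\<Sum>a\<in>UNIV. L (ax c) (L (ax a) (ax (Some i))) $ a)"
proof -
  let ?\<nu> = "L (ax c) (ax (Some i)) $ None"
  let ?c = "ax c $ None :: real"
  have i0: "ax (Some i) $ None = (0::real)" by (simp add: axis_def)
  have Gi: "G v (ax (Some i)) = L v (ax (Some i)) - (v $ None / r) *\<^sub>R ax (Some i)" for v
    by (simp add: G i0)
  have tr: "(\<Sum>a\<in>UNIV. G (ax a) Y $ a) = (\<Sum>d\<in>UNIV. Y $ d * \<tau> d) - (real CARD('n) + 2) * (Y $ None / r)" for Y
  proof -
    have lin: "linear (L v)" for v using L by (simp add: bilinear_def)
    have "(\<Sum>a\<in>UNIV. G (ax a) Y $ a)
      = (\<Sum>a\<in>UNIV. L (ax a) Y $ a - (ax a $ None * (Y $ a / r)) - Y $ None / r)"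
      by (rule sum.cong) (simp_all add: G axis_def)
    also have "\<dots> = (\<Sum>a\<in>UNIV. L (ax a) Y $ a) - Y $ None / r - (real CARD('n) + 1) * (Y $ None / r)"
      unfolding sum_subtractf sum_ax_None by (simp add: add.commute)
    also have "(\<Sum>a\<in>UNIV. L (ax a) Y $ a) = (\<Sum>a\<in>UNIV. \<Sum>d\<in>UNIV. Y $ d * L (ax a) (ax d) $ a)"
      by (subst linear_ax_expansion[OF lin]) simp
    also have "\<dots> = (\<Sum>d\<in>UNIV. Y $ d * \<tau> d)"
      by (subst sum.swap) (simp add: \<tau>_def sum_distrib_left)
    finally show ?thesis by (simp add: algebra_simps add_divide_distrib)
  qed
  have 1: "(\<Sum>a\<in>UNIV. G (ax a) (G (ax c) (ax (Some i))) $ a)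
    = ?\<nu> * \<tau> None + (\<Sum>k\<in>UNIV. L (ax c) (ax (Some i)) $ Some k * \<tau> (Some k)) - (?c / r) * \<tau> (Some i)
      - (real CARD('n) + 2) * (?\<nu> / r)"
  proof -
    have "(\<Sum>k\<in>UNIV. (?c / r) * ax (Some i) $ Some k * \<tau> (Some k)) = (?c / r) * \<tau> (Some i)"
      by (simp add: axis_def if_distrib[of "\<lambda>x. _ * x"] if_distrib[of "\<lambda>x. x * _"] cong: if_cong)
    then show ?thesis unfolding tr
      by (simp add: sum_option Gi i0 left_diff_distrib sum_subtractf)
  qed
  have 2: "(\<Sum>a\<in>UNIV. G (ax c) (G (ax a) (ax (Some i))) $ a)
    = (\<Sum>a\<in>UNIV. L (ax c) (L (ax a) (ax (Some i))) $ a) - ?\<nu> / r - (?c / r) * \<tau> (Some i) - ?\<nu> / r"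
  proof -
    have "G (ax c) (G (ax a) (ax (Some i))) $ a
      = L (ax c) (L (ax a) (ax (Some i))) $ a - ax a $ None * (L (ax c) (ax (Some i)) $ a / r)
        - (?c / r) * L (ax a) (ax (Some i)) $ a
        - ax c $ a * (L (ax a) (ax (Some i)) $ None / r)" for a
    proof -
      have z: "ax a $ None * ax (Some i) $ a = (0::real)" by (simp add: axis_def)
      have "G (ax c) (G (ax a) (ax (Some i))) $ a
        = L (ax c) (L (ax a) (ax (Some i)) - (ax a $ None / r) *\<^sub>R ax (Some i)) $ a
          - (?c / r) * (L (ax a) (ax (Some i)) $ a - (ax a $ None * ax (Some i) $ a) / r)
          - (L (ax a) (ax (Some i)) $ None / r) * ax c $ a"
        by (simp add: G[of "ax c"] Gi i0)
      then show ?thesis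
        by (simp add: z bilinear_rsub[OF L] bilinear_rmul[OF L] mult.commute)
    qed
    moreover have "(\<Sum>a\<in>UNIV. ax c $ a * (L (ax a) (ax (Some i)) $ None / r)) = ?\<nu> / r"
      by (rule sum_ax)
    ultimately show ?thesis
      by (simp only: sum_subtractf sum_ax_None sum_distrib_left[symmetric] \<tau>_def)
  qed
  show ?thesis unfolding sum_subtractf 1 2 by (simp add: add_divide_distrib distrib_right)
qed

lemma bilinear_rho_symbol:
  assumes "bilinear (\<Gamma> x)"
  shows "bilinear (rho_symbol \<Gamma> x)"
  unfolding bilinear_def rho_symbol_def
  by (intro conjI allI linearI)
    (simp_all add: bilinear_ladd[OF assms] bilinear_radd[OF assms] bilinear_lmul[OF assms]
      bilinear_rmul[OF assms] algebra_simps add_divide_distrib)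

text \<open>What the hypotheses on the metric say in a chart about its Levi-Civita connection, with \<open>x\<^sub>0\<close> as defining
  function and with constant fields as arguments.\<close>

locale precompact_chart =
  fixes S :: "('n::finite) coords set"
    and g :: "'n coords \<Rightarrow> 'n coords \<Rightarrow> 'n coords \<Rightarrow> real"
    and \<Gamma> :: "'n coords \<Rightarrow> 'n coords \<Rightarrow> 'n coords \<Rightarrow> 'n coords"
  assumes S: "hopen S"
    and g_bilinear: "x \<in> pos S \<Longrightarrow> bilinear (g x)"
    and g_sym: "x \<in> pos S \<Longrightarrow> g x v w = g x w v"
    and g_nondegenerate: "x \<in> pos S \<Longrightarrow> (\<And>w. g x v w = 0) \<Longrightarrow> v = 0"
    and g_smooth: "smooth_on (pos S) (\<lambda>x. g x v w)"
    and \<Gamma>_bilinear: "x \<in> pos S \<Longrightarrow> bilinear (\<Gamma> x)"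
    and \<Gamma>_sym: "x \<in> pos S \<Longrightarrow> \<Gamma> x v w = \<Gamma> x w v"
    and g_parallel: "x \<in> pos S \<Longrightarrow> bderiv (\<lambda>y. g y u w) x v = g x (\<Gamma> x v u) w + g x u (\<Gamma> x v w)"
    and ext_normal: "\<exists>N. smooth_on S N \<and> (\<forall>x\<in>pos S. N x = rho_symbol \<Gamma> x v w $ None)"
    and ext_scaled: "\<exists>W. smooth_on S W \<and> (\<forall>x\<in>pos S. W x = x $ None *\<^sub>R rho_symbol \<Gamma> x v w)"
    and ext_tangential: "w $ None = 0 \<Longrightarrow>
      \<exists>Z. smooth_on S Z \<and> (\<forall>x\<in>pos S. Z x = rho_symbol \<Gamma> x v w)"
    and ext_ricci: "w $ None = 0 \<Longrightarrow> p \<in> S \<Longrightarrow> p $ None = 0 \<Longrightarrow>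
      \<exists>V F. hopen V \<and> V \<subseteq> S \<and> p \<in> V \<and> continuous_on V F \<and> (\<forall>x\<in>pos V. F x = chart_ricci \<Gamma> x v w)"
begin

lemma thick_S: "thick S" and thick_pos: "thick (pos S)" and hopen_pos_S: "hopen (pos S)"
  using thick_hopen S hopen_pos by auto

text \<open>The smooth extensions of the three kinds of symbols that pre-compactness controls.\<close>

definition \<nu> :: "'n option \<Rightarrow> 'n option \<Rightarrow> 'n coords \<Rightarrow> real" where
  "\<nu> a b = bval (\<lambda>x. rho_symbol \<Gamma> x (ax a) (ax b) $ None)"

definition \<omega> :: "'n option \<Rightarrow> 'n option \<Rightarrow> 'n coords \<Rightarrow> 'n coords" where
  "\<omega> a b = bval (\<lambda>x. x $ None *\<^sub>R rho_symbol \<Gamma> x (ax a) (ax b))"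

definition \<zeta> :: "'n option \<Rightarrow> 'n \<Rightarrow> 'n coords \<Rightarrow> 'n coords" where
  "\<zeta> a i = bval (\<lambda>x. rho_symbol \<Gamma> x (ax a) (ax (Some i)))"

lemma bval_extension:
  fixes u :: "'n coords \<Rightarrow> 'b::real_normed_vector"
  assumes "\<exists>U. smooth_on S U \<and> (\<forall>x\<in>pos S. U x = u x)"
  shows "smooth_on S (bval u)" and "x \<in> pos S \<Longrightarrow> bval u x = u x"
proof -
  obtain U where "smooth_on S U" "\<forall>x\<in>pos S. U x = u x" using assms by blast
  then have "\<exists>V U. hopen V \<and> x \<in> V \<and> smooth_on V U \<and> (\<forall>y\<in>pos V. U y = u y)" if "x \<in> S" for x
    using S that by blast
  then show "smooth_on S (bval u)" and "x \<in> pos S \<Longrightarrow> bval u x = u x"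
    using smooth_on_bval(1)[OF S, of u] smooth_on_bval(2)[OF S, of u x] by blast+
qed

lemma smooth_\<nu>: "smooth_on S (\<nu> a b)"
  and \<nu>: "x \<in> pos S \<Longrightarrow> \<nu> a b x = rho_symbol \<Gamma> x (ax a) (ax b) $ None"
  unfolding \<nu>_def by (rule bval_extension[OF ext_normal]; assumption)+

lemma smooth_\<omega>: "smooth_on S (\<omega> a b)"
  and \<omega>: "x \<in> pos S \<Longrightarrow> \<omega> a b x = x $ None *\<^sub>R rho_symbol \<Gamma> x (ax a) (ax b)"
  unfolding \<omega>_def by (rule bval_extension[OF ext_scaled]; assumption)+

lemma smooth_\<zeta>: "smooth_on S (\<zeta> a i)"
  and \<zeta>: "x \<in> pos S \<Longrightarrow> \<zeta> a i x = rho_symbol \<Gamma> x (ax a) (ax (Some i))"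
  unfolding \<zeta>_def
  by (rule bval_extension[OF ext_tangential]; (assumption | simp add: axis_def))+

lemma rho_symbol_sym: "x \<in> pos S \<Longrightarrow> rho_symbol \<Gamma> x v w = rho_symbol \<Gamma> x w v"
  by (simp add: rho_symbol_def \<Gamma>_sym)

lemma bderiv_\<Gamma>:
  assumes x: "x \<in> pos S"
  shows "bderiv (\<lambda>y. \<Gamma> y (ax c) (ax (Some i))) x v
    = bderiv (\<zeta> c i) x v + (ax c $ None * v $ None / (x $ None)\<^sup>2) *\<^sub>R ax (Some i)"
proof -
  have x0: "x $ None \<noteq> 0" using x by (simp add: pos_def)
  have xS: "x \<in> S" using x pos_subset by blast
  have "((\<lambda>y. (ax c $ None / y $ None) *\<^sub>R (ax (Some i) :: 'n coords)) has_derivative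
      (\<lambda>v. (- (ax c $ None * v $ None / (x $ None)\<^sup>2)) *\<^sub>R ax (Some i))) (at x within half_space)"
    using x0 by (auto intro!: derivative_eq_intros bounded_linear_imp_has_derivative[OF bounded_linear_vec_nth] simp: power2_eq_square divide_inverse mult_ac)
  from has_derivative_diff[OF has_bderiv[OF S smooth_\<zeta> xS] this]
  have "bderiv (\<lambda>y. \<zeta> c i y - (ax c $ None / y $ None) *\<^sub>R ax (Some i)) x
      = (\<lambda>v. bderiv (\<zeta> c i) x v - (- (ax c $ None * v $ None / (x $ None)\<^sup>2)) *\<^sub>R ax (Some i))"
    by (intro bderiv_eqI) (use xS openin_imp_subset[OF S] in auto)
  moreover have "bderiv (\<lambda>y. \<Gamma> y (ax c) (ax (Some i))) x
      = bderiv (\<lambda>y. \<zeta> c i y - (ax c $ None / y $ None) *\<^sub>R ax (Some i)) x"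
    by (rule bderiv_cong[OF hopen_pos_S x]) (simp add: \<zeta> rho_symbol_def axis_def)
  ultimately show ?thesis by simp
qed

subsection \<open>The Ricci tensor at the boundary\<close>

text \<open>The trace \<open>\<Sum>a. \<nabla>\<^sup>\<rho>\<^sub>a \<partial>\<^sub>d\<close> in terms of symbols that extend: for \<open>d = None\<close> the symmetry of the connection
  avoids those without extension.\<close>

definition \<tau> :: "'n option \<Rightarrow> 'n coords \<Rightarrow> real" where
  "\<tau> d x = (case d of None \<Rightarrow> \<nu> None None x + (\<Sum>k\<in>UNIV. \<zeta> None k x $ Some k)
     | Some k \<Rightarrow> (\<Sum>a\<in>UNIV. \<zeta> a k x $ a))"

lemma \<tau>: "x \<in> pos S \<Longrightarrow> \<tau> d x = (\<Sum>a\<in>UNIV. rho_symbol \<Gamma> x (ax a) (ax d) $ a)"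
  by (cases d) (simp_all add: \<tau>_def \<nu> \<zeta> sum_option rho_symbol_sym[of x "ax (Some k)" e\<^sub>0 for k])

text \<open>The part of \<open>Ric\<close> without poles.\<close>

definition ricci_rest :: "'n option \<Rightarrow> 'n \<Rightarrow> 'n coords \<Rightarrow> real" where
  "ricci_rest c i x = (\<Sum>a\<in>UNIV. bderiv (\<zeta> c i) x (ax a) $ a - bderiv (\<zeta> a i) x (ax c) $ a)
     + \<nu> c (Some i) x * \<tau> None x + (\<Sum>k\<in>UNIV. \<zeta> c i x $ Some k * \<tau> (Some k) x)
     - (\<Sum>a\<in>UNIV. \<Sum>k\<in>UNIV. \<zeta> a i x $ Some k * \<zeta> c k x $ a)"

lemma scaled_ricci:
  assumes x: "x \<in> pos S"
  shows "x $ None * chart_ricci \<Gamma> x (ax c) (ax (Some i)) = x $ None * ricci_rest c i x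
    - CARD('n) * \<nu> c (Some i) x - (\<Sum>a\<in>UNIV. \<nu> a (Some i) x * \<omega> c None x $ a)"
proof -
  let ?L = "rho_symbol \<Gamma> x" and ?r = "x $ None"
  have r: "?r \<noteq> 0" using x by (simp add: pos_def)
  have bL: "bilinear ?L" by (rule bilinear_rho_symbol[of \<Gamma> x, OF \<Gamma>_bilinear[OF x]])
  have G: "\<Gamma> x v w = ?L v w - (v $ None / ?r) *\<^sub>R w - (w $ None / ?r) *\<^sub>R v" for v w
    by (simp add: rho_symbol_def)
  have z: "ax a $ None * (s :: real) / t * ax (Some i) $ a = 0" for a s t by (simp add: axis_def)
  have z': "ax c $ None * ax a $ None / t * ax (Some i) $ a = (0::real)" for a t by (simp add: axis_def)
  have "chart_ricci \<Gamma> x (ax c) (ax (Some i))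
    = (\<Sum>a\<in>UNIV. (bderiv (\<zeta> c i) x (ax a) $ a - bderiv (\<zeta> a i) x (ax c) $ a)
       + (\<Gamma> x (ax a) (\<Gamma> x (ax c) (ax (Some i))) $ a - \<Gamma> x (ax c) (\<Gamma> x (ax a) (ax (Some i))) $ a))"
    unfolding chart_ricci_def by (rule sum.cong) (simp_all add: bderiv_\<Gamma>[OF x] z z')
  also have "\<dots> = (\<Sum>a\<in>UNIV. bderiv (\<zeta> c i) x (ax a) $ a - bderiv (\<zeta> a i) x (ax c) $ a)
      + (?L (ax c) (ax (Some i)) $ None * \<tau> None x + (\<Sum>k\<in>UNIV. ?L (ax c) (ax (Some i)) $ Some k * \<tau> (Some k) x)
      - CARD('n) * ?L (ax c) (ax (Some i)) $ None / ?r
      - (\<Sum>a\<in>UNIV. ?L (ax c) (?L (ax a) (ax (Some i))) $ a))"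
    unfolding sum.distrib \<tau>[OF x] using ricci_quadratic_part[OF G bL r, of c i] by simp
  finally have 1: "chart_ricci \<Gamma> x (ax c) (ax (Some i)) = \<dots>" .
  have 2: "(\<Sum>a\<in>UNIV. ?L (ax c) (?L (ax a) (ax (Some i))) $ a)
      = (\<Sum>a\<in>UNIV. \<nu> a (Some i) x * ?L (ax c) e\<^sub>0 $ a) + (\<Sum>a\<in>UNIV. \<Sum>k\<in>UNIV. \<zeta> a i x $ Some k * \<zeta> c k x $ a)"
  proof -
    have lin: "linear (?L v)" for v using bL by (simp add: bilinear_def)
    have "?L (ax c) (?L (ax a) (ax (Some i))) $ a
        = \<nu> a (Some i) x * ?L (ax c) e\<^sub>0 $ a + (\<Sum>k\<in>UNIV. \<zeta> a i x $ Some k * \<zeta> c k x $ a)" for a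
      by (subst linear_ax_expansion[OF lin]) (simp add: sum_option \<nu>[OF x] \<zeta>[OF x])
    then show ?thesis by (simp add: sum.distrib)
  qed
  have 3: "?r * (\<Sum>a\<in>UNIV. \<nu> a (Some i) x * ?L (ax c) e\<^sub>0 $ a) = (\<Sum>a\<in>UNIV. \<nu> a (Some i) x * \<omega> c None x $ a)"
    by (simp add: \<omega>[OF x] sum_distrib_left mult_ac)
  have 4: "?r * (CARD('n) * ?L (ax c) (ax (Some i)) $ None / ?r) = CARD('n) * \<nu> c (Some i) x"
    using r by (simp add: \<nu>[OF x])
  show ?thesis
    unfolding 1 2 ricci_rest_def 3[symmetric] 4[symmetric] by (simp add: \<nu>[OF x] \<zeta>[OF x] algebra_simps)
qed

text \<open>The limit of \<open>scaled_ricci\<close> at the boundary. This is where the condition on the Ricci curvature enters: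
  \<open>x\<^sub>0 Ric\<close> tends to zero.\<close>

lemma \<nu>_relation:
  assumes p: "p \<in> S" "p $ None = 0"
  shows "CARD('n) * \<nu> c (Some i) p + (\<Sum>a\<in>UNIV. \<nu> a (Some i) p * \<omega> c None p $ a) = 0"
proof -
  obtain V F where V: "hopen V" "V \<subseteq> S" "p \<in> V" "continuous_on V F"
      "\<forall>x\<in>pos V. F x = chart_ricci \<Gamma> x (ax c) (ax (Some i))"
    using ext_ricci[of "ax (Some i)" p "ax c"] p by (auto simp: axis_def)
  have sm: "smooth_on S (ricci_rest c i)"
    unfolding ricci_rest_def \<tau>_def option.case
    by (intro smooth_intros thick_S smooth_\<nu> smooth_\<zeta> S)
  have c: "continuous_on V f" if "smooth_on S f" for f :: "'n coords \<Rightarrow> 'b::real_normed_vector"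
    using smooth_on_continuous[OF that] V(2) continuous_on_subset by blast
  have "p $ None * F p = p $ None * ricci_rest c i p
    - CARD('n) * \<nu> c (Some i) p - (\<Sum>a\<in>UNIV. \<nu> a (Some i) p * \<omega> c None p $ a)"
  proof (rule eq_from_pos[OF V(1) _ _ _ V(3), where
        f = "\<lambda>p. p $ None * F p" and g = "\<lambda>p. p $ None * ricci_rest c i p
    - CARD('n) * \<nu> c (Some i) p - (\<Sum>a\<in>UNIV. \<nu> a (Some i) p * \<omega> c None p $ a)"])
    show "continuous_on V (\<lambda>p. p $ None * F p)"
      by (intro continuous_intros V(4))
    show "continuous_on V (\<lambda>p. p $ None * ricci_rest c i p
      - CARD('n) * \<nu> c (Some i) p - (\<Sum>a\<in>UNIV. \<nu> a (Some i) p * \<omega> c None p $ a))"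
      by (intro continuous_intros c sm smooth_\<nu> smooth_\<omega>)
    show "x $ None * F x = x $ None * ricci_rest c i x
      - CARD('n) * \<nu> c (Some i) x - (\<Sum>a\<in>UNIV. \<nu> a (Some i) x * \<omega> c None x $ a)" if "x \<in> pos V" for x
      using scaled_ricci[of x c i] V(5) that pos_mono[OF V(2)] by auto
  qed
  then show ?thesis using p(2) by simp
qed

lemma eq_on_boundary:
  fixes f h :: "'n coords \<Rightarrow> 'b::real_normed_vector"
  assumes "smooth_on S f" "smooth_on S h" "\<And>x. x \<in> pos S \<Longrightarrow> f x = h x" "x \<in> S"
  shows "f x = h x"
  by (rule eq_from_pos[OF S smooth_on_continuous[OF assms(1)] smooth_on_continuous[OF assms(2)] assms(3,4)])

lemma \<omega>_tangential:
  assumes "x \<in> S"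
  shows "\<omega> (Some j) None x = x $ None *\<^sub>R \<zeta> None j x"
  by (rule eq_on_boundary[OF smooth_\<omega> _ _ assms])
    (intro smooth_intros thick_S smooth_\<zeta> | simp add: \<omega> \<zeta> rho_symbol_sym[of _ "ax (Some j)" e\<^sub>0])+

text \<open>The term of \<open>\<nu>_relation\<close> with \<open>\<omega>\<close> vanishes for tangential \<open>c\<close>, because \<open>\<omega>\<close> does; for \<open>c = None\<close> it is
  a combination of the functions \<open>\<nu>\<close> treated before.\<close>

lemma \<nu>_boundary:
  assumes p: "p \<in> S" "p $ None = 0"
  shows "\<nu> c (Some i) p = 0"
proof -
  have 1: "\<nu> (Some j) (Some i) p = 0" for j
    using \<nu>_relation[OF p, of "Some j" i] p by (simp add: \<omega>_tangential)
  have "\<omega> None None p $ None = p $ None * \<nu> None None p"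
    by (rule eq_on_boundary[OF _ _ _ p(1)])
      (intro smooth_intros thick_S smooth_\<omega> smooth_\<nu> | simp add: \<omega> \<nu>)+
  then have "\<nu> None (Some i) p = 0"
    using \<nu>_relation[OF p, of None i] p(2) by (simp add: sum_option 1)
  then show ?thesis using 1 by (cases c) auto
qed

subsection \<open>The metric in the frame of the b-tangent bundle\<close>

text \<open>The fields \<open>E\<^sub>0 = x\<^sub>0 \<partial>\<^sub>0, E\<^sub>i = \<partial>\<^sub>i\<close> are a frame for the vector fields tangent to the boundary. In the frame
  \<open>x\<^sub>0 E\<^sub>a\<close> the connection has coefficients that are smooth up to the boundary. This needs that the functions
  \<open>\<nu> c (Some i)\<close> vanish there.\<close>

definition \<Theta> :: "'n option \<Rightarrow> 'n coords \<Rightarrow> real ^ 'n option ^ 'n option" where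
  "\<Theta> c x = (\<chi> a d. case a of
      None \<Rightarrow> (case d of None \<Rightarrow> \<nu> c None x | Some k \<Rightarrow> \<omega> c None x $ Some k - (if c = Some k then 1 else 0))
    | Some i \<Rightarrow> (case d of None \<Rightarrow> normal_quotient (\<nu> c (Some i)) x | Some k \<Rightarrow> \<zeta> c i x $ Some k))"

definition frame_factor :: "'n option \<Rightarrow> 'n coords \<Rightarrow> real" where
  "frame_factor a x = (if a = None then x $ None else 1)"

definition frame_metric :: "'n coords \<Rightarrow> real ^ 'n option ^ 'n option" where
  "frame_metric x = (\<chi> a b. (x $ None)\<^sup>2 * frame_factor a x * frame_factor b x * g x (ax a) (ax b))"

lemma smooth_\<Theta>: "smooth_on S (\<lambda>x. \<Theta> c x $ a $ d)"
proof -
  have "smooth_on S (normal_quotient (\<nu> c (Some i)))" for i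
    by (rule smooth_on_normal_quotient[OF S smooth_\<nu> \<nu>_boundary])
  then show ?thesis
    unfolding \<Theta>_def
    by (cases a; cases d)
      (simp_all add: smooth_\<nu> smooth_on_diff smooth_on_nth smooth_\<omega> smooth_\<zeta> smooth_on_const thick_S)
qed

lemma \<Theta>_interior:
  assumes x: "x \<in> pos S"
  shows "\<Theta> c x $ a $ d * frame_factor d x = frame_factor a x * \<Gamma> x (ax c) (ax a) $ d
    + (if d = a then frame_factor a x * (ax c $ None * (if a = None then 2 else 1) / x $ None) else 0)"
proof -
  have r: "x $ None \<noteq> 0" using x by (simp add: pos_def)
  have "x \<in> S" using x pos_subset by blast
  then have nq: "x $ None * normal_quotient (\<nu> c (Some i)) x = \<nu> c (Some i) x" for i
    using normal_quotient_mult[OF S smooth_\<nu>[of c "Some i"] \<nu>_boundary, of x] by simp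
  show ?thesis
    by (cases a; cases d)
      (use r in \<open>auto simp: \<Theta>_def frame_factor_def nq mult.commute[of "normal_quotient _ _"] \<nu>[OF x] \<omega>[OF x] \<zeta>[OF x] rho_symbol_def axis_def field_simps\<close>)
qed

lemma smooth_frame_metric: "smooth_on (pos S) (\<lambda>x. frame_metric x $ a $ b)"
proof -
  have "smooth_on (pos S) (frame_factor a)" for a
    unfolding frame_factor_def
    by (cases a) (simp_all add: smooth_on_nth smooth_on_id smooth_on_const thick_pos)
  then show ?thesis
    unfolding frame_metric_def vec_lambda_beta
    by (intro smooth_on_mult smooth_on_power smooth_on_nth smooth_on_id thick_pos g_smooth) auto
qed

lemma bderiv_nth:
  fixes f :: "'n coords \<Rightarrow> 'b::real_normed_vector ^ 'm"
  assumes "(f has_derivative D) (at x within half_space)" "x \<in> half_space"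
  shows "bderiv (\<lambda>y. f y $ i) x v = D v $ i"
  using bderiv_eqI[OF assms(2) bounded_linear.has_derivative[OF bounded_linear_vec_nth assms(1)], of i] by simp

lemma bderiv_frame_metric:
  assumes x: "x \<in> pos S"
  shows "bderiv (\<lambda>y. frame_metric y $ a $ b) x (ax c)
    = (\<Theta> c x ** frame_metric x + frame_metric x ** transpose (\<Theta> c x)) $ a $ b"
proof -
  let ?r = "x $ None" and ?c = "ax c $ None :: real"
  let ?s = "\<lambda>a. frame_factor a x"
  let ?k = "\<lambda>a. ?c * (if a = None then 2 else (1::real)) / ?r"
  have r: "?r \<noteq> 0" using x by (simp add: pos_def)
  have bg: "bilinear (g x)" by (rule g_bilinear[OF x])
  have lin: "linear (\<lambda>v. g x v w)" "linear (g x w)" for w using bg by (auto simp: bilinear_def)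
  have gl: "g x (\<Gamma> x (ax c) (ax a)) w = (\<Sum>d\<in>UNIV. \<Gamma> x (ax c) (ax a) $ d * g x (ax d) w)" for w a
    using linear_ax_expansion[OF lin(1)[of w], of "\<Gamma> x (ax c) (ax a)"] by simp
  have gr: "g x w (\<Gamma> x (ax c) (ax a)) = (\<Sum>d\<in>UNIV. \<Gamma> x (ax c) (ax a) $ d * g x w (ax d))" for w a
    using linear_ax_expansion[OF lin(2)[of w], of "\<Gamma> x (ax c) (ax a)"] by simp
  have half: "x \<in> half_space" using x openin_imp_subset[OF S] pos_subset by blast
  have ds: "(frame_factor a has_derivative (\<lambda>v. if a = None then v $ None else 0)) (at x within half_space)" for a
    unfolding frame_factor_def
    by (cases a) (simp_all add: bounded_linear_imp_has_derivative[OF bounded_linear_vec_nth])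
  have dr: "((\<lambda>y. (y $ None)\<^sup>2) has_derivative (\<lambda>v. 2 * ?r * v $ None)) (at x within half_space)"
    by (auto intro!: derivative_eq_intros bounded_linear_imp_has_derivative[OF bounded_linear_vec_nth])
  have dg: "((\<lambda>y. g y (ax a) (ax b)) has_derivative bderiv (\<lambda>y. g y (ax a) (ax b)) x) (at x within half_space)"
    by (rule has_bderiv[OF hopen_pos_S g_smooth x])
  have "bderiv (\<lambda>y. frame_metric y $ a $ b) x (ax c)
    = 2 * ?r * ?c * ?s a * ?s b * g x (ax a) (ax b)
      + ?r\<^sup>2 * ((if a = None then ?c else 0) * ?s b + ?s a * (if b = None then ?c else 0)) * g x (ax a) (ax b)
      + ?r\<^sup>2 * ?s a * ?s b * bderiv (\<lambda>y. g y (ax a) (ax b)) x (ax c)"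
    using fun_cong[OF bderiv_eqI[OF half
        has_derivative_mult[OF has_derivative_mult[OF has_derivative_mult[OF dr ds[of a]] ds[of b]] dg]], of "ax c"]
    unfolding frame_metric_def vec_lambda_beta by (simp add: algebra_simps)
  also have "\<dots> = ?r\<^sup>2 * ?s a * ?s b * (g x (\<Gamma> x (ax c) (ax a)) (ax b) + g x (ax a) (\<Gamma> x (ax c) (ax b)))
      + ?r\<^sup>2 * ?s a * ?s b * (?k a + ?k b) * g x (ax a) (ax b)"
    unfolding g_parallel[OF x]
    by (cases a; cases b) (use r in \<open>simp_all add: frame_factor_def field_simps power2_eq_square\<close>)
  finally have 1: "bderiv (\<lambda>y. frame_metric y $ a $ b) x (ax c) = \<dots>" .
  have 2: "(\<Sum>d\<in>UNIV. \<Theta> c x $ a $ d * frame_factor d x * h d)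
      = ?s a * (\<Sum>d\<in>UNIV. \<Gamma> x (ax c) (ax a) $ d * h d) + ?s a * ?k a * h a" for a and h :: "'n option \<Rightarrow> real"
    unfolding \<Theta>_interior[OF x]
    by (simp add: distrib_right sum.distrib sum_distrib_left mult.assoc if_distrib[of "\<lambda>x. x * _"] cong: if_cong)
  have "(\<Theta> c x ** frame_metric x) $ a $ b
      = ?r\<^sup>2 * ?s b * (\<Sum>d\<in>UNIV. \<Theta> c x $ a $ d * frame_factor d x * g x (ax d) (ax b))"
    by (simp add: matrix_matrix_mult_def frame_metric_def sum_distrib_left mult_ac)
  moreover have "(frame_metric x ** transpose (\<Theta> c x)) $ a $ b
      = ?r\<^sup>2 * ?s a * (\<Sum>d\<in>UNIV. \<Theta> c x $ b $ d * frame_factor d x * g x (ax a) (ax d))"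
    by (simp add: matrix_matrix_mult_def transpose_def frame_metric_def sum_distrib_left mult_ac)
  ultimately show ?thesis unfolding 1 2 gl gr by (simp add: algebra_simps)
qed

lemma frame_metric_system:
  assumes x: "x \<in> pos S"
  shows "(frame_metric has_derivative
    (\<lambda>v. \<Sum>c\<in>UNIV. v $ c *\<^sub>R (\<Theta> c x ** frame_metric x + frame_metric x ** transpose (\<Theta> c x)))) (at x)"
proof -
  have half: "x \<in> half_space" using x openin_imp_subset[OF S] pos_subset by blast
  have "smooth_on (pos S) frame_metric"
    by (simp add: smooth_on_vec_iff[OF thick_pos] smooth_frame_metric)
  note D = has_bderiv[OF hopen_pos_S this x]
  have "bderiv frame_metric x (ax c) = \<Theta> c x ** frame_metric x + frame_metric x ** transpose (\<Theta> c x)" for c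
    unfolding vec_eq_iff
  proof (intro allI)
    fix a b
    have "bderiv (\<lambda>y. frame_metric y $ a $ b) x (ax c) = bderiv frame_metric x (ax c) $ a $ b"
      by (rule bderiv_nth[OF bounded_linear.has_derivative[OF bounded_linear_vec_nth D] half])
    then show "bderiv frame_metric x (ax c) $ a $ b
      = (\<Theta> c x ** frame_metric x + frame_metric x ** transpose (\<Theta> c x)) $ a $ b"
      using bderiv_frame_metric[OF x] by simp
  qed
  then have "bderiv frame_metric x v
    = (\<Sum>c\<in>UNIV. v $ c *\<^sub>R (\<Theta> c x ** frame_metric x + frame_metric x ** transpose (\<Theta> c x)))" for v
    using linear_ax_expansion[OF has_derivative_linear[OF D], of v] by simp
  then have "bderiv frame_metric x
    = (\<lambda>v. \<Sum>c\<in>UNIV. v $ c *\<^sub>R (\<Theta> c x ** frame_metric x + frame_metric x ** transpose (\<Theta> c x)))"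
    by (rule ext)
  then show ?thesis using D at_within_pos[OF S x] by simp
qed

definition G :: "'n coords \<Rightarrow> real ^ 'n option ^ 'n option" where
  "G = bval frame_metric"

lemma smooth_matrix_product:
  fixes A B :: "'n coords \<Rightarrow> real ^ 'n option ^ 'n option"
  assumes "thick T" "\<And>i j. smooth_on T (\<lambda>x. A x $ i $ j)" "\<And>i j. smooth_on T (\<lambda>x. B x $ i $ j)"
  shows "smooth_on T (\<lambda>x. (A x ** B x) $ i $ j)"
  unfolding matrix_matrix_mult_def vec_lambda_beta by (intro smooth_on_sum smooth_on_mult assms)

lemma smooth_matrix:
  fixes A :: "'n coords \<Rightarrow> real ^ 'n option ^ 'n option"
  assumes "thick T"
  shows "smooth_on T A \<longleftrightarrow> (\<forall>i j. smooth_on T (\<lambda>x. A x $ i $ j))"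
  by (simp add: smooth_on_vec_iff[OF assms])

lemma smooth_G_matrix: "smooth_on S G"
  and G: "x \<in> pos S \<Longrightarrow> G x = frame_metric x"
proof -
  have lin: "linear (\<lambda>A. \<Theta> c x ** A + A ** transpose (\<Theta> c x))" for c x
    by (rule linearI) (simp_all add: vec_eq_iff matrix_matrix_mult_def sum.distrib sum_distrib_left algebra_simps)
  have sm: "smooth_on S (\<lambda>x. \<Theta> c x ** A + A ** transpose (\<Theta> c x))" for c A
    unfolding smooth_matrix[OF thick_S] vector_add_component
    by (intro allI smooth_on_add smooth_matrix_product smooth_on_const thick_S smooth_\<Theta>)
      (simp add: transpose_def smooth_\<Theta>)
  show "smooth_on S G" and "x \<in> pos S \<Longrightarrow> G x = frame_metric x"
    unfolding G_def using linear_system_extends[OF S lin sm frame_metric_system] by auto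
qed

lemma smooth_G: "smooth_on S (\<lambda>x. G x $ a $ b)"
  using smooth_G_matrix smooth_matrix[OF thick_S] by blast

lemma frame_metric_sym: "x \<in> pos S \<Longrightarrow> frame_metric x $ a $ b = frame_metric x $ b $ a"
  by (simp add: frame_metric_def g_sym mult_ac)

lemma G_sym: "x \<in> S \<Longrightarrow> G x $ a $ b = G x $ b $ a"
  by (rule eq_on_boundary[OF smooth_G smooth_G]) (simp_all add: G frame_metric_sym)

text \<open>At the boundary the covariant derivative of the frame vector \<open>x\<^sub>0 E\<^sub>0\<close> in direction \<open>\<partial>\<^sub>j\<close> has the component
  \<open>- 1\<close> along \<open>x\<^sub>0 E\<^sub>j\<close>, which comes from the pole of the symbols, and no other ones.\<close>

lemma bderiv_G_boundary:
  assumes p: "p \<in> S" "p $ None = 0"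
  shows "bderiv (\<lambda>x. G x $ None $ None) p (ax (Some j)) = - 2 * G p $ None $ Some j"
proof -
  have "bderiv (\<lambda>x. G x $ None $ None) p (ax (Some j))
    = 2 * (\<Sum>d\<in>UNIV. \<Theta> (Some j) p $ None $ d * G p $ d $ None)"
  proof (rule eq_on_boundary[OF _ _ _ p(1)])
    show "smooth_on S (\<lambda>p. bderiv (\<lambda>x. G x $ None $ None) p (ax (Some j)))"
      by (rule smooth_on_bderiv[OF S smooth_G])
    show "smooth_on S (\<lambda>p. 2 * (\<Sum>d\<in>UNIV. \<Theta> (Some j) p $ None $ d * G p $ d $ None))"
      by (intro smooth_on_mult smooth_on_sum smooth_on_const thick_S smooth_\<Theta> smooth_G)
    fix x assume x: "x \<in> pos S"
    have "bderiv (\<lambda>x. G x $ None $ None) x (ax (Some j))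
        = bderiv (\<lambda>x. frame_metric x $ None $ None) x (ax (Some j))"
      using bderiv_cong[OF hopen_pos_S x, of "\<lambda>x. G x $ None $ None" "\<lambda>x. frame_metric x $ None $ None"] G by simp
    then show "bderiv (\<lambda>x. G x $ None $ None) x (ax (Some j))
        = 2 * (\<Sum>d\<in>UNIV. \<Theta> (Some j) x $ None $ d * G x $ d $ None)"
      by (simp add: bderiv_frame_metric[OF x] G[OF x] matrix_matrix_mult_def transpose_def
          frame_metric_sym[OF x, of None] mult.commute)
  qed
  moreover have "\<nu> (Some j) None p = \<nu> None (Some j) p"
    by (rule eq_on_boundary[OF smooth_\<nu> smooth_\<nu> _ p(1)]) (simp add: \<nu> rho_symbol_sym)
  then have "\<Theta> (Some j) p $ None $ None = 0" by (simp add: \<Theta>_def \<nu>_boundary[OF p])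
  moreover have "\<Theta> (Some j) p $ None $ Some k = (if k = j then - 1 else 0)" for k
    using p by (auto simp: \<Theta>_def \<omega>_tangential)
  ultimately show ?thesis
    by (simp add: sum_option G_sym[OF p(1), of "Some j" None] if_distrib[of "\<lambda>x. x * _"] cong: if_cong)
qed

lemma det_frame_metric:
  assumes x: "x \<in> pos S"
  shows "det (frame_metric x) = (x $ None) ^ (2 * CARD('n) + 4) * det (\<chi> i j. g x (ax i) (ax j))"
proof -
  define s where "s a = x $ None * frame_factor a x" for a
  define m :: "real ^ 'n option ^ 'n option" where "m = (\<chi> i j. g x (ax i) (ax j))"
  have s: "prod s UNIV = (x $ None) ^ (CARD('n) + 2)"
    by (simp add: s_def prod_option frame_factor_def)
  have "frame_metric x = (\<chi> a. s a *s (transpose (\<chi> b. s b *s transpose m $ b)) $ a)"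
    by (simp add: vec_eq_iff frame_metric_def transpose_def m_def s_def power2_eq_square)
  then have "det (frame_metric x) = prod s UNIV * (prod s UNIV * det m)"
    by (simp add: det_rows_mul)
  moreover have "CARD('n) + 2 + (CARD('n) + 2) = 2 * CARD('n) + 4" by simp
  then have "(x $ None) ^ (CARD('n) + 2) * (x $ None) ^ (CARD('n) + 2) = (x $ None) ^ (2 * CARD('n) + 4)"
    by (simp only: power_add[symmetric])
  ultimately show ?thesis unfolding s m_def by (simp only: mult.assoc[symmetric])
qed

lemma det_g_nonzero:
  assumes x: "x \<in> pos S"
  shows "det (\<chi> i j. g x (ax i) (ax j)) \<noteq> 0"
proof -
  let ?m = "\<chi> i j. g x (ax i) (ax j)"
  have "v = 0" if v: "?m *v v = 0" for v
  proof (rule g_nondegenerate[OF x])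
    fix w
    have lin: "linear (g x v)" "linear (\<lambda>v. g x v w)" for v w
      using g_bilinear[OF x] by (auto simp: bilinear_def)
    have "g x (ax i) v = 0" for i
      using linear_ax_expansion[OF lin(1)[of "ax i"], of v] v
      by (simp add: vec_eq_iff matrix_vector_mult_def mult.commute)
    then show "g x v w = 0"
      using linear_ax_expansion[OF lin(1)[of v], of w] by (simp add: g_sym[OF x, of v])
  qed
  then show ?thesis
    using matrix_left_invertible_ker[of ?m] invertible_det_nz[of ?m] by (metis invertible_left_inverse)
qed

lemma det_frame_metric_nonzero: "x \<in> pos S \<Longrightarrow> det (frame_metric x) \<noteq> 0"
  using det_frame_metric det_g_nonzero pos_pos by fastforce

lemma frame_metric_inverse:
  assumes "x \<in> pos S"
  shows "frame_metric x ** matrix_inv (frame_metric x) = mat 1"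
    and "matrix_inv (frame_metric x) ** frame_metric x = mat 1"
proof -
  have "\<exists>B. frame_metric x ** B = mat 1 \<and> B ** frame_metric x = mat 1"
    using det_frame_metric_nonzero[OF assms] invertible_det_nz[of "frame_metric x"]
    unfolding invertible_def by simp
  from someI_ex[OF this] show "frame_metric x ** matrix_inv (frame_metric x) = mat 1"
    and "matrix_inv (frame_metric x) ** frame_metric x = mat 1"
    unfolding matrix_inv_def by auto
qed

lemma smooth_frame_metric_inverse: "smooth_on (pos S) (\<lambda>x. matrix_inv (frame_metric x) $ k $ j)"
proof -
  have "smooth_on (pos S) (\<lambda>x. det (\<chi> i l. if l = k then ax j $ i else frame_metric x $ i $ l) / det (frame_metric x))"
  proof (intro smooth_on_divide smooth_on_det thick_pos det_frame_metric_nonzero smooth_frame_metric)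
    show "smooth_on (pos S) (\<lambda>x. (\<chi> i l. if l = k then ax j $ i else frame_metric x $ i $ l) $ i $ l)" for i l
      by (cases "l = k") (simp_all add: smooth_on_const thick_pos smooth_frame_metric)
  qed
  then show ?thesis
  proof (rule smooth_on_eq)
    fix x assume x: "x \<in> pos S"
    have "frame_metric x *v (matrix_inv (frame_metric x) *v ax j) = ax j"
      by (simp add: matrix_vector_mul_assoc frame_metric_inverse[OF x])
    then have "matrix_inv (frame_metric x) *v ax j
      = (\<chi> k. det (\<chi> i l. if l = k then ax j $ i else frame_metric x $ i $ l) / det (frame_metric x))"
      using cramer[OF det_frame_metric_nonzero[OF x]] by blast
    moreover have "matrix_inv (frame_metric x) $ k $ j = (matrix_inv (frame_metric x) *v ax j) $ k"
      by (simp add: matrix_vector_mult_def axis_def if_distrib[of "\<lambda>x. _ * x"] cong: if_cong)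
    ultimately show "det (\<chi> i l. if l = k then ax j $ i else frame_metric x $ i $ l) / det (frame_metric x)
      = matrix_inv (frame_metric x) $ k $ j" by simp
  qed
qed

lemma bounded_bilinear_matrix_mult:
  "bounded_bilinear ((**) :: real ^ 'm ^ 'm \<Rightarrow> real ^ 'm ^ 'm \<Rightarrow> real ^ 'm ^ 'm)"
  unfolding bilinear_conv_bounded_bilinear[symmetric] bilinear_def
  by (intro conjI allI linearI)
    (simp_all add: vec_eq_iff matrix_matrix_mult_def sum.distrib sum_distrib_left algebra_simps)

text \<open>The derivative of the inverse is \<open>- H (dG) H\<close>. So the inverse solves a linear system with the same
  coefficients.\<close>

lemma inverse_system:
  assumes x: "x \<in> pos S"
  defines "H \<equiv> \<lambda>x. matrix_inv (frame_metric x)"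
  shows "(H has_derivative (\<lambda>v. \<Sum>c\<in>UNIV. v $ c *\<^sub>R (- (H x ** \<Theta> c x) - transpose (\<Theta> c x) ** H x))) (at x)"
proof -
  have half: "x \<in> half_space" using x openin_imp_subset[OF S] pos_subset by blast
  have smH: "smooth_on (pos S) H"
    unfolding H_def smooth_matrix[OF thick_pos] using smooth_frame_metric_inverse by blast
  have DH: "(H has_derivative bderiv H x) (at x)"
    using has_bderiv[OF hopen_pos_S smH x] at_within_pos[OF S x] by simp
  let ?F = "frame_metric x"
  let ?D = "\<lambda>v. \<Sum>c\<in>UNIV. v $ c *\<^sub>R (\<Theta> c x ** ?F + ?F ** transpose (\<Theta> c x))"
  have inv: "?F ** H x = mat 1" "H x ** ?F = mat 1"
    using frame_metric_inverse[OF x] by (simp_all add: H_def)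
  have "((\<lambda>y. frame_metric y ** H y) has_derivative (\<lambda>v. ?F ** bderiv H x v + ?D v ** H x)) (at x)"
    by (rule bounded_bilinear.FDERIV[OF bounded_bilinear_matrix_mult frame_metric_system[OF x] DH])
  moreover have "((\<lambda>y. frame_metric y ** H y) has_derivative (\<lambda>v. 0)) (at x)"
    by (rule has_derivative_transform_within_open[OF has_derivative_const open_pos[OF S] x, of "mat 1"])
      (simp add: H_def frame_metric_inverse)
  ultimately have "(\<lambda>v. ?F ** bderiv H x v + ?D v ** H x) = (\<lambda>v. 0)"
    by (rule has_derivative_unique)
  then have zero: "?F ** bderiv H x v + ?D v ** H x = 0" for v by meson
  have eq: "bderiv H x v = (\<Sum>c\<in>UNIV. v $ c *\<^sub>R (- (H x ** \<Theta> c x) - transpose (\<Theta> c x) ** H x))" for v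
  proof -
    interpret mm: bounded_bilinear "(**) :: real ^ 'n option ^ 'n option \<Rightarrow> real ^ 'n option ^ 'n option \<Rightarrow> real ^ 'n option ^ 'n option"
      by (rule bounded_bilinear_matrix_mult)
    have "H x ** (?F ** bderiv H x v + ?D v ** H x) = 0"
      unfolding zero by (rule mm.zero_right)
    then have "bderiv H x v = - (H x ** (?D v ** H x))"
      by (simp add: mm.add_right matrix_mul_assoc inv eq_neg_iff_add_eq_0)
    also have "\<dots> = (\<Sum>c\<in>UNIV. v $ c *\<^sub>R (- (H x ** ((\<Theta> c x ** ?F + ?F ** transpose (\<Theta> c x)) ** H x))))"
      by (simp add: mm.sum_left mm.sum_right mm.scaleR_left mm.scaleR_right sum_negf)
    also have "(\<lambda>c. H x ** ((\<Theta> c x ** ?F + ?F ** transpose (\<Theta> c x)) ** H x))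
        = (\<lambda>c. H x ** \<Theta> c x + transpose (\<Theta> c x) ** H x)"
    proof
      fix c
      have "(?F ** transpose (\<Theta> c x)) ** H x = ?F ** (transpose (\<Theta> c x) ** H x)"
        and "(\<Theta> c x ** ?F) ** H x = \<Theta> c x ** (?F ** H x)"
        and "H x ** (?F ** (transpose (\<Theta> c x) ** H x)) = (H x ** ?F) ** (transpose (\<Theta> c x) ** H x)"
        by (simp_all only: matrix_mul_assoc)
      then show "H x ** ((\<Theta> c x ** ?F + ?F ** transpose (\<Theta> c x)) ** H x)
          = H x ** \<Theta> c x + transpose (\<Theta> c x) ** H x"
        by (simp only: mm.add_left mm.add_right inv matrix_mul_lid matrix_mul_rid)
    qed
    finally show ?thesis by simp
  qed
  then have "bderiv H x = (\<lambda>v. \<Sum>c\<in>UNIV. v $ c *\<^sub>R (- (H x ** \<Theta> c x) - transpose (\<Theta> c x) ** H x))"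
    by (rule ext)
  then show ?thesis using DH by simp
qed

text \<open>The inverse extends to the boundary as well, and by continuity it is still the inverse there.\<close>

lemma det_G_nonzero:
  assumes x: "x \<in> S"
  shows "det (G x) \<noteq> 0"
proof -
  define H where "H = bval (\<lambda>x. matrix_inv (frame_metric x))"
  have lin: "linear (\<lambda>A. - (A ** \<Theta> c x) - transpose (\<Theta> c x) ** A)" for c x
    by (rule linearI) (simp_all add: vec_eq_iff matrix_matrix_mult_def sum.distrib sum_distrib_left algebra_simps)
  have sm: "smooth_on S (\<lambda>x. - (A ** \<Theta> c x) - transpose (\<Theta> c x) ** A)" for c A
    unfolding smooth_matrix[OF thick_S] vector_minus_component vector_uminus_component
    by (intro allI smooth_on_diff smooth_on_minus smooth_matrix_product smooth_on_const thick_S smooth_\<Theta>)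
      (simp add: transpose_def smooth_\<Theta>)
  have H: "smooth_on S H" "\<And>x. x \<in> pos S \<Longrightarrow> H x = matrix_inv (frame_metric x)"
    unfolding H_def using linear_system_extends[OF S lin sm inverse_system] by auto
  have smH: "smooth_on S (\<lambda>x. H x $ i $ j)" for i j
    using H(1) smooth_matrix[OF thick_S] by blast
  have "G x ** H x = mat 1"
  proof (rule eq_on_boundary[OF _ smooth_on_const[OF thick_S] _ x])
    show "smooth_on S (\<lambda>x. G x ** H x)"
      unfolding smooth_matrix[OF thick_S] by (intro allI smooth_matrix_product thick_S smooth_G smH)
    show "G x ** H x = mat 1" if "x \<in> pos S" for x
      using that by (simp add: G H(2) frame_metric_inverse)
  qed
  then have "det (G x) * det (H x) = 1" by (metis det_I det_mul)
  then show ?thesis by auto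
qed

lemma g_eq_G:
  assumes x: "x \<in> pos S"
  shows "g x (ax a) (ax b) = G x $ a $ b / ((x $ None)\<^sup>2 * frame_factor a x * frame_factor b x)"
  using pos_pos[OF x] by (simp add: G[OF x] frame_metric_def frame_factor_def)

end

section \<open>The normal form in a chart\<close>

lemma hopen_positive:
  fixes f :: "('n::finite) coords \<Rightarrow> real"
  assumes "hopen S" "continuous_on S f"
  shows "hopen {x \<in> S. 0 < f x}"
proof -
  have "openin (top_of_set S) (S \<inter> f -` {0<..})"
    by (rule continuous_openin_preimage_gen[OF assms(2)]) simp
  moreover have "S \<inter> f -` {0<..} = {x \<in> S. 0 < f x}" by auto
  ultimately show ?thesis using assms(1) openin_trans by metis
qed

context precompact_chart
begin

text \<open>The defining function \<open>\<phi> x\<^sub>0\<close> with \<open>\<phi> = \<bar>G\<^sub>0\<^sub>0\<bar> powr (-1/2)\<close> makes the leading coefficient \<open>\<epsilon>\<close>. The function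
  \<open>C\<close> is then chosen such that the component \<open>h\<^sub>0\<^sub>0\<close> vanishes. The components \<open>h\<^sub>0\<^sub>i\<close> have a simple
  pole, whose residue is zero by the formula for the derivatives of \<open>G\<^sub>0\<^sub>0\<close> along the boundary.\<close>

lemma normal_form:
  assumes p: "p \<in> S" "p $ None = 0" and \<epsilon>: "\<epsilon> = 1 \<or> \<epsilon> = - 1" "0 < \<epsilon> * G p $ None $ None"
  shows "\<exists>V R C C1 h. hopen V \<and> V \<subseteq> S \<and> p \<in> V \<and> smooth_on V R \<and> smooth_on V C \<and> smooth_on V C1
    \<and> (\<forall>x\<in>V. R x = 0 \<longleftrightarrow> x $ None = 0) \<and> (\<forall>x\<in>V. x $ None = 0 \<longrightarrow> bderiv R x e\<^sub>0 \<noteq> 0)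
    \<and> (\<forall>x\<in>V. C x = \<epsilon> + R x * C1 x)
    \<and> (\<forall>x\<in>V. bilinear (h x) \<and> (\<forall>v w. h x v w = h x w v)) \<and> (\<forall>v w. smooth_on V (\<lambda>x. h x v w))
    \<and> (\<forall>x\<in>pos V. \<forall>v w. g x v w = C x / R x ^ 4 * (bderiv R x v * bderiv R x w) + h x v w / (R x)\<^sup>2)
    \<and> (\<forall>x\<in>V. x $ None = 0 \<longrightarrow> (\<forall>v. v $ None = 0 \<and> (\<forall>w. w $ None = 0 \<longrightarrow> h x v w = 0) \<longrightarrow> v = 0))"
proof -
  define S1 where "S1 = {x \<in> S. 0 < \<epsilon> * G x $ None $ None}"
  have S1: "hopen S1"
    unfolding S1_def
    by (intro hopen_positive S continuous_on_mult continuous_on_const smooth_on_continuous[OF smooth_G])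
  have S1': "S1 \<subseteq> S" "p \<in> S1" using p \<epsilon> by (auto simp: S1_def)
  have oS1: "openin (top_of_set S) S1"
    using S1 S1' S openin_imp_subset by (metis openin_subset_trans)
  have t1: "thick S1" by (rule thick_hopen[OF S1])
  have G1: "smooth_on S1 (\<lambda>x. G x $ a $ b)" for a b by (rule smooth_on_openin[OF oS1 smooth_G])
  define \<phi> where "\<phi> x = (\<epsilon> * G x $ None $ None) powr (- 1 / 2)" for x
  have sm\<phi>1: "smooth_on S1 \<phi>"
    unfolding \<phi>_def by (intro smooth_on_powr t1 smooth_on_mult smooth_on_const G1) (simp add: S1_def)
  have \<phi>pos: "0 < \<phi> x" if "x \<in> S1" for x using that by (auto simp: \<phi>_def S1_def)
  have \<phi>sq: "(\<phi> x)\<^sup>2 * (\<epsilon> * G x $ None $ None) = 1" if "x \<in> S1" for x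
  proof -
    let ?y = "\<epsilon> * G x $ None $ None"
    have y: "0 < ?y" using that by (simp add: S1_def)
    have "(\<phi> x)\<^sup>2 = ?y powr (- 1)"
      using y unfolding \<phi>_def by (simp add: power2_eq_square powr_add[symmetric])
    also have "\<dots> = inverse ?y" using y by (simp only: powr_minus powr_one less_imp_le)
    finally have "(\<phi> x)\<^sup>2 * ?y = inverse ?y * ?y" by (rule arg_cong)
    also have "\<dots> = 1" by (rule left_inverse) (use y in auto)
    finally show ?thesis .
  qed
  define \<psi> where "\<psi> x = bderiv \<phi> x e\<^sub>0 / \<phi> x" for x
  have sm\<psi>1: "smooth_on S1 \<psi>"
    unfolding \<psi>_def by (intro smooth_on_divide t1 smooth_on_bderiv S1 sm\<phi>1) (use \<phi>pos in fastforce)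
  define V where "V = {x \<in> S1. 0 < 1 + x $ None * \<psi> x}"
  have V: "hopen V"
    unfolding V_def by (intro hopen_positive S1 continuous_intros smooth_on_continuous[OF sm\<psi>1])
  have V': "V \<subseteq> S1" "V \<subseteq> S" "p \<in> V" using p S1' by (auto simp: V_def)
  have oV: "openin (top_of_set S1) V" using V V' S1 openin_imp_subset by (metis openin_subset_trans)
  have t: "thick V" by (rule thick_hopen[OF V])
  have smG: "smooth_on V (\<lambda>x. G x $ a $ b)" for a b by (rule smooth_on_openin[OF oV G1])
  have sm\<phi>: "smooth_on V \<phi>" and sm\<psi>: "smooth_on V \<psi>"
    using smooth_on_openin[OF oV] sm\<phi>1 sm\<psi>1 by auto
  have smx: "smooth_on V (\<lambda>x. x $ None)" by (intro smooth_on_nth smooth_on_id t)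
  have \<phi>0: "\<phi> x \<noteq> 0" and q0: "1 + x $ None * \<psi> x \<noteq> 0" if "x \<in> V" for x
    using that \<phi>pos V'(1) by (fastforce simp: V_def)+
  define q where "q x = 1 + x $ None * \<psi> x" for x
  have smq: "smooth_on V q" unfolding q_def by (intro smooth_on_add smooth_on_mult smooth_on_const t smx sm\<psi>)
  have q: "q x \<noteq> 0" if "x \<in> V" for x using q0[OF that] by (simp add: q_def)
  define R where "R x = \<phi> x * x $ None" for x
  have smR: "smooth_on V R" unfolding R_def by (intro smooth_on_mult t smx sm\<phi>)
  have half: "x \<in> half_space" if "x \<in> V" for x using that openin_imp_subset[OF V] by blast
  have dR: "bderiv R x v = bderiv \<phi> x v * x $ None + \<phi> x * v $ None" if x: "x \<in> V" for x v
  proof -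
    have "(R has_derivative (\<lambda>v. \<phi> x * v $ None + bderiv \<phi> x v * x $ None)) (at x within half_space)"
      unfolding R_def
      by (rule has_derivative_mult[OF has_bderiv[OF V sm\<phi> x] bounded_linear_imp_has_derivative[OF bounded_linear_vec_nth]])
    from bderiv_eqI[OF half[OF x] this] show ?thesis by simp
  qed
  define C where "C x = \<epsilon> / (q x)\<^sup>2" for x
  define C1 where "C1 x = - \<epsilon> * (2 * \<psi> x + x $ None * (\<psi> x)\<^sup>2) / ((q x)\<^sup>2 * \<phi> x)" for x
  have smC: "smooth_on V C"
    unfolding C_def by (intro smooth_on_divide smooth_on_const smooth_on_power t smq) (simp add: q)
  have smC1: "smooth_on V C1"
    unfolding C1_def
    by (intro smooth_on_divide smooth_on_mult smooth_on_add smooth_on_const smooth_on_power t smq smx sm\<phi> sm\<psi>)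
      (simp add: q \<phi>0)
  have CC1: "C x = \<epsilon> + R x * C1 x" if x: "x \<in> V" for x
  proof -
    have "(q x)\<^sup>2 - x $ None * (2 * \<psi> x + x $ None * (\<psi> x)\<^sup>2) = 1"
      by (simp add: q_def power2_eq_square algebra_simps)
    then have "(\<epsilon> * (q x)\<^sup>2 - \<epsilon> * (x $ None * (2 * \<psi> x + x $ None * (\<psi> x)\<^sup>2))) / (q x)\<^sup>2 = C x"
      by (simp add: C_def right_diff_distrib[symmetric])
    then show ?thesis using q[OF x] \<phi>0[OF x]
      by (simp add: R_def C1_def diff_divide_distrib mult_ac)
  qed
  define d\<phi> where "d\<phi> i x = bderiv \<phi> x (ax (Some i))" for i x
  have smd: "smooth_on V (d\<phi> i)" for i unfolding d\<phi>_def by (rule smooth_on_bderiv[OF V sm\<phi>])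
  \<comment> \<open>Differentiate \<open>\<phi>\<^sup>2 \<epsilon> G\<^sub>0\<^sub>0 = 1\<close> along the boundary and insert \<open>\<partial>\<^sub>i G\<^sub>0\<^sub>0 = - 2 G\<^sub>0\<^sub>i\<close>.\<close>
  have d\<phi>: "d\<phi> i x * G x $ None $ None = \<phi> x * G x $ None $ Some i" if x: "x \<in> V" and x0: "x $ None = 0" for i x
  proof -
    let ?H = "\<lambda>x. G x $ None $ None"
    have "((\<lambda>x. (\<phi> x)\<^sup>2 * (\<epsilon> * ?H x)) has_derivative
        (\<lambda>v. (\<phi> x)\<^sup>2 * (\<epsilon> * bderiv ?H x v) + 2 * \<phi> x * bderiv \<phi> x v * (\<epsilon> * ?H x))) (at x within half_space)"
      using has_derivative_mult[OF has_derivative_power[OF has_bderiv[OF V sm\<phi> x], of 2]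
          has_derivative_mult_right[OF has_bderiv[OF V smG x], of \<epsilon>]]
      by (simp add: mult_ac)
    then have "bderiv (\<lambda>x. (\<phi> x)\<^sup>2 * (\<epsilon> * ?H x)) x
        = (\<lambda>v. (\<phi> x)\<^sup>2 * (\<epsilon> * bderiv ?H x v) + 2 * \<phi> x * bderiv \<phi> x v * (\<epsilon> * ?H x))"
      by (rule bderiv_eqI[OF half[OF x]])
    moreover have "bderiv (\<lambda>x. (\<phi> x)\<^sup>2 * (\<epsilon> * ?H x)) x = bderiv (\<lambda>x. 1) x"
      by (rule bderiv_cong[OF V x]) (use \<phi>sq V'(1) in blast)
    moreover have "bderiv (\<lambda>x :: 'n coords. 1::real) x = (\<lambda>v. 0)"
      by (rule bderiv_eqI[OF half[OF x] has_derivative_const])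
    ultimately have "(\<phi> x)\<^sup>2 * (\<epsilon> * bderiv ?H x v) + 2 * \<phi> x * bderiv \<phi> x v * (\<epsilon> * ?H x) = 0" for v
      by metis
    from this[of "ax (Some i)"] have "2 * \<epsilon> * \<phi> x * (d\<phi> i x * ?H x - \<phi> x * G x $ None $ Some i) = 0"
      using bderiv_G_boundary[of x i] x x0 V'(2)
      by (auto simp: d\<phi>_def power2_eq_square algebra_simps)
    then show ?thesis using \<epsilon>(1) \<phi>0[OF x] by auto
  qed
  \<comment> \<open>\<open>Q i\<close> is \<open>x\<^sub>0 h\<^sub>0\<^sub>i\<close>.\<close>
  define Q where "Q i x = (\<phi> x)\<^sup>2 * G x $ None $ Some i - \<epsilon> * d\<phi> i x / (q x * \<phi> x)" for i x
  have smQ: "smooth_on V (Q i)" for i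
    unfolding Q_def
    by (intro smooth_on_diff smooth_on_divide smooth_on_mult smooth_on_const smooth_on_power t smq sm\<phi> smG smd)
      (simp add: q \<phi>0)
  have \<phi>2: "(\<phi> x)\<^sup>2 = \<epsilon> / G x $ None $ None" and H0: "G x $ None $ None \<noteq> 0" if "x \<in> V" for x
  proof -
    show H: "G x $ None $ None \<noteq> 0" using \<phi>sq[of x] that V'(1) by auto
    have "\<epsilon> * \<epsilon> = 1" using \<epsilon>(1) by auto
    then have "(\<phi> x)\<^sup>2 * G x $ None $ None = \<epsilon> * ((\<phi> x)\<^sup>2 * (\<epsilon> * G x $ None $ None))" by (simp add: mult_ac)
    also have "\<dots> = \<epsilon>" using \<phi>sq[of x] that V'(1) by (metis mult_1_right subsetD)
    finally show "(\<phi> x)\<^sup>2 = \<epsilon> / G x $ None $ None" using H by (simp add: field_simps)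
  qed
  have d\<phi>': "d\<phi> i x = \<phi> x * (G x $ None $ Some i / G x $ None $ None)" if "x \<in> V" "x $ None = 0" for i x
    using d\<phi>[OF that, of i] H0[OF that(1)] by (simp add: field_simps)
  have Q0: "Q i x = 0" if "x \<in> V" "x $ None = 0" for i x
    using that \<phi>0[OF that(1)] by (simp add: Q_def q_def \<phi>2 d\<phi>')
  define k where "k a b x = (case a of
      None \<Rightarrow> (case b of None \<Rightarrow> 0 | Some j \<Rightarrow> normal_quotient (Q j) x)
    | Some i \<Rightarrow> (case b of None \<Rightarrow> normal_quotient (Q i) x
       | Some j \<Rightarrow> (\<phi> x)\<^sup>2 * G x $ Some i $ Some j - \<epsilon> * d\<phi> i x * d\<phi> j x / ((q x)\<^sup>2 * (\<phi> x)\<^sup>2)))"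
    for a b :: "'n option" and x
  have smk: "smooth_on V (k a b)" for a b
  proof -
    have 1: "smooth_on V (\<lambda>x. (\<phi> x)\<^sup>2 * G x $ Some i $ Some j - \<epsilon> * d\<phi> i x * d\<phi> j x / ((q x)\<^sup>2 * (\<phi> x)\<^sup>2))" for i j
    proof (rule smooth_on_diff[OF t])
      show "smooth_on V (\<lambda>x. (\<phi> x)\<^sup>2 * G x $ Some i $ Some j)"
        by (intro smooth_on_mult smooth_on_power t sm\<phi> smG)
      have "smooth_on V (\<lambda>x. \<epsilon> * d\<phi> i x * d\<phi> j x)" "smooth_on V (\<lambda>x. (q x)\<^sup>2 * (\<phi> x)\<^sup>2)"
        by (intro smooth_on_mult smooth_on_power smooth_on_const t smd smq sm\<phi>)+
      then show "smooth_on V (\<lambda>x. \<epsilon> * d\<phi> i x * d\<phi> j x / ((q x)\<^sup>2 * (\<phi> x)\<^sup>2))"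
        by (rule smooth_on_divide[OF t]) (simp add: q \<phi>0)
    qed
    have 2: "smooth_on V (normal_quotient (Q i))" for i
      by (rule smooth_on_normal_quotient[OF V smQ Q0])
    have "smooth_on V (\<lambda>x. k a b x)"
      unfolding k_def by (cases a; cases b) (simp_all add: smooth_on_const t 1 2)
    then show ?thesis .
  qed
  have ksym: "k a b x = k b a x" if "x \<in> V" for a b x
    using that V'(2) by (cases a; cases b) (auto simp: k_def G_sym[of x "Some i" "Some j" for i j] mult_ac)
  define h where "h x v w = (\<Sum>a\<in>UNIV. \<Sum>b\<in>UNIV. v $ a * w $ b * k a b x)" for x v w
  have hbil: "bilinear (h x)" for x
    unfolding bilinear_def h_def
    by (intro conjI allI linearI)
      (simp_all add: sum.distrib[symmetric] sum_distrib_left algebra_simps)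
  have hsym: "h x v w = h x w v" if "x \<in> V" for x v w
  proof -
    have "h x v w = (\<Sum>b\<in>UNIV. \<Sum>a\<in>UNIV. v $ a * w $ b * k a b x)" unfolding h_def by (rule sum.swap)
    then show ?thesis unfolding h_def using ksym[OF that] by (simp add: mult_ac)
  qed
  have hax: "h x (ax a) (ax b) = k a b x" for x a b
    by (simp add: h_def mult.assoc sum_distrib_left[symmetric] sum_ax)
  have smh: "smooth_on V (\<lambda>x. h x v w)" for v w
    unfolding h_def by (intro smooth_on_sum smooth_on_mult smooth_on_const t smk)
  have metric: "g x v w = C x / R x ^ 4 * (bderiv R x v * bderiv R x w) + h x v w / (R x)\<^sup>2"
    if x: "x \<in> pos V" for x v w
  proof -
    have xV: "x \<in> V" and r: "x $ None \<noteq> 0" using x by (auto simp: pos_def)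
    have xS: "x \<in> pos S" using x pos_mono[OF V'(2)] by blast
    note nz = r \<phi>0[OF xV] q[OF xV]
    have R0: "R x \<noteq> 0" using nz by (simp add: R_def)
    have dR0: "bderiv R x e\<^sub>0 = \<phi> x * q x"
      using nz by (simp add: dR[OF xV] q_def \<psi>_def axis_def algebra_simps)
    have dRi: "bderiv R x (ax (Some i)) = d\<phi> i x * x $ None" for i
      by (simp add: dR[OF xV] d\<phi>_def axis_def)
    have H: "G x $ None $ None = \<epsilon> / (\<phi> x)\<^sup>2"
      using \<phi>2[OF xV] H0[OF xV] nz \<epsilon>(1) by (auto simp: field_simps)
    have nq: "normal_quotient (Q i) x = Q i x / x $ None" for i using r by (simp add: normal_quotient_def)
    have 1: "g x (ax a) (ax b) = C x / R x ^ 4 * (bderiv R x (ax a) * bderiv R x (ax b)) + k a b x / (R x)\<^sup>2" for a b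
    proof -
      have *: "(x $ None)\<^sup>2 * (R x)\<^sup>2 * frame_factor a x * frame_factor b x * (C x / R x ^ 4 * (bderiv R x (ax a) * bderiv R x (ax b)) + k a b x / (R x)\<^sup>2)
          = (R x)\<^sup>2 * G x $ a $ b"
      proof (cases a)
        case None
        note a = this
        show ?thesis
        proof (cases b)
          case None
          show ?thesis
            using nz by (simp add: a None frame_factor_def k_def dR0 C_def R_def H field_simps power2_eq_square power4_eq_xxxx)
        next
          case (Some j)
          show ?thesis
            using nz by (simp add: a Some frame_factor_def k_def dR0 dRi C_def R_def nq Q_def field_simps power2_eq_square power4_eq_xxxx)
        qed
      next
        case (Some i)
        note a = this
        show ?thesis
        proof (cases b)
          case None
          have "G x $ Some i $ None = G x $ None $ Some i" using G_sym V'(2) xV by blast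
          then show ?thesis
            using nz by (simp add: a None frame_factor_def k_def dR0 dRi C_def R_def nq Q_def field_simps power2_eq_square power4_eq_xxxx)
        next
          case (Some j)
          show ?thesis
            using nz by (simp add: a Some frame_factor_def k_def dRi C_def R_def field_simps power2_eq_square power4_eq_xxxx)
        qed
      qed
      have f0: "frame_factor a x \<noteq> 0" "frame_factor b x \<noteq> 0" using r by (simp_all add: frame_factor_def)
      have "(x $ None)\<^sup>2 * (R x)\<^sup>2 * frame_factor a x * frame_factor b x * g x (ax a) (ax b) = (R x)\<^sup>2 * G x $ a $ b"
        unfolding g_eq_G[OF xS] using f0 r by (simp add: field_simps)
      then show ?thesis unfolding *[symmetric] using f0 r R0 by simp
    qed
    have linR: "linear (bderiv R x)" by (rule linear_bderiv[OF V smR xV])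
    have "g x v w = (\<Sum>a\<in>UNIV. \<Sum>b\<in>UNIV. v $ a * w $ b * g x (ax a) (ax b))"
      by (rule bilinear_ax_expansion[OF g_bilinear[OF xS]])
    also have "\<dots> = (\<Sum>a\<in>UNIV. \<Sum>b\<in>UNIV. (C x / R x ^ 4) * ((v $ a * bderiv R x (ax a)) * (w $ b * bderiv R x (ax b)))
        + v $ a * w $ b * k a b x / (R x)\<^sup>2)"
      unfolding 1 by (intro sum.cong refl) (simp add: algebra_simps)
    also have "\<dots> = (C x / R x ^ 4) * ((\<Sum>a\<in>UNIV. v $ a * bderiv R x (ax a)) * (\<Sum>b\<in>UNIV. w $ b * bderiv R x (ax b)))
        + h x v w / (R x)\<^sup>2"
      unfolding sum_product h_def sum.distrib by (simp add: sum_distrib_left sum_divide_distrib)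
    also have "(\<Sum>a\<in>UNIV. v $ a * bderiv R x (ax a)) = bderiv R x v"
      using linear_ax_expansion[OF linR, of v] by simp
    also have "(\<Sum>b\<in>UNIV. w $ b * bderiv R x (ax b)) = bderiv R x w"
      using linear_ax_expansion[OF linR, of w] by simp
    finally show ?thesis .
  qed
  have nondeg: "v = 0" if x: "x \<in> V" "x $ None = 0" and v: "v $ None = 0" "\<And>w. w $ None = 0 \<Longrightarrow> h x v w = 0" for x v
  proof -
    let ?H = "G x $ None $ None"
    \<comment> \<open>The correction of \<open>v\<close> that is orthogonal to \<open>E\<^sub>0\<close>. On tangential vectors \<open>h\<close> is \<open>\<phi>\<^sup>2\<close> times the Schur
      complement of \<open>G\<^sub>0\<^sub>0\<close>, so \<open>u\<close> is in the kernel of \<open>G\<close>.\<close>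
    define u :: "'n coords" where "u = (\<chi> a. if a = None then - (\<Sum>j\<in>UNIV. G x $ None $ Some j * v $ Some j) / ?H else v $ a)"
    have H: "?H \<noteq> 0" by (rule H0[OF x(1)])
    have kij: "k (Some j) (Some i) x = (\<phi> x)\<^sup>2 * (G x $ Some j $ Some i - G x $ None $ Some j * G x $ None $ Some i / ?H)" for i j
      using \<phi>0[OF x(1)] \<phi>2[OF x(1)] x H
      by (simp add: k_def d\<phi>' q_def field_simps power2_eq_square)
    have "(G x *v u) $ a = 0" for a
    proof (cases a)
      case None
      then show ?thesis using H by (simp add: matrix_vector_mult_def sum_option u_def)
    next
      case (Some i)
      have "h x v (ax (Some i)) = (\<Sum>a\<in>UNIV. v $ a * k a (Some i) x)"
        unfolding h_def by (simp add: mult.assoc sum_distrib_left[symmetric] sum_ax)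
      moreover have "h x v (ax (Some i)) = 0" by (rule v(2)) (simp add: axis_def)
      ultimately have "(\<phi> x)\<^sup>2 * (\<Sum>j\<in>UNIV. (G x $ Some j $ Some i - G x $ None $ Some j * G x $ None $ Some i / ?H) * v $ Some j) = 0"
        by (simp add: sum_option v(1) kij sum_distrib_left mult_ac)
      then have "(\<Sum>j\<in>UNIV. G x $ Some j $ Some i * v $ Some j)
          = (\<Sum>j\<in>UNIV. G x $ None $ Some j * G x $ None $ Some i / ?H * v $ Some j)"
        using \<phi>0[OF x(1)] by (simp add: left_diff_distrib sum_subtractf)
      also have "\<dots> = G x $ None $ Some i * (\<Sum>j\<in>UNIV. G x $ None $ Some j * v $ Some j) / ?H"
        by (simp add: sum_distrib_left sum_divide_distrib mult_ac)
      finally have "(\<Sum>j\<in>UNIV. G x $ Some i $ Some j * v $ Some j)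
          = G x $ Some i $ None * (\<Sum>j\<in>UNIV. G x $ None $ Some j * v $ Some j) / ?H"
        using G_sym[of x "Some i" "Some j" for j] G_sym[of x "Some i" None] x V'(2) by auto
      then show ?thesis by (simp add: Some matrix_vector_mult_def sum_option u_def)
    qed
    then have "G x *v u = 0" by (simp add: vec_eq_iff)
    moreover have "det (G x) \<noteq> 0" using det_G_nonzero x V'(2) by blast
    ultimately have "u = 0"
      using matrix_left_invertible_ker[of "G x"] invertible_det_nz[of "G x"] by (metis invertible_left_inverse)
    then have "u $ a = 0" for a by simp
    moreover have "v $ a = (if a = None then 0 else u $ a)" for a using v(1) by (simp add: u_def)
    ultimately have "v $ a = 0" for a by simp
    then show "v = 0" by (simp add: vec_eq_iff)
  qed
  have R0: "R x = 0 \<longleftrightarrow> x $ None = 0" if "x \<in> V" for x using \<phi>0[OF that] by (simp add: R_def)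
  have dR0: "bderiv R x e\<^sub>0 \<noteq> 0" if "x \<in> V" "x $ None = 0" for x
    using dR[OF that(1), of e\<^sub>0] \<phi>0[OF that(1)] that(2) by (simp add: axis_def)
  show ?thesis
    by (intro exI[of _ V] exI[of _ R] exI[of _ C] exI[of _ C1] exI[of _ h] conjI ballI allI impI
        V V'(2) V'(3) smR smC smC1 R0 dR0 CC1 hbil hsym smh metric; (assumption | (rule nondeg; blast)))
qed

end

section \<open>Charts of a manifold with boundary\<close>

locale smooth_manifold =
  fixes X :: "'a topology" and A :: "('a, 'n::finite) chart set"
  assumes manifold: "manifold_with_boundary X A"
begin

lemma chart_homeomorphic:
    "c \<in> A \<Longrightarrow> homeomorphic_map (subtopology X (fst c)) (top_of_set (snd c ` fst c)) (snd c)"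
  and openin_chart: "c \<in> A \<Longrightarrow> openin X (fst c)"
  and hopen_chart: "c \<in> A \<Longrightarrow> hopen (snd c ` fst c)"
  and smooth_transition_chart: "c \<in> A \<Longrightarrow> c' \<in> A \<Longrightarrow> smooth_on (coord c (fst c')) (transition c c')"
  and topspace_eq: "topspace X = \<Union> (fst ` A)"
  and Hausdorff: "Hausdorff_space X"
  using manifold unfolding manifold_with_boundary_def by auto

lemma chart_subset: "c \<in> A \<Longrightarrow> fst c \<subseteq> topspace X"
  using openin_chart openin_subset by blast

lemma inj_chart: "c \<in> A \<Longrightarrow> inj_on (snd c) (fst c)"
  using homeomorphic_imp_injective_map[OF chart_homeomorphic] chart_subset
  by (simp add: Int_absorb1)

lemma coord_inv_chart: "c \<in> A \<Longrightarrow> p \<in> fst c \<Longrightarrow> coord_inv c (snd c p) = p"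
  unfolding coord_inv_def using inj_chart by simp

lemma coordD:
  assumes "c \<in> A" "x \<in> coord c U"
  shows "coord_inv c x \<in> U" "coord_inv c x \<in> fst c" "snd c (coord_inv c x) = x"
  using assms(2) coord_inv_chart[OF assms(1)] unfolding coord_def by auto

lemma coordI: "p \<in> U \<Longrightarrow> p \<in> fst c \<Longrightarrow> snd c p \<in> coord c U"
  unfolding coord_def by blast

lemma coord_mono: "U \<subseteq> V \<Longrightarrow> coord c U \<subseteq> coord c V"
  unfolding coord_def by blast

lemma coord_chart: "coord c (fst c) = snd c ` fst c"
  unfolding coord_def by simp

lemma hopen_coord:
  assumes "c \<in> A" "openin X U"
  shows "hopen (coord c U)"
proof -
  have "openin (subtopology X (fst c)) (U \<inter> fst c)"
    using assms(2) by (auto simp: openin_subtopology)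
  then have "openin (top_of_set (snd c ` fst c)) (snd c ` (U \<inter> fst c))"
    using homeomorphic_imp_open_map[OF chart_homeomorphic[OF assms(1)]] unfolding open_map_def by blast
  then show ?thesis unfolding coord_def using hopen_chart[OF assms(1)] openin_trans by blast
qed

lemma openin_coord_inverse:
  assumes "c \<in> A" "hopen V"
  shows "openin X {p \<in> fst c. snd c p \<in> V}"
proof -
  have cont: "continuous_map (subtopology X (fst c)) (top_of_set (snd c ` fst c)) (snd c)"
    using homeomorphic_imp_continuous_map[OF chart_homeomorphic[OF assms(1)]] .
  have "openin (top_of_set (snd c ` fst c)) (snd c ` fst c \<inter> V)"
    using assms(2) openin_imp_subset[OF hopen_chart[OF assms(1)]]
    by (auto simp: openin_open)
  from openin_continuous_map_preimage[OF cont this]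
  have "openin (subtopology X (fst c)) {p \<in> fst c. snd c p \<in> V}"
    using chart_subset[OF assms(1)] by (auto simp: Int_absorb1 elim!: back_subst[of "openin _"])
  then show ?thesis using openin_chart[OF assms(1)] openin_trans_full by blast
qed

lemma openin_Int_chart: "c \<in> A \<Longrightarrow> openin X U \<Longrightarrow> openin X (U \<inter> fst c)"
  using openin_chart by blast

lemma coord_subset_chart: "coord c U \<subseteq> coord c (fst c)"
  unfolding coord_def by blast

subsection \<open>Transition maps\<close>

lemma transitionD:
  assumes "c \<in> A" "c' \<in> A" "x \<in> coord c (U \<inter> fst c')"
  shows "transition c c' x \<in> coord c' (U \<inter> fst c)"
    and "coord_inv c' (transition c c' x) = coord_inv c x"
    and "transition c' c (transition c c' x) = x"
  using coordD[OF assms(1,3)] coord_inv_chart[OF assms(2)] coordI[of "coord_inv c x" "U \<inter> fst c" c']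
  unfolding transition_def by auto

lemma transition_compose:
  assumes "c \<in> A" "c' \<in> A" "x \<in> coord c (fst c')"
  shows "transition c' c'' (transition c c' x) = transition c c'' x"
  using transitionD(2)[OF assms(1,2), of x "fst c'"] assms(3) by (simp add: transition_def)

lemma smooth_transition:
  assumes "c \<in> A" "c' \<in> A" "openin X U" "U \<subseteq> fst c'"
  shows "smooth_on (coord c U) (transition c c')"
  by (rule smooth_on_hopen_subset[OF hopen_coord[OF assms(1) openin_chart[OF assms(2)]]
      hopen_coord[OF assms(1,3)] coord_mono[OF assms(4)] smooth_transition_chart[OF assms(1,2)]])

lemma transition_derivative:
  assumes "c \<in> A" "c' \<in> A" "x \<in> coord c (fst c')"
  shows "(transition c c' has_derivative bderiv (transition c c') x) (at x within half_space)"
  by (rule has_bderiv[OF hopen_coord[OF assms(1) openin_chart[OF assms(2)]]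
      smooth_transition_chart[OF assms(1,2)] assms(3)])

lemma linear_transition_derivative:
  "c \<in> A \<Longrightarrow> c' \<in> A \<Longrightarrow> x \<in> coord c (fst c') \<Longrightarrow> linear (bderiv (transition c c') x)"
  using transition_derivative has_derivative_linear by blast

text \<open>The chain rule for a function of the coordinates of \<open>c'\<close> which is pulled back to \<open>c\<close>.\<close>

lemma bderiv_transition:
  assumes c: "c \<in> A" "c' \<in> A" and U: "openin X U" and x: "x \<in> coord c (U \<inter> fst c')"
    and f: "(f has_derivative D) (at (transition c c' x) within half_space)"
    and h: "\<And>y. y \<in> coord c (U \<inter> fst c') \<Longrightarrow> h y = f (transition c c' y)"
  shows "bderiv h x v = D (bderiv (transition c c') x v)"
proof -
  let ?V = "coord c (U \<inter> fst c')"
  have V: "hopen ?V" by (rule hopen_coord[OF c(1) openin_Int_chart[OF c(2) U]])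
  have xc: "x \<in> coord c (fst c')" using x by (auto simp: coord_def)
  have half: "x \<in> half_space" using x openin_imp_subset[OF V] by blast
  have sub: "transition c c' ` ?V \<subseteq> half_space"
    using transitionD(1)[OF c] openin_imp_subset[OF hopen_coord[OF c(2) openin_Int_chart[OF c(1) U]]] by blast
  have "(transition c c' has_derivative bderiv (transition c c') x) (at x within ?V)"
    using transition_derivative[OF c xc] at_within_hopen[OF V x] by simp
  from has_derivative_in_compose[OF this has_derivative_subset[OF f sub]]
  have "((\<lambda>y. f (transition c c' y)) has_derivative (\<lambda>v. D (bderiv (transition c c') x v))) (at x within ?V)" .
  then have "(h has_derivative (\<lambda>v. D (bderiv (transition c c') x v))) (at x within ?V)"
    by (rule has_derivative_transform[OF x, rotated]) (rule h)
  then show ?thesis using bderiv_eqI[OF half] at_within_hopen[OF V x] by metis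
qed

lemma transition_derivative_compose:
  assumes c: "c \<in> A" "c' \<in> A" "c'' \<in> A" and x: "x \<in> coord c (fst c' \<inter> fst c'')"
  shows "bderiv (transition c' c'') (transition c c' x) (bderiv (transition c c') x v) = bderiv (transition c c'') x v"
proof (rule bderiv_transition[OF c(1,2) openin_chart[OF c(3)], symmetric])
  show "x \<in> coord c (fst c'' \<inter> fst c')" using x by (simp add: Int_commute)
  from transitionD(1)[OF c(1,2) this] have "transition c c' x \<in> coord c' (fst c'')"
    by (auto simp: coord_def)
  then show "(transition c' c'' has_derivative bderiv (transition c' c'') (transition c c' x)) (at (transition c c' x) within half_space)"
    by (rule transition_derivative[OF c(2,3)])
  show "transition c c'' y = transition c' c'' (transition c c' y)" if "y \<in> coord c (fst c'' \<inter> fst c')" for y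
    by (rule transition_compose[OF c(1,2), symmetric]) (use that in \<open>auto simp: coord_def\<close>)
qed

lemma transition_self: "c \<in> A \<Longrightarrow> x \<in> coord c U \<Longrightarrow> transition c c x = x"
  unfolding transition_def using coordD by simp

lemma transition_self_derivative:
  assumes "c \<in> A" "x \<in> coord c U"
  shows "bderiv (transition c c) x v = v"
proof -
  have S: "hopen (coord c (fst c))" by (rule hopen_coord[OF assms(1) openin_chart[OF assms(1)]])
  have x: "x \<in> coord c (fst c)" using assms(2) coord_subset_chart by blast
  have "bderiv (transition c c) x = bderiv (\<lambda>y. y) x"
    by (rule bderiv_cong[OF S x]) (rule transition_self[OF assms(1)])
  moreover have "bderiv (\<lambda>y :: 'n coords. y) x = (\<lambda>v. v)"
    by (rule bderiv_eqI) (use x openin_imp_subset[OF S] in auto)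
  ultimately show ?thesis by simp
qed

lemma transition_derivative_inverse:
  assumes c: "c \<in> A" "c' \<in> A" and x: "x \<in> coord c (fst c')"
  shows "bderiv (transition c' c) (transition c c' x) (bderiv (transition c c') x v) = v"
proof -
  have x': "x \<in> coord c (fst c' \<inter> fst c)" using x unfolding coord_def by auto
  show ?thesis
    using transition_derivative_compose[OF c c(1) x'] transition_self_derivative[OF c(1) x] by simp
qed

subsection \<open>The boundary\<close>

text \<open>Invariance of domain: the image of the interior is open in the whole space and contained in the
  half-space, so it does not meet the boundary hyperplane.\<close>

lemma transition_pos:
  assumes c: "c \<in> A" "c' \<in> A" and x: "x \<in> coord c (fst c')" "0 < x $ None"
  shows "0 < transition c c' x $ None"
proof -
  let ?W = "pos (coord c (fst c'))"
  have S: "hopen (coord c (fst c'))" by (rule hopen_coord[OF c(1) openin_chart[OF c(2)]])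
  have "inj_on (transition c c') ?W"
  proof (rule inj_on_inverseI[where g = "transition c' c"])
    show "transition c' c (transition c c' y) = y" if "y \<in> ?W" for y
      using transitionD(3)[OF c, of y "fst c'"] that pos_subset by auto
  qed
  moreover have "continuous_on ?W (transition c c')"
    using smooth_on_continuous[OF smooth_transition_chart[OF c]] pos_subset continuous_on_subset by blast
  ultimately have "open (transition c c' ` ?W)"
    using invariance_of_domain open_pos[OF S] by blast
  moreover have xW: "x \<in> ?W" using x by (simp add: pos_def)
  ultimately obtain r where r: "0 < r" "ball (transition c c' x) r \<subseteq> transition c c' ` ?W"
    by (meson imageI open_contains_ball)
  have half: "transition c c' ` ?W \<subseteq> half_space"
    using transitionD(1)[OF c, of _ "fst c'"] openin_imp_subset[OF hopen_coord[OF c(2) openin_Int_chart[OF c(1) openin_chart[OF c(2)]]]]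
      pos_subset by fastforce
  have "transition c c' x - (r / 2) *\<^sub>R e\<^sub>0 \<in> ball (transition c c' x) r"
    using r by (simp add: dist_norm)
  then have "transition c c' x - (r / 2) *\<^sub>R e\<^sub>0 \<in> half_space" using r half by blast
  then show ?thesis using r(1) by (simp add: half_space_def axis_def)
qed

lemma bdry_iff:
  assumes "c \<in> A" "p \<in> fst c"
  shows "p \<in> bdry A \<longleftrightarrow> snd c p $ None = 0"
proof
  assume "p \<in> bdry A"
  then obtain c' where c': "c' \<in> A" "p \<in> fst c'" "snd c' p $ None = 0" unfolding bdry_def by blast
  have x: "snd c p \<in> coord c (fst c')" by (rule coordI[OF c'(2) assms(2)])
  have "transition c c' (snd c p) = snd c' p" by (simp add: transition_def coord_inv_chart assms)
  then have "\<not> 0 < snd c p $ None" using transition_pos[OF assms(1) c'(1) x] c'(3) by auto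
  then show "snd c p $ None = 0"
    using hopenD[OF hopen_chart[OF assms(1)]] assms(2) by fastforce
next
  assume "snd c p $ None = 0"
  then show "p \<in> bdry A" unfolding bdry_def using assms by blast
qed

lemma coord_bdry_iff:
  assumes "c \<in> A"
  shows "x \<in> coord c (U \<inter> bdry A) \<longleftrightarrow> x \<in> coord c U \<and> x $ None = 0"
  unfolding coord_def using bdry_iff[OF assms] by auto

lemma coord_mint:
  assumes "c \<in> A" "openin X U"
  shows "coord c (U \<inter> mint X A) = pos (coord c U)"
proof -
  have "p \<in> mint X A \<longleftrightarrow> 0 < snd c p $ None" if "p \<in> fst c" for p
    using bdry_iff[OF assms(1) that] chart_subset[OF assms(1)] that
      hopenD[OF hopen_chart[OF assms(1)], of "snd c p"] unfolding mint_def by fastforce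
  then show ?thesis unfolding coord_def pos_def by auto
qed

lemma coord_mint_chart: "c \<in> A \<Longrightarrow> coord c (mint X A) = pos (snd c ` fst c)"
  using coord_mint[OF _ openin_chart, of c c] unfolding coord_def by (simp add: Int_ac)

lemma coord_topspace: "c \<in> A \<Longrightarrow> coord c (topspace X) = snd c ` fst c"
  unfolding coord_def using chart_subset by (simp add: Int_absorb1)

lemma openin_mint: "openin X (mint X A)"
proof -
  have "mint X A = (\<Union>c\<in>A. {p \<in> fst c. snd c p \<in> pos half_space})"
  proof (intro set_eqI iffI)
    fix p assume "p \<in> mint X A"
    then obtain c where c: "c \<in> A" "p \<in> fst c" "p \<notin> bdry A" unfolding mint_def topspace_eq by auto
    then have "snd c p \<in> half_space" "snd c p $ None \<noteq> 0"
      using openin_imp_subset[OF hopen_chart[OF c(1)]] bdry_iff[OF c(1,2)] by auto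
    then show "p \<in> (\<Union>c\<in>A. {p \<in> fst c. snd c p \<in> pos half_space})"
      using c by (auto simp: pos_def half_space_def)
  next
    fix p assume "p \<in> (\<Union>c\<in>A. {p \<in> fst c. snd c p \<in> pos half_space})"
    then obtain c where c: "c \<in> A" "p \<in> fst c" "0 < snd c p $ None" by (auto simp: pos_def)
    then show "p \<in> mint X A"
      using bdry_iff[OF c(1,2)] chart_subset[OF c(1)] by (auto simp: mint_def)
  qed
  then show ?thesis
    using openin_coord_inverse[OF _ hopen_pos[OF hopen_half_space]] by auto
qed

lemma transition_boundary:
  assumes c: "c \<in> A" "c' \<in> A" and x: "x \<in> coord c (fst c')"
  shows "transition c c' x $ None = 0 \<longleftrightarrow> x $ None = 0"
  using bdry_iff[OF c(1), of "coord_inv c x"] bdry_iff[OF c(2), of "coord_inv c x"] coordD[OF c(1) x]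
  by (simp add: transition_def)

text \<open>In the product of \<open>x\<^sub>0\<close> and \<open>normal_quotient f\<close> the derivative of the second factor does not contribute
  where \<open>x\<^sub>0 = 0\<close>.\<close>

lemma vanishing_on_boundary_derivative:
  fixes f :: "'n coords \<Rightarrow> real"
  assumes S: "hopen S" and f: "smooth_on S f" and z: "\<And>y. y \<in> S \<Longrightarrow> y $ None = 0 \<Longrightarrow> f y = 0"
    and x: "x \<in> S" "x $ None = 0"
  shows "bderiv f x v = v $ None * normal_quotient f x"
proof -
  have "((\<lambda>y. y $ None * normal_quotient f y) has_derivative
      (\<lambda>v. x $ None * bderiv (normal_quotient f) x v + v $ None * normal_quotient f x)) (at x within half_space)"
    by (rule has_derivative_mult[OF bounded_linear_imp_has_derivative[OF bounded_linear_vec_nth]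
        has_bderiv[OF S smooth_on_normal_quotient[OF S f z] x(1)]])
  then have "bderiv (\<lambda>y. y $ None * normal_quotient f y) x v = v $ None * normal_quotient f x"
    using bderiv_eqI x openin_imp_subset[OF S] by fastforce
  then show ?thesis
    using bderiv_cong[OF S x(1), of f "\<lambda>y. y $ None * normal_quotient f y"] normal_quotient_mult[OF S f z] by simp
qed

lemma transition_derivative_tangent:
  assumes c: "c \<in> A" "c' \<in> A" and x: "x \<in> coord c (fst c')" "x $ None = 0" and v: "v $ None = 0"
  shows "bderiv (transition c c') x v $ None = 0"
proof -
  have S: "hopen (coord c (fst c'))" by (rule hopen_coord[OF c(1) openin_chart[OF c(2)]])
  have half: "x \<in> half_space" using x openin_imp_subset[OF S] by blast
  have "bderiv (\<lambda>y. transition c c' y $ None) x v = bderiv (transition c c') x v $ None"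
    using bderiv_eqI[OF half bounded_linear.has_derivative[OF bounded_linear_vec_nth transition_derivative[OF c x(1)]]] by metis
  moreover have "bderiv (\<lambda>y. transition c c' y $ None) x v = v $ None * normal_quotient (\<lambda>y. transition c c' y $ None) x"
    by (rule vanishing_on_boundary_derivative[OF S _ _ x])
      (use smooth_on_nth[OF thick_hopen[OF S] smooth_transition_chart[OF c]] transition_boundary[OF c] in auto)
  ultimately show ?thesis using v by simp
qed

subsection \<open>Objects given in one chart\<close>

lemma smooth_transition_Int:
  assumes "c \<in> A" "c0 \<in> A" "openin X U"
  shows "smooth_on (coord c (U \<inter> fst c0)) (transition c c0)"
  by (rule smooth_transition[OF assms(1,2) openin_Int_chart[OF assms(2,3)]]) simp

lemma smooth_fun_chart:
  assumes c0: "c0 \<in> A" and U: "openin X U" "U \<subseteq> fst c0" and f: "smooth_on (coord c0 U) f"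
  shows "smooth_fun A U (\<lambda>p. f (snd c0 p))"
  unfolding smooth_fun_def
proof
  fix c assume c: "c \<in> A"
  have "smooth_on (coord c U) (\<lambda>x. f (transition c c0 x))"
  proof (rule smooth_on_compose[OF thick_hopen[OF hopen_coord[OF c U(1)]] smooth_transition[OF c c0 U] _ f])
    show "transition c c0 ` coord c U \<subseteq> coord c0 U"
      using transitionD(1)[OF c c0, of _ U] U(2) coord_mono[of "U \<inter> fst c" U c0] by (auto simp: Int_absorb2)
  qed
  then show "smooth_on (coord c U) ((\<lambda>p. f (snd c0 p)) \<circ> coord_inv c)"
    by (simp add: transition_def o_def)
qed

text \<open>The vector field and the bilinear form that have a prescribed representative in the chart \<open>c0\<close>.\<close>

definition chart_field :: "('a, 'n) chart \<Rightarrow> ('n coords \<Rightarrow> 'n coords) \<Rightarrow> ('a, 'n) vfield" where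
  "chart_field c0 v = (\<lambda>c x. bderiv (transition c0 c) (transition c c0 x) (v (transition c c0 x)))"

lemma chart_field_self: "c0 \<in> A \<Longrightarrow> x \<in> coord c0 U \<Longrightarrow> chart_field c0 v c0 x = v x"
  by (simp add: chart_field_def transition_self transition_self_derivative)

lemma smooth_chart_field:
  assumes c0: "c0 \<in> A" and c: "c \<in> A" and U: "openin X U" "U \<subseteq> fst c0" and v: "smooth_on (coord c0 U) v"
  shows "smooth_on (coord c U) (chart_field c0 v c)"
proof -
  have Uc: "openin X (U \<inter> fst c)" by (rule openin_Int_chart[OF c U(1)])
  let ?V = "coord c0 (U \<inter> fst c)"
  have V: "hopen ?V" by (rule hopen_coord[OF c0 Uc])
  have t: "thick ?V" by (rule thick_hopen[OF V])
  have sv: "smooth_on ?V v"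
    by (rule smooth_on_hopen_subset[OF hopen_coord[OF c0 U(1)] V coord_mono v]) blast
  have st: "smooth_on ?V (transition c0 c)" by (rule smooth_transition_Int[OF c0 c U(1)])
  have "smooth_on ?V (\<lambda>y. \<Sum>a\<in>UNIV. v y $ a *\<^sub>R bderiv (transition c0 c) y (ax a))"
    by (intro smooth_on_sum smooth_on_scaleR smooth_on_nth t sv smooth_on_bderiv V st)
  then have 1: "smooth_on ?V (\<lambda>y. bderiv (transition c0 c) y (v y))"
  proof (rule smooth_on_eq)
    fix y assume "y \<in> ?V"
    then show "(\<Sum>a\<in>UNIV. v y $ a *\<^sub>R bderiv (transition c0 c) y (ax a)) = bderiv (transition c0 c) y (v y)"
      using linear_ax_expansion[OF linear_bderiv[OF V st], of y "v y"] by simp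
  qed
  show ?thesis unfolding chart_field_def
  proof (rule smooth_on_compose[OF thick_hopen[OF hopen_coord[OF c U(1)]] smooth_transition[OF c c0 U] _ 1])
    show "transition c c0 ` coord c U \<subseteq> ?V"
      using transitionD(1)[OF c c0, of _ U] U(2) by (auto simp: Int_absorb2)
  qed
qed

lemma chart_field_law:
  assumes c0: "c0 \<in> A" and c: "c \<in> A" "c' \<in> A" and x: "x \<in> coord c (fst c0 \<inter> fst c')"
  shows "chart_field c0 v c' (transition c c' x) = bderiv (transition c c') x (chart_field c0 v c x)"
proof -
  have x': "x \<in> coord c (fst c')" "x \<in> coord c (fst c0)" "x \<in> coord c (fst c' \<inter> fst c0)"
    using x coord_mono[of "fst c0 \<inter> fst c'"] by (auto simp: coord_def)
  have y: "transition c c0 x \<in> coord c0 (fst c \<inter> fst c')"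
    using transitionD(1)[OF c(1) c0 x'(3)] by (simp add: coord_def Int_ac)
  have "transition c' c0 (transition c c' x) = transition c c0 x"
    by (rule transition_compose[OF c x'(1)])
  moreover have "transition c0 c (transition c c0 x) = x"
    using transitionD(3)[OF c(1) c0, of x "fst c0"] x'(2) by simp
  ultimately show ?thesis
    unfolding chart_field_def using transition_derivative_compose[OF c0 c y] by simp
qed

lemma vector_field_chart_field:
  assumes c0: "c0 \<in> A" and U: "openin X U" "U \<subseteq> fst c0" and v: "smooth_on (coord c0 U) v"
  shows "vector_field A U (chart_field c0 v)"
  unfolding vector_field_def
proof (intro conjI ballI)
  show "smooth_on (coord c U) (chart_field c0 v c)" if "c \<in> A" for c
    by (rule smooth_chart_field[OF c0 that U v])
  show "chart_field c0 v c' (transition c c' x) = bderiv (transition c c') x (chart_field c0 v c x)"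
    if "c \<in> A" "c' \<in> A" "x \<in> coord c (U \<inter> fst c')" for c c' x
    by (rule chart_field_law[OF c0 that(1,2)]) (use that(3) U(2) in \<open>auto simp: coord_def\<close>)
qed

lemma chart_field_tangent:
  assumes c0: "c0 \<in> A" "c \<in> A" and x: "x \<in> coord c (fst c0)" "x $ None = 0"
    and v: "v (transition c c0 x) $ None = 0"
  shows "chart_field c0 v c x $ None = 0"
proof -
  have "transition c c0 x \<in> coord c0 (fst c)"
    using transitionD(1)[OF c0(2,1), of x "fst c0"] x by (auto simp: coord_def)
  then show ?thesis
    unfolding chart_field_def
    by (rule transition_derivative_tangent[OF c0 _ _ v]) (simp add: transition_boundary[OF c0(2,1) x(1)] x)
qed

definition chart_form :: "('a, 'n) chart \<Rightarrow> ('n coords \<Rightarrow> 'n coords \<Rightarrow> 'n coords \<Rightarrow> real) \<Rightarrow> ('a, 'n) bform" where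
  "chart_form c0 h = (\<lambda>c x v w.
     h (transition c c0 x) (bderiv (transition c c0) x v) (bderiv (transition c c0) x w))"

lemma sym_form_field_chart_form:
  assumes c0: "c0 \<in> A" and U: "openin X U" "U \<subseteq> fst c0"
    and h: "\<And>x. x \<in> coord c0 U \<Longrightarrow> bilinear (h x)" "\<And>x v w. x \<in> coord c0 U \<Longrightarrow> h x v w = h x w v"
      "\<And>v w. smooth_on (coord c0 U) (\<lambda>x. h x v w)"
  shows "sym_form_field A U (chart_form c0 h)"
proof -
  have T: "transition c c0 x \<in> coord c0 U" "x \<in> coord c (fst c0)" if "c \<in> A" "x \<in> coord c U" for c x
    using transitionD(1)[OF that(1) c0, of x U] that U(2) coord_mono[of "U \<inter> fst c" U c0] coord_mono[OF U(2), of c]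
    by (auto simp: Int_absorb2)
  have bil: "bilinear (chart_form c0 h c x)" and sym: "chart_form c0 h c x v w = chart_form c0 h c x w v"
    if "c \<in> A" "x \<in> coord c U" for c x v w
  proof -
    note b = h(1)[OF T(1)[OF that]]
    note l = linear_transition_derivative[OF that(1) c0 T(2)[OF that]]
    show "bilinear (chart_form c0 h c x)"
      unfolding bilinear_def chart_form_def
      by (intro conjI allI linearI) (simp_all add: linear_add[OF l] linear_scale[OF l]
          bilinear_ladd[OF b] bilinear_radd[OF b] bilinear_lmul[OF b] bilinear_rmul[OF b])
    show "chart_form c0 h c x v w = chart_form c0 h c x w v"
      unfolding chart_form_def by (rule h(2)[OF T(1)[OF that]])
  qed
  have sm: "smooth_on (coord c U) (\<lambda>x. chart_form c0 h c x v w)" if c: "c \<in> A" for c v w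
  proof -
    have V: "hopen (coord c U)" by (rule hopen_coord[OF c U(1)])
    have t: "thick (coord c U)" by (rule thick_hopen[OF V])
    have st: "smooth_on (coord c U) (transition c c0)" by (rule smooth_transition[OF c c0 U])
    have sh: "smooth_on (coord c U) (\<lambda>x. h (transition c c0 x) (ax a) (ax b))" for a b
      by (rule smooth_on_compose[OF t st _ h(3)]) (use T(1)[OF c] in auto)
    have "smooth_on (coord c U) (\<lambda>x. \<Sum>a\<in>UNIV. \<Sum>b\<in>UNIV. bderiv (transition c c0) x v $ a
        * bderiv (transition c c0) x w $ b * h (transition c c0 x) (ax a) (ax b))"
      by (intro smooth_on_sum smooth_on_mult smooth_on_nth t smooth_on_bderiv V st sh)
    then show ?thesis
    proof (rule smooth_on_eq)
      fix x assume x: "x \<in> coord c U"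
      show "(\<Sum>a\<in>UNIV. \<Sum>b\<in>UNIV. bderiv (transition c c0) x v $ a
          * bderiv (transition c c0) x w $ b * h (transition c c0 x) (ax a) (ax b)) = chart_form c0 h c x v w"
        unfolding chart_form_def by (rule bilinear_ax_expansion[OF h(1)[OF T(1)[OF c x]], symmetric])
    qed
  qed
  have law: "chart_form c0 h c x v w = chart_form c0 h c' (transition c c' x)
      (bderiv (transition c c') x v) (bderiv (transition c c') x w)"
    if "c \<in> A" "c' \<in> A" "x \<in> coord c (U \<inter> fst c')" for c c' x v w
  proof -
    have x: "x \<in> coord c (fst c')" "x \<in> coord c (fst c' \<inter> fst c0)"
      using that(3) U(2) by (auto simp: coord_def)
    show ?thesis
      unfolding chart_form_def
      by (simp add: transition_compose[OF that(1,2) x(1)] transition_derivative_compose[OF that(1,2) c0 x(2)])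
  qed
  show ?thesis unfolding sym_form_field_def using bil sym sm law by simp
qed

lemma differential_chart:
  assumes c0: "c0 \<in> A" and c: "c \<in> A" and U: "openin X U" "U \<subseteq> fst c0" and f: "smooth_on (coord c0 U) f"
    and x: "x \<in> coord c U"
  shows "differential (\<lambda>p. f (snd c0 p)) c x v = bderiv f (transition c c0 x) (bderiv (transition c c0) x v)"
  unfolding differential_def
proof (rule bderiv_transition[OF c c0 U(1)])
  show x': "x \<in> coord c (U \<inter> fst c0)" using x U(2) by (simp add: Int_absorb2)
  have "transition c c0 x \<in> coord c0 U"
    using transitionD(1)[OF c c0 x'] by (auto simp: coord_def)
  then show "(f has_derivative bderiv f (transition c c0 x)) (at (transition c c0 x) within half_space)"
    by (rule has_bderiv[OF hopen_coord[OF c0 U(1)] f])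
qed (simp add: transition_def)

text \<open>The derivative of the transition map from \<open>c0\<close> carries \<open>e\<^sub>0\<close> to a vector in the other chart on which the
  differential does not vanish.\<close>

lemma local_defining_chart:
  assumes c0: "c0 \<in> A" and U: "openin X U" "U \<subseteq> fst c0" and f: "smooth_on (coord c0 U) f"
    and z: "\<And>x. x \<in> coord c0 U \<Longrightarrow> f x = 0 \<longleftrightarrow> x $ None = 0"
    and d: "\<And>x. x \<in> coord c0 U \<Longrightarrow> x $ None = 0 \<Longrightarrow> bderiv f x e\<^sub>0 \<noteq> 0"
  shows "local_defining X A U (\<lambda>p. f (snd c0 p))"
  unfolding local_defining_def
proof (intro conjI ballI)
  show "smooth_fun A U (\<lambda>p. f (snd c0 p))" by (rule smooth_fun_chart[OF c0 U f])
  show "f (snd c0 p) = 0 \<longleftrightarrow> p \<in> bdry A" if "p \<in> U" for p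
    using z[of "snd c0 p"] bdry_iff[OF c0, of p] U(2) that coordI[of p U c0] by blast
next
  fix c x assume c: "c \<in> A" and x: "x \<in> coord c (U \<inter> bdry A)"
  then have x': "x \<in> coord c U" "x $ None = 0" "x \<in> coord c (fst c0)" "x \<in> coord c (U \<inter> fst c0)"
    using coord_bdry_iff[OF c] coord_mono[OF U(2), of c] U(2) by (auto simp: Int_absorb2)
  let ?y = "transition c c0 x"
  have y: "?y \<in> coord c0 (U \<inter> fst c)" by (rule transitionD(1)[OF c c0 x'(4)])
  have y': "?y \<in> coord c0 U" "?y \<in> coord c0 (fst c)" "transition c0 c ?y = x"
    using y transitionD(3)[OF c c0 x'(4)] by (auto simp: coord_def)
  have "differential (\<lambda>p. f (snd c0 p)) c x (bderiv (transition c0 c) ?y e\<^sub>0) = bderiv f ?y e\<^sub>0"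
    using differential_chart[OF c0 c U f x'(1)] transition_derivative_inverse[OF c0 c y'(2), of e\<^sub>0] y'(3) by simp
  then show "\<exists>v. differential (\<lambda>p. f (snd c0 p)) c x v \<noteq> 0"
    using d[OF y'(1)] transition_boundary[OF c c0 x'(3)] x'(2) by metis
qed (rule U(1))

end

section \<open>Global extension of local vector fields\<close>

text \<open>The functions \<open>t\<^sup>-\<^sup>k exp (-1/t)\<close>, extended by zero, form a family that is closed under
  differentiation, up to linear combinations.\<close>

definition flat_fun :: "nat \<Rightarrow> real \<Rightarrow> real" where
  "flat_fun k t = (if 0 < t then inverse t ^ k * exp (- inverse t) else 0)"

lemma flat_fun_tendsto: "(flat_fun k \<longlongrightarrow> 0) (at 0)"
proof -
  have "((\<lambda>t. inverse t ^ k / exp (inverse t)) \<longlongrightarrow> (0::real)) (at_right 0)"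
    by (rule filterlim_compose[OF tendsto_power_div_exp_0 filterlim_inverse_at_top_right])
  then have "(flat_fun k \<longlongrightarrow> 0) (at_right 0)"
    by (rule Lim_transform_eventually)
      (auto simp: flat_fun_def eventually_at_filter exp_minus divide_inverse)
  moreover have "(flat_fun k \<longlongrightarrow> 0) (at_left 0)"
    by (rule tendsto_eventually) (auto simp: flat_fun_def eventually_at_filter)
  ultimately show ?thesis by (simp add: filterlim_split_at)
qed

lemma flat_fun_derivative:
  "(flat_fun k has_real_derivative flat_fun (k + 2) t - real k * flat_fun (k + 1) t) (at t)"
proof (cases t "0 :: real" rule: linorder_cases)
  case less
  have "((\<lambda>t. 0) has_real_derivative flat_fun (k + 2) t - real k * flat_fun (k + 1) t) (at t)"
    using less by (simp add: flat_fun_def)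
  then show ?thesis
    by (rule has_field_derivative_transform_within_open[of _ _ _ "{..<0}"]) (use less in \<open>auto simp: flat_fun_def\<close>)
next
  case equal
  have "(\<lambda>h. (flat_fun k (0 + h) - flat_fun k 0) / h) \<midarrow>0\<rightarrow> 0"
    by (rule Lim_transform_eventually[OF flat_fun_tendsto[of "Suc k"]])
      (auto simp: flat_fun_def eventually_at_filter field_simps)
  then show ?thesis using equal by (simp add: DERIV_def flat_fun_def)
next
  case greater
  have "((\<lambda>t. inverse t ^ k) has_real_derivative
      real k * (- (inverse t ^ Suc (Suc 0)) * inverse t ^ (k - Suc 0))) (at t)"
    by (rule DERIV_power[OF DERIV_inverse]) (use greater in simp)
  moreover have "real k * (- (inverse t ^ Suc (Suc 0)) * inverse t ^ (k - Suc 0)) = - real k * inverse t ^ (k + 1)"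
    by (cases k) (simp_all add: algebra_simps)
  ultimately have "((\<lambda>t. inverse t ^ k) has_real_derivative - real k * inverse t ^ (k + 1)) (at t)"
    by (simp only:)
  moreover have "((\<lambda>t. exp (- inverse t)) has_real_derivative exp (- inverse t) * inverse t ^ 2) (at t)"
    using greater by (auto intro!: derivative_eq_intros simp: power2_eq_square)
  ultimately have "((\<lambda>t. inverse t ^ k * exp (- inverse t)) has_real_derivative
      - real k * inverse t ^ (k + 1) * exp (- inverse t) + exp (- inverse t) * inverse t ^ 2 * inverse t ^ k) (at t)"
    by (rule DERIV_mult)
  moreover have "- real k * inverse t ^ (k + 1) * exp (- inverse t) + exp (- inverse t) * inverse t ^ 2 * inverse t ^ k
      = flat_fun (k + 2) t - real k * flat_fun (k + 1) t"
    using greater by (simp add: flat_fun_def power_add power2_eq_square mult_ac)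
  ultimately have "((\<lambda>t. inverse t ^ k * exp (- inverse t)) has_real_derivative
      flat_fun (k + 2) t - real k * flat_fun (k + 1) t) (at t)" by simp
  then show ?thesis
    by (rule has_field_derivative_transform_within_open[of _ _ _ "{0<..}"]) (use greater in \<open>auto simp: flat_fun_def\<close>)
qed

lemma smooth_flat_fun: "smooth_on UNIV (flat_fun k)"
  unfolding smooth_on_def
proof
  fix m
  have t: "thick (UNIV :: real set)" by (rule thick_open) simp
  show "Ck_on m UNIV (flat_fun k)"
  proof (induction m arbitrary: k)
    case 0
    then show ?case by (auto intro!: continuous_at_imp_continuous_on DERIV_isCont[OF flat_fun_derivative])
  next
    case (Suc m)
    let ?D = "\<lambda>t. flat_fun (k + 2) t + (- real k) * flat_fun (k + 1) t"
    have D: "Ck_on m UNIV ?D"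
      by (rule Ck_on_add[OF t Suc Ck_on_linear_image[OF t bounded_linear_mult_right Suc]])
    show ?case
    proof (rule Ck_on_SucI[OF t, where f' = "\<lambda>t v. ?D t * v"])
      show "(flat_fun k has_derivative (*) (?D x)) (at x within UNIV)" for x
        using flat_fun_derivative[of k x] by (simp add: has_field_derivative_def)
      show "Ck_on m UNIV (\<lambda>t. ?D t * v)" for v
        by (rule Ck_on_linear_image[OF t bounded_linear_mult_left D])
    qed
  qed
qed

lemma flat_fun_0: "0 \<le> flat_fun 0 t" "0 < flat_fun 0 t \<longleftrightarrow> 0 < t"
  by (auto simp: flat_fun_def)

text \<open>The quotient \<open>e(1 - s) / (e(1 - s) + e(s - 1/2))\<close> with \<open>e(t) = exp (-1/t)\<close> and \<open>s = \<bar>x - x\<^sub>0\<bar>\<^sup>2 / r\<^sup>2\<close>.\<close>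

lemma bump_function:
  fixes x0 :: "'b::euclidean_space"
  assumes r: "0 < r"
  shows "\<exists>\<beta> :: 'b \<Rightarrow> real. (\<forall>S. thick S \<longrightarrow> smooth_on S \<beta>) \<and>
    (\<forall>x. dist x0 x \<le> r / 2 \<longrightarrow> \<beta> x = 1) \<and> (\<forall>x. r \<le> dist x0 x \<longrightarrow> \<beta> x = 0)"
proof -
  define s where "s x = (x - x0) \<bullet> (x - x0) / r\<^sup>2" for x
  have s: "s x = (dist x0 x / r)\<^sup>2" for x
    by (simp add: s_def dist_norm dot_square_norm power_divide norm_minus_commute)
  define \<beta> where "\<beta> x = flat_fun 0 (1 - s x) / (flat_fun 0 (1 - s x) + flat_fun 0 (s x - 1 / 2))" for x
  have "smooth_on S \<beta>" if t: "thick S" for S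
  proof -
    have sm: "smooth_on S s"
      unfolding s_def using r
      by (intro smooth_on_divide smooth_on_inner smooth_on_diff smooth_on_id smooth_on_const t) auto
    have f: "smooth_on S (\<lambda>x. flat_fun 0 (h x))" if "smooth_on S h" for h
      by (rule smooth_on_compose[OF t that _ smooth_flat_fun]) simp
    show ?thesis unfolding \<beta>_def
    proof (intro smooth_on_divide smooth_on_add f smooth_on_diff smooth_on_const sm t)
      fix x
      have "0 < 1 - s x \<or> 0 < s x - 1 / 2" by linarith
      then show "flat_fun 0 (1 - s x) + flat_fun 0 (s x - 1 / 2) \<noteq> 0"
        using flat_fun_0[of "1 - s x"] flat_fun_0[of "s x - 1 / 2"] by linarith
    qed simp
  qed
  moreover have "\<beta> x = 1" if "dist x0 x \<le> r / 2" for x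
  proof -
    have "dist x0 x / r \<le> 1 / 2" using that r by (simp add: field_simps)
    then have "s x \<le> (1 / 2)\<^sup>2" unfolding s using r by (intro power_mono) auto
    then have "s x \<le> 1 / 4" by (simp add: power2_eq_square)
    then show ?thesis by (simp add: \<beta>_def flat_fun_def)
  qed
  moreover have "\<beta> x = 0" if "r \<le> dist x0 x" for x
  proof -
    have "1 \<le> dist x0 x / r" using that r by simp
    then have "1 \<le> s x" unfolding s by (rule one_le_power)
    then show ?thesis by (simp add: \<beta>_def flat_fun_def)
  qed
  ultimately show ?thesis by blast
qed

context smooth_manifold
begin

lemma closedin_coord_ball:
  assumes c: "c \<in> A" and D: "cball x0 r \<inter> half_space \<subseteq> snd c ` fst c"
  shows "closedin X {p \<in> fst c. snd c p \<in> cball x0 r}"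
proof -
  let ?K = "{p \<in> fst c. snd c p \<in> cball x0 r}"
  have half: "snd c ` fst c \<subseteq> half_space" by (rule openin_imp_subset[OF hopen_chart[OF c]])
  then have im: "snd c ` ?K = cball x0 r \<inter> half_space" using D by blast
  have "closed (half_space :: 'n coords set)"
    unfolding half_space_def by (rule closed_halfspace_component_ge_cart)
  then have "compactin (top_of_set (snd c ` fst c)) (snd c ` ?K)"
    unfolding im compactin_subtopology by (simp add: D compact_Int_closed)
  moreover have "?K \<subseteq> topspace (subtopology X (fst c))" using chart_subset[OF c] by auto
  ultimately have "compactin (subtopology X (fst c)) ?K"
    using homeomorphic_map_compactness[OF chart_homeomorphic[OF c]] by blast
  then have "compactin X ?K" by (simp add: compactin_subtopology)
  then show ?thesis using Hausdorff compactin_imp_closedin by blast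
qed

text \<open>The condition on the Ricci curvature concerns global vector fields, so constant fields of a chart are
  cut off.\<close>

lemma global_field:
  assumes c0: "c0 \<in> A" and r: "0 < r" and D: "cball x0 r \<inter> half_space \<subseteq> snd c0 ` fst c0"
  shows "\<exists>\<xi>. vector_field A (topspace X) \<xi> \<and> (\<forall>x\<in>hball x0 (r / 2). \<xi> c0 x = v) \<and>
    (v $ None = 0 \<longrightarrow> vector_field_tangent A (topspace X) \<xi>)"
proof -
  obtain \<beta> :: "'n coords \<Rightarrow> real" where \<beta>: "\<And>S. thick S \<Longrightarrow> smooth_on S \<beta>"
      "\<And>x. dist x0 x \<le> r / 2 \<Longrightarrow> \<beta> x = 1" "\<And>x. r \<le> dist x0 x \<Longrightarrow> \<beta> x = 0"
    using bump_function[OF r, of x0] by blast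
  define w where "w x = \<beta> x *\<^sub>R v" for x
  define \<xi> :: "('a, 'n) vfield" where "\<xi> c x = (if coord_inv c x \<in> fst c0 then chart_field c0 w c x else 0)" for c x
  have S0: "hopen (coord c0 (fst c0))" by (rule hopen_coord[OF c0 openin_chart[OF c0]])
  have sw: "smooth_on (coord c0 (fst c0)) w"
    unfolding w_def by (intro smooth_on_scaleR smooth_on_const thick_hopen[OF S0] \<beta>(1))
  let ?K = "{p \<in> fst c0. snd c0 p \<in> cball x0 r}"
  have K: "openin X (topspace X - ?K)" using closedin_coord_ball[OF c0 D] by blast
  have sm: "smooth_on (coord c (topspace X)) (\<xi> c)" if c: "c \<in> A" for c
  proof (rule smooth_on_local)
    fix x assume x: "x \<in> coord c (topspace X)"
    have o: "openin (top_of_set (coord c (topspace X))) (coord c U)" if "openin X U" for U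
      using openin_subset_trans[OF hopen_coord[OF c that] coord_mono openin_imp_subset[OF hopen_coord[OF c openin_topspace]]]
        openin_subset[OF that] by blast
    show "\<exists>V. x \<in> V \<and> openin (top_of_set (coord c (topspace X))) V \<and> smooth_on V (\<xi> c)"
    proof (cases "coord_inv c x \<in> fst c0")
      case True
      have "x \<in> coord c (fst c0)"
        using coordI[OF True] coordD[OF c x] by metis
      moreover have "smooth_on (coord c (fst c0)) (\<xi> c)"
        by (rule smooth_on_eq[OF smooth_chart_field[OF c0 c openin_chart[OF c0] order_refl sw]])
          (use coordD[OF c] in \<open>simp add: \<xi>_def\<close>)
      ultimately show ?thesis using o[OF openin_chart[OF c0]] by blast
    next
      case False
      have "x \<in> coord c (topspace X - ?K)"
        using coordI[of "coord_inv c x" "topspace X - ?K" c] coordD[OF c x] False by auto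
      moreover have "smooth_on (coord c (topspace X - ?K)) (\<xi> c)"
      proof (rule smooth_on_eq[OF smooth_on_const[OF thick_hopen[OF hopen_coord[OF c K]], of 0]])
        fix y assume y: "y \<in> coord c (topspace X - ?K)"
        show "0 = \<xi> c y"
        proof (cases "coord_inv c y \<in> fst c0")
          case True
          let ?z = "transition c c0 y"
          have "r \<le> dist x0 ?z" using coordD(1)[OF c y] True by (simp add: transition_def)
          then have w0: "w ?z = 0" by (simp add: w_def \<beta>(3))
          have "y \<in> coord c (fst c0)" using coordI[OF True] coordD[OF c y] by metis
          then have "?z \<in> coord c0 (fst c)"
            using transitionD(1)[OF c c0, of y "fst c0"] by (auto simp: coord_def)
          then show ?thesis
            using linear_0[OF linear_transition_derivative[OF c0 c]] by (simp add: \<xi>_def chart_field_def w0)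
        qed (simp add: \<xi>_def)
      qed
      ultimately show ?thesis using o[OF K] by blast
    qed
  qed
  have law: "\<xi> c' (transition c c' x) = bderiv (transition c c') x (\<xi> c x)"
    if c: "c \<in> A" "c' \<in> A" "x \<in> coord c (topspace X \<inter> fst c')" for c c' x
  proof -
    have i: "coord_inv c' (transition c c' x) = coord_inv c x" by (rule transitionD(2)[OF c])
    have x: "x \<in> coord c (fst c')" using c(3) by (auto simp: coord_def)
    show ?thesis
    proof (cases "coord_inv c x \<in> fst c0")
      case True
      then have "x \<in> coord c (fst c0 \<inter> fst c')"
        using coordI[of "coord_inv c x" "fst c0 \<inter> fst c'" c] coordD[OF c(1) x] by auto
      then show ?thesis using chart_field_law[OF c0 c(1,2)] True i by (simp add: \<xi>_def)
    next
      case False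
      then show ?thesis using linear_0[OF linear_transition_derivative[OF c(1,2) x]] i by (simp add: \<xi>_def)
    qed
  qed
  have vf: "vector_field A (topspace X) \<xi>" unfolding vector_field_def using sm law by blast
  moreover have "\<xi> c0 x = v" if x: "x \<in> hball x0 (r / 2)" for x
  proof -
    have "x \<in> cball x0 r \<inter> half_space" using x r by (simp add: hball_def)
    then have x': "x \<in> coord c0 (fst c0)" using D coord_chart by blast
    have "\<beta> x = 1" using x by (intro \<beta>(2)) (simp add: hball_def)
    then show ?thesis
      using chart_field_self[OF c0 x'] coordD(1)[OF c0 x'] by (simp add: \<xi>_def w_def)
  qed
  moreover have "vector_field_tangent A (topspace X) \<xi>" if v: "v $ None = 0"
    unfolding vector_field_tangent_def
  proof (intro conjI vf ballI)
    fix c x assume c: "c \<in> A" and x: "x \<in> coord c (topspace X \<inter> bdry A)"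
    show "\<xi> c x $ None = 0"
    proof (cases "coord_inv c x \<in> fst c0")
      case True
      have "x \<in> coord c (topspace X)" "x $ None = 0" using x coord_bdry_iff[OF c] by auto
      moreover from this have "x \<in> coord c (fst c0)" using coordI[OF True] coordD[OF c] by metis
      ultimately show ?thesis
        using chart_field_tangent[OF c0 c, of x w] True v by (simp add: \<xi>_def w_def)
    qed (simp add: \<xi>_def)
  qed
  ultimately show ?thesis by blast
qed

end

section \<open>Pre-compact metrics in charts\<close>

lemma bderiv_component: "x \<in> half_space \<Longrightarrow> bderiv (\<lambda>y. y $ a) x = (\<lambda>v. v $ a)"
  by (rule bderiv_eqI[OF _ bounded_linear_imp_has_derivative[OF bounded_linear_vec_nth]])

lemma bderiv_locally_const:
  assumes "hopen V" "x \<in> V" "\<And>y. y \<in> V \<Longrightarrow> f y = k"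
  shows "bderiv f x = (\<lambda>_. 0)"
proof -
  have "bderiv f x = bderiv (\<lambda>_. k) x" by (rule bderiv_cong[OF assms])
  also have "\<dots> = (\<lambda>_. 0)"
    by (rule bderiv_eqI[OF _ has_derivative_const]) (use assms openin_imp_subset in blast)
  finally show ?thesis .
qed

lemma cov_locally_const:
  assumes "hopen V" "x \<in> V" "\<And>y. y \<in> V \<Longrightarrow> \<xi> c y = v" "\<And>y. y \<in> V \<Longrightarrow> \<eta> c y = w"
  shows "cov \<Gamma> \<xi> \<eta> c x = \<Gamma> c x v w"
  using bderiv_locally_const[OF assms(1,2,4)] assms by (simp add: cov_def)

lemma ricci_locally_const:
  assumes V: "hopen V" "x \<in> V" and \<xi>: "\<And>y. y \<in> V \<Longrightarrow> \<xi> c y = v" and \<eta>: "\<And>y. y \<in> V \<Longrightarrow> \<eta> c y = w"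
    and bil: "bilinear (\<Gamma> c x)"
  shows "ricci \<Gamma> \<xi> \<eta> c x = chart_ricci (\<Gamma> c) x v w"
proof -
  have const: "\<And>y. y \<in> V \<Longrightarrow> (\<lambda>_ _. u) c y = u" for u :: "'b coords" by simp
  have c1: "bderiv (cov \<Gamma> \<zeta> \<eta> c) x = bderiv (\<lambda>y. \<Gamma> c y u w) x"
    if "\<And>y. y \<in> V \<Longrightarrow> \<zeta> c y = u" for \<zeta> u
  proof (rule bderiv_cong[OF V])
    fix y assume "y \<in> V"
    from cov_locally_const[OF V(1) this, of \<zeta> c u \<eta> w \<Gamma>] show "cov \<Gamma> \<zeta> \<eta> c y = \<Gamma> c y u w"
      using that \<eta> by simp
  qed
  have z: "\<Gamma> c x 0 w = 0" by (rule bilinear_lzero[OF bil])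
  have lb: "lie_bracket (\<lambda>_ _. u) \<xi> c x = 0" for u
    using bderiv_locally_const[OF V, of "\<xi> c" v] \<xi> bderiv_locally_const[OF V, of "\<lambda>_. u" u]
    by (simp add: lie_bracket_def)
  have R: "riemann \<Gamma> (\<lambda>_ _. u) \<xi> \<eta> c x = (bderiv (\<lambda>y. \<Gamma> c y v w) x u + \<Gamma> c x u (\<Gamma> c x v w))
      - (bderiv (\<lambda>y. \<Gamma> c y u w) x v + \<Gamma> c x v (\<Gamma> c x u w))" for u
  proof -
    have 1: "cov \<Gamma> (\<lambda>_ _. u) (cov \<Gamma> \<xi> \<eta>) c x = bderiv (\<lambda>y. \<Gamma> c y v w) x u + \<Gamma> c x u (\<Gamma> c x v w)"
      using c1[of \<xi> v, OF \<xi>] cov_locally_const[OF V, of \<xi> c v \<eta> w \<Gamma>] \<xi> \<eta>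
      by (simp add: cov_def[of \<Gamma> _ "cov \<Gamma> \<xi> \<eta>"])
    have 2: "cov \<Gamma> \<xi> (cov \<Gamma> (\<lambda>_ _. u) \<eta>) c x = bderiv (\<lambda>y. \<Gamma> c y u w) x v + \<Gamma> c x v (\<Gamma> c x u w)"
      using c1[of "\<lambda>_ _. u" u, OF refl] cov_locally_const[OF V, of "\<lambda>_ _. u" c u \<eta> w \<Gamma>] \<xi>[OF V(2)] \<eta>
      by (simp add: cov_def[of \<Gamma> _ "cov \<Gamma> (\<lambda>_ _. u) \<eta>"])
    have 3: "cov \<Gamma> (lie_bracket (\<lambda>_ _. u) \<xi>) \<eta> c x = 0"
      using bderiv_locally_const[OF V, of "\<eta> c" w] \<eta> V(2) by (simp add: cov_def lb z)
    show ?thesis unfolding riemann_def 1 2 3 by simp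
  qed
  show ?thesis
    unfolding ricci_def chart_ricci_def trace_def matrix_def by (simp add: R algebra_simps)
qed

locale precompact_manifold = smooth_manifold X A
  for X :: "'a topology" and A :: "('a, 'n::finite) chart set" +
  fixes g :: "('a, 'n) bform" and \<Gamma> :: "('a, 'n) christoffel"
  assumes metric: "pseudo_metric A (mint X A) g"
    and levi_civita: "levi_civita X A g \<Gamma>"
    and precompact: "precompact_connection X A \<Gamma>"
    and ricci_flat: "asym_tangentially_ricci_flat X A g"
begin

abbreviation const_field :: "('a, 'n) chart \<Rightarrow> 'n coords \<Rightarrow> ('a, 'n) vfield" where
  "const_field c v \<equiv> chart_field c (\<lambda>_. v)"

lemma vector_field_const:
  "c \<in> A \<Longrightarrow> openin X U \<Longrightarrow> U \<subseteq> fst c \<Longrightarrow> vector_field A U (const_field c v)"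
  by (rule vector_field_chart_field) (simp_all add: smooth_on_const thick_hopen hopen_coord)

lemma const_field_tangent:
  assumes "c \<in> A" "v $ None = 0"
  shows "vector_field_tangent A (fst c) (const_field c v)"
  unfolding vector_field_tangent_def
  using vector_field_const[OF assms(1) openin_chart[OF assms(1)] order_refl]
    chart_field_tangent[OF assms(1), of _ _ "\<lambda>_. v"] assms(2) coord_bdry_iff by simp

lemma const_field_self: "c \<in> A \<Longrightarrow> x \<in> snd c ` fst c \<Longrightarrow> const_field c v c x = v"
  using chart_field_self[of c x "fst c"] by (simp add: coord_chart)

lemma cov_const: "c \<in> A \<Longrightarrow> x \<in> snd c ` fst c \<Longrightarrow> cov \<Delta> (const_field c v) (const_field c w) c x = \<Delta> c x v w"
  using cov_locally_const[OF hopen_chart, of c x "const_field c v" c v "const_field c w" w \<Delta>] const_field_self by blast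

lemma interior_chart:
  assumes "c \<in> A"
  shows "openin X (fst c \<inter> mint X A)" "fst c \<inter> mint X A \<subseteq> mint X A" "fst c \<inter> mint X A \<subseteq> fst c"
    "coord c (fst c \<inter> mint X A) = pos (snd c ` fst c)"
  using openin_chart[OF assms] openin_mint coord_mint[OF assms openin_chart[OF assms]] by (auto simp: coord_chart)

lemma symmetric_connection:
  assumes c: "c \<in> A" and x: "x \<in> pos (snd c ` fst c)" and \<Delta>: "torsion_free X A \<Delta>"
  shows "\<Delta> c x v w = \<Delta> c x w v"
proof -
  have x': "x \<in> snd c ` fst c" using x pos_subset by blast
  note I = interior_chart[OF c]
  have "cov \<Delta> (const_field c v) (const_field c w) c x - cov \<Delta> (const_field c w) (const_field c v) c x
      = lie_bracket (const_field c v) (const_field c w) c x"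
    using \<Delta> I(1,2) vector_field_const[OF c I(1,3)] c x I(4) unfolding torsion_free_def by blast
  moreover have "bderiv (const_field c v c) x = (\<lambda>_. 0)" for v
    by (rule bderiv_locally_const[OF hopen_chart[OF c] x' const_field_self[OF c]])
  ultimately show ?thesis by (simp add: cov_const[OF c x'] lie_bracket_def)
qed

lemma metric_connection:
  assumes c: "c \<in> A" and x: "x \<in> pos (snd c ` fst c)" and \<Delta>: "levi_civita X A g \<Delta>"
  shows "bderiv (\<lambda>y. g c y u w) x v = g c x (\<Delta> c x v u) w + g c x u (\<Delta> c x v w)"
proof -
  have x': "x \<in> snd c ` fst c" using x pos_subset by blast
  note I = interior_chart[OF c]
  have "bderiv (\<lambda>y. g c y (const_field c u c y) (const_field c w c y)) x (const_field c v c x)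
      = g c x (cov \<Delta> (const_field c v) (const_field c u) c x) (const_field c w c x)
        + g c x (const_field c u c x) (cov \<Delta> (const_field c v) (const_field c w) c x)"
    using \<Delta> I(1,2) vector_field_const[OF c I(1,3)] c x I(4) unfolding levi_civita_def by blast
  moreover have "bderiv (\<lambda>y. g c y (const_field c u c y) (const_field c w c y)) x = bderiv (\<lambda>y. g c y u w) x"
    by (rule bderiv_cong[OF hopen_chart[OF c] x']) (simp add: const_field_self[OF c])
  ultimately show ?thesis by (simp add: cov_const[OF c x'] const_field_self[OF c x'])
qed

lemma metric_chart:
  assumes c: "c \<in> A" and x: "x \<in> pos (snd c ` fst c)"
  shows "bilinear (g c x)" "g c x v w = g c x w v" "(\<And>w. g c x v w = 0) \<Longrightarrow> v = 0"
  using metric c x coord_mint_chart[OF c] unfolding pseudo_metric_def sym_form_field_def by auto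

lemma connection_chart:
  assumes c: "c \<in> A" and x: "x \<in> pos (snd c ` fst c)" and \<Delta>: "levi_civita X A g \<Delta>"
  shows "bilinear (\<Delta> c x)"
  using \<Delta> c x coord_mint_chart[OF c] unfolding levi_civita_def connection_def by auto

text \<open>Koszul's argument for the uniqueness of the Levi-Civita connection.\<close>

lemma levi_civita_unique:
  assumes c: "c \<in> A" and x: "x \<in> pos (snd c ` fst c)" and \<Delta>: "levi_civita X A g \<Delta>"
  shows "\<Delta> c x v u = \<Gamma> c x v u"
proof -
  define t where "t v u w = g c x (\<Delta> c x v u - \<Gamma> c x v u) w" for v u w
  note b = metric_chart(1)[OF c x] and s = metric_chart(2)[OF c x]
  have sym: "t v u w = t u v w" for v u w
    using symmetric_connection[OF c x] levi_civita \<Delta> unfolding t_def levi_civita_def by metis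
  have skew: "t v u w = - t v w u" for v u w
    using metric_connection[OF c x levi_civita, of u w v] metric_connection[OF c x \<Delta>, of u w v]
      s[of u "\<Delta> c x v w"] s[of u "\<Gamma> c x v w"]
    by (simp add: t_def bilinear_lsub[OF b])
  have "t v u w = 0" for w
    using skew[of v u w] sym[of v w u] skew[of w v u] sym[of w u v] skew[of u w v] sym[of u v w] by linarith
  then have "\<Delta> c x v u - \<Gamma> c x v u = 0" unfolding t_def by (rule metric_chart(3)[OF c x])
  then show ?thesis by simp
qed

lemma nabla_rho_const:
  assumes c: "c \<in> A" and x: "x \<in> snd c ` fst c"
  shows "nabla_rho \<Gamma> (\<lambda>p. snd c p $ None) (const_field c v) (const_field c w) c x = rho_symbol (\<Gamma> c) x v w"
    and "differential (\<lambda>p. snd c p $ None) c x v = v $ None"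
proof -
  have S: "hopen (snd c ` fst c)" by (rule hopen_chart[OF c])
  have "bderiv ((\<lambda>p. snd c p $ None) \<circ> coord_inv c) x = bderiv (\<lambda>y. y $ None) x"
    by (rule bderiv_cong[OF S x]) (use coordD(3)[OF c, of _ "fst c"] coord_chart[of c] in simp)
  also have "\<dots> = (\<lambda>v. v $ None)"
    by (rule bderiv_component) (use x openin_imp_subset[OF S] in auto)
  finally show d: "differential (\<lambda>p. snd c p $ None) c x v = v $ None" for v by (simp add: differential_def)
  have "snd c (coord_inv c x) = x" using coordD(3)[OF c, of x "fst c"] x by (simp add: coord_chart)
  then show "nabla_rho \<Gamma> (\<lambda>p. snd c p $ None) (const_field c v) (const_field c w) c x = rho_symbol (\<Gamma> c) x v w"
    by (simp add: nabla_rho_def rho_symbol_def cov_const[OF c x] const_field_self[OF c x] d)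
qed

text \<open>The cut-off of a field that is constant and tangential in the chart is tangential everywhere, so the
  hypothesis applies to it and yields the Ricci tensor near \<open>p\<close>.\<close>

lemma ricci_extends:
  assumes c: "c \<in> A" and w: "w $ None = 0" and p: "p \<in> snd c ` fst c"
  shows "\<exists>V F. hopen V \<and> V \<subseteq> snd c ` fst c \<and> p \<in> V \<and> continuous_on V F \<and>
    (\<forall>x\<in>pos V. F x = chart_ricci (\<Gamma> c) x v w)"
proof -
  let ?S = "snd c ` fst c"
  have S: "hopen ?S" by (rule hopen_chart[OF c])
  obtain \<Delta> where \<Delta>: "levi_civita X A g \<Delta>" and ext: "\<And>\<xi> \<eta>. vector_field A (topspace X) \<xi> \<Longrightarrow>
      vector_field A (topspace X) \<eta> \<Longrightarrow> vector_field_tangent A (topspace X) \<eta> \<Longrightarrow>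
      \<exists>F. extends_fun X A (topspace X) (ricci \<Delta> \<xi> \<eta>) F"
    using ricci_flat unfolding asym_tangentially_ricci_flat_def by meson
  obtain r where r: "0 < r" "cball p r \<inter> half_space \<subseteq> ?S" using hopen_contains_hcball[OF S p] .
  define V where "V = hball p (r / 2)"
  have V: "hopen V" "V \<subseteq> ?S" "p \<in> V"
    using r hopen_hball hopenD[OF S p] by (auto simp: V_def hball_def half_space_def)
  obtain \<xi> where \<xi>: "vector_field A (topspace X) \<xi>" "\<And>x. x \<in> V \<Longrightarrow> \<xi> c x = v"
    using global_field[OF c r] unfolding V_def by blast
  obtain \<eta> where \<eta>: "vector_field A (topspace X) \<eta>" "\<And>x. x \<in> V \<Longrightarrow> \<eta> c x = w" "vector_field_tangent A (topspace X) \<eta>"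
    using global_field[OF c r] w unfolding V_def by blast
  obtain F where F: "extends_fun X A (topspace X) (ricci \<Delta> \<xi> \<eta>) F" using ext \<xi>(1) \<eta>(1,3) by blast
  have "smooth_on (coord c (topspace X)) (F \<circ> coord_inv c)"
    using F c unfolding extends_fun_def smooth_fun_def by blast
  then have "continuous_on V (F \<circ> coord_inv c)"
    using smooth_on_continuous V(2) continuous_on_subset coord_topspace[OF c] by metis
  moreover have "(F \<circ> coord_inv c) x = chart_ricci (\<Gamma> c) x v w" if x: "x \<in> pos V" for x
  proof -
    have xS: "x \<in> pos ?S" and xV: "x \<in> V" using x V(2) pos_mono pos_subset by blast+
    have "x \<in> coord c (topspace X \<inter> mint X A)"
      using xS coord_mint[OF c openin_topspace] coord_topspace[OF c] by simp
    then have "F (coord_inv c x) = ricci \<Delta> \<xi> \<eta> c x" using F c unfolding extends_fun_def by blast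
    also have "\<dots> = chart_ricci (\<Delta> c) x v w"
      by (rule ricci_locally_const[where V = V]) (use V xV \<xi> \<eta> connection_chart[OF c xS \<Delta>] in auto)
    also have "\<dots> = chart_ricci (\<Gamma> c) x v w"
    proof -
      have "bderiv (\<lambda>y. \<Delta> c y u1 u2) x = bderiv (\<lambda>y. \<Gamma> c y u1 u2) x" for u1 u2
        by (rule bderiv_cong[OF hopen_pos[OF S] xS]) (rule levi_civita_unique[OF c _ \<Delta>])
      then show ?thesis unfolding chart_ricci_def by (simp add: levi_civita_unique[OF c xS \<Delta>])
    qed
    finally show ?thesis by simp
  qed
  ultimately show ?thesis using V by blast
qed

lemma precompact_chart:
  assumes c: "c \<in> A"
  shows "precompact_chart (snd c ` fst c) (g c) (\<Gamma> c)"
proof -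
  let ?S = "snd c ` fst c" and ?\<rho> = "\<lambda>p. snd c p $ None"
  have S: "hopen ?S" by (rule hopen_chart[OF c])
  have t: "thick ?S" by (rule thick_hopen[OF S])
  have "local_defining X A (fst c) (\<lambda>p. (\<lambda>x. x $ None) (snd c p))"
  proof (rule local_defining_chart[OF c openin_chart[OF c] order_refl])
    show "smooth_on (coord c (fst c)) (\<lambda>x. x $ None)"
      unfolding coord_chart by (intro smooth_on_nth smooth_on_id t)
    have "bderiv (\<lambda>x :: 'n coords. x $ None) x = (\<lambda>v. v $ None)" if "x \<in> coord c (fst c)" for x
      by (rule bderiv_component) (use that openin_imp_subset[OF S] coord_chart[of c] in auto)
    then show "bderiv (\<lambda>x :: 'n coords. x $ None) x e\<^sub>0 \<noteq> 0" if "x \<in> coord c (fst c)" for x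
      using that by (simp add: axis_def)
  qed simp
  then have ld: "local_defining X A (fst c) ?\<rho>" by simp
  have vf: "vector_field A (fst c) (const_field c v)" for v by (rule vector_field_const[OF c openin_chart[OF c] order_refl])
  have cm: "coord c (fst c \<inter> mint X A) = pos ?S" by (rule interior_chart(4)[OF c])
  have ci: "?\<rho> (coord_inv c x) = x $ None" if "x \<in> pos ?S" for x
    using coordD(3)[OF c, of x "fst c"] that pos_subset[of ?S] by (auto simp: coord_chart)
  have vext: "\<exists>Z. smooth_on ?S Z \<and> (\<forall>x\<in>pos ?S. Z x = \<zeta> c x)" if ext: "smooth_up_to_bdry_vf X A (fst c) \<zeta>" for \<zeta>
  proof -
    obtain Z where Z: "vector_field A (fst c) Z" "\<forall>c'\<in>A. \<forall>x\<in>coord c' (fst c \<inter> mint X A). Z c' x = \<zeta> c' x"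
      using ext unfolding smooth_up_to_bdry_vf_def by blast
    have "smooth_on (coord c (fst c)) (Z c)" using Z(1) c unfolding vector_field_def by blast
    then have "smooth_on ?S (Z c)" by (simp only: coord_chart)
    moreover have "\<forall>x\<in>pos ?S. Z c x = \<zeta> c x" using Z(2) c cm by simp
    ultimately show ?thesis by blast
  qed
  have P: "smooth_up_to_bdry_fun X A (fst c) (\<lambda>c' x. differential ?\<rho> c' x (nabla_rho \<Gamma> ?\<rho> (const_field c v) (const_field c w) c' x))"
    "smooth_up_to_bdry_vf X A (fst c) (scale_field ?\<rho> (nabla_rho \<Gamma> ?\<rho> (const_field c v) (const_field c w)))"
    "w $ None = 0 \<Longrightarrow> smooth_up_to_bdry_vf X A (fst c) (nabla_rho \<Gamma> ?\<rho> (const_field c v) (const_field c w))" for v w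
    using precompact ld vf[of v] vf[of w] const_field_tangent[OF c, of w] unfolding precompact_connection_def by blast+
  note nr = nabla_rho_const[OF c subsetD[OF pos_subset]]
  show ?thesis
  proof
    show "hopen ?S" by (rule S)
    show "bilinear (g c x)" "g c x v w = g c x w v" "(\<And>w. g c x v w = 0) \<Longrightarrow> v = 0"
      if "x \<in> pos ?S" for x v w using metric_chart[OF c that] by auto
    show "smooth_on (pos ?S) (\<lambda>x. g c x v w)" for v w
      using metric c coord_mint_chart[OF c] unfolding pseudo_metric_def sym_form_field_def by auto
    show "bilinear (\<Gamma> c x)" if "x \<in> pos ?S" for x by (rule connection_chart[OF c that levi_civita])
    show "\<Gamma> c x v w = \<Gamma> c x w v" if "x \<in> pos ?S" for x v w
      by (rule symmetric_connection[OF c that]) (use levi_civita in \<open>simp add: levi_civita_def\<close>)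
    show "bderiv (\<lambda>y. g c y u w) x v = g c x (\<Gamma> c x v u) w + g c x u (\<Gamma> c x v w)" if "x \<in> pos ?S" for x u w v
      by (rule metric_connection[OF c that levi_civita])
    show "\<exists>N. smooth_on ?S N \<and> (\<forall>x\<in>pos ?S. N x = rho_symbol (\<Gamma> c) x v w $ None)" for v w
    proof -
      obtain F where F: "extends_fun X A (fst c) (\<lambda>c' x. differential ?\<rho> c' x
          (nabla_rho \<Gamma> ?\<rho> (const_field c v) (const_field c w) c' x)) F"
        using P(1) unfolding smooth_up_to_bdry_fun_def by blast
      have "smooth_on (coord c (fst c)) (F \<circ> coord_inv c)"
        using F c unfolding extends_fun_def smooth_fun_def by blast
      then have "smooth_on ?S (F \<circ> coord_inv c)" by (simp only: coord_chart)
      moreover have "(F \<circ> coord_inv c) x = rho_symbol (\<Gamma> c) x v w $ None" if "x \<in> pos ?S" for x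
      proof -
        have "F (coord_inv c x) = differential ?\<rho> c x (nabla_rho \<Gamma> ?\<rho> (const_field c v) (const_field c w) c x)"
          using F c cm that unfolding extends_fun_def by blast
        then show ?thesis using nr that by simp
      qed
      ultimately show ?thesis by blast
    qed
    show "\<exists>W. smooth_on ?S W \<and> (\<forall>x\<in>pos ?S. W x = x $ None *\<^sub>R rho_symbol (\<Gamma> c) x v w)" for v w
      using vext[OF P(2)[of v w]] nr(1) ci by (simp add: scale_field_def cong: conj_cong ball_cong)
    show "\<exists>Z. smooth_on ?S Z \<and> (\<forall>x\<in>pos ?S. Z x = rho_symbol (\<Gamma> c) x v w)" if "w $ None = 0" for v w
      using vext[OF P(3)[OF that, of v]] nr(1) by (simp cong: conj_cong ball_cong)
    show "\<exists>V F. hopen V \<and> V \<subseteq> ?S \<and> p \<in> V \<and> continuous_on V F \<and> (\<forall>x\<in>pos V. F x = chart_ricci (\<Gamma> c) x v w)"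
      if "w $ None = 0" "p \<in> ?S" for p v w by (rule ricci_extends[OF c that])
  qed
qed

end

section \<open>The tractor metric\<close>

text \<open>Coefficients of a vector field tangent to the boundary with respect to the frame \<open>x\<^sub>0 \<partial>\<^sub>0, \<partial>\<^sub>i\<close>.\<close>

definition frame_component :: "(('n::finite) coords \<Rightarrow> 'n coords) \<Rightarrow> 'n option \<Rightarrow> 'n coords \<Rightarrow> real" where
  "frame_component v a = (case a of None \<Rightarrow> normal_quotient (\<lambda>x. v x $ None) | Some i \<Rightarrow> (\<lambda>x. v x $ Some i))"

context precompact_chart
begin

text \<open>The local expression of \<open>\<sigma>\<^sup>2 g(v, w)\<close> that makes sense on the boundary: the determinant of \<open>g\<close> is that of
  \<open>G\<close> times \<open>x\<^sub>0\<^sup>-\<^sup>2\<^sup>(\<^sup>n\<^sup>+\<^sup>2\<^sup>)\<close>, so \<open>\<sigma>\<^sup>2\<close> contributes \<open>x\<^sub>0\<^sup>2\<close> and cancels the poles of \<open>g\<close>.\<close>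

definition tractor_pairing :: "('n coords \<Rightarrow> 'n coords) \<Rightarrow> ('n coords \<Rightarrow> 'n coords) \<Rightarrow> 'n coords \<Rightarrow> real" where
  "tractor_pairing v w x = \<bar>det (G x)\<bar> powr (- 1 / (real CARD('n) + 2)) *
     (\<Sum>a\<in>UNIV. \<Sum>b\<in>UNIV. G x $ a $ b * frame_component v a x * frame_component w b x)"

lemma smooth_frame_component:
  assumes T: "hopen T" and v: "smooth_on T v" "\<And>x. x \<in> T \<Longrightarrow> x $ None = 0 \<Longrightarrow> v x $ None = 0"
  shows "smooth_on T (frame_component v a)"
    and "x \<in> T \<Longrightarrow> v x $ a = frame_factor a x * frame_component v a x"
proof -
  have s: "smooth_on T (\<lambda>x. v x $ b)" for b by (rule smooth_on_nth[OF thick_hopen[OF T] v(1)])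
  show "smooth_on T (frame_component v a)"
    using s smooth_on_normal_quotient[OF T s[of None] v(2)] by (cases a) (simp_all add: frame_component_def)
  show "v x $ a = frame_factor a x * frame_component v a x" if "x \<in> T"
    using normal_quotient_mult[OF T s[of None] v(2) that]
    by (cases a) (simp_all add: frame_component_def frame_factor_def)
qed

lemma smooth_tractor_pairing:
  assumes T: "hopen T" "T \<subseteq> S"
    and v: "smooth_on T v" "\<And>x. x \<in> T \<Longrightarrow> x $ None = 0 \<Longrightarrow> v x $ None = 0"
    and w: "smooth_on T w" "\<And>x. x \<in> T \<Longrightarrow> x $ None = 0 \<Longrightarrow> w x $ None = 0"
  shows "smooth_on T (tractor_pairing v w)"
proof -
  have t: "thick T" by (rule thick_hopen[OF T(1)])
  have G: "smooth_on T (\<lambda>x. G x $ a $ b)" for a b by (rule smooth_on_hopen_subset[OF S T smooth_G])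
  have "smooth_on T (\<lambda>x. \<bar>det (G x)\<bar> powr (- 1 / (real CARD('n) + 2)))"
    by (intro smooth_on_abs_powr smooth_on_det t G) (use T(2) det_G_nonzero in auto)
  moreover have "smooth_on T (\<lambda>x. \<Sum>a\<in>UNIV. \<Sum>b\<in>UNIV. G x $ a $ b * frame_component v a x * frame_component w b x)"
    by (intro smooth_on_sum smooth_on_mult t G smooth_frame_component(1)[OF T(1) v] smooth_frame_component(1)[OF T(1) w])
  ultimately show ?thesis
    unfolding tractor_pairing_def by (rule smooth_on_mult[OF t])
qed

lemma tractor_pairing_interior:
  assumes T: "hopen T" "T \<subseteq> S"
    and v: "smooth_on T v" "\<And>x. x \<in> T \<Longrightarrow> x $ None = 0 \<Longrightarrow> v x $ None = 0"
    and w: "smooth_on T w" "\<And>x. x \<in> T \<Longrightarrow> x $ None = 0 \<Longrightarrow> w x $ None = 0"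
    and x: "x \<in> pos T"
  shows "tractor_pairing v w x
    = (sqrt \<bar>det (\<chi> i j. g x (ax i) (ax j))\<bar> powr (- 1 / (real CARD('n) + 2)))\<^sup>2 * g x (v x) (w x)"
proof -
  have xT: "x \<in> T" and xS: "x \<in> pos S" and r: "0 < x $ None"
    using x pos_subset pos_mono[OF T(2)] by (auto simp: pos_def)
  let ?r = "x $ None" and ?N = "real CARD('n) + 2"
  define D where "D = \<bar>det (\<chi> i j. g x (ax i) (ax j))\<bar>"
  have D: "0 < D" using det_g_nonzero[OF xS] by (simp add: D_def)
  have "g x (v x) (w x) = (\<Sum>a\<in>UNIV. \<Sum>b\<in>UNIV. v x $ a * w x $ b * g x (ax a) (ax b))"
    by (rule bilinear_ax_expansion[OF g_bilinear[OF xS]])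
  then have "?r\<^sup>2 * g x (v x) (w x)
      = (\<Sum>a\<in>UNIV. \<Sum>b\<in>UNIV. ?r\<^sup>2 * (v x $ a * w x $ b * g x (ax a) (ax b)))"
    by (simp add: sum_distrib_left)
  also have "\<dots> = (\<Sum>a\<in>UNIV. \<Sum>b\<in>UNIV. G x $ a $ b * frame_component v a x * frame_component w b x)"
    by (intro sum.cong refl)
      (simp add: smooth_frame_component(2)[OF T(1) v xT] smooth_frame_component(2)[OF T(1) w xT]
        G[OF xS] frame_metric_def mult_ac)
  finally have 1: "\<dots> = ?r\<^sup>2 * g x (v x) (w x)" by simp
  have "\<bar>det (G x)\<bar> = ?r ^ (2 * CARD('n) + 4) * D"
    using r by (simp add: G[OF xS] det_frame_metric[OF xS] D_def abs_mult)
  also have "?r ^ (2 * CARD('n) + 4) = ?r powr (2 * ?N)"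
    using powr_realpow[OF r, of "2 * CARD('n) + 4"] by (simp add: algebra_simps)
  finally have "\<bar>det (G x)\<bar> powr (- 1 / ?N) = (?r powr (2 * ?N)) powr (- 1 / ?N) * D powr (- 1 / ?N)"
    using D by (simp add: powr_mult)
  also have "(?r powr (2 * ?N)) powr (- 1 / ?N) = ?r powr (- 2)"
  proof -
    have "2 * ?N * (- 1 / ?N) = - 2" by (simp add: field_simps)
    then show ?thesis by (simp only: powr_powr)
  qed
  also have "\<dots> = 1 / ?r\<^sup>2"
    using r by (simp add: powr_minus_divide powr_numeral)
  finally have 2: "\<bar>det (G x)\<bar> powr (- 1 / ?N) = 1 / ?r\<^sup>2 * D powr (- 1 / ?N)" .
  have 3: "(sqrt D powr (- 1 / ?N))\<^sup>2 = D powr (- 1 / ?N)"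
  proof -
    have "(sqrt D * sqrt D) powr (- 1 / ?N) = sqrt D powr (- 1 / ?N) * sqrt D powr (- 1 / ?N)"
      by (rule powr_mult)
    then show ?thesis using D by (simp add: power2_eq_square)
  qed
  show ?thesis
    unfolding tractor_pairing_def 1 2 D_def[symmetric] 3 using r by simp
qed

end

context precompact_manifold
begin

abbreviation pairing :: "('a, 'n) chart \<Rightarrow> ('n coords \<Rightarrow> 'n coords) \<Rightarrow> ('n coords \<Rightarrow> 'n coords) \<Rightarrow> 'n coords \<Rightarrow> real" where
  "pairing c \<equiv> precompact_chart.tractor_pairing (g c)"

lemma pairing:
  assumes c: "c \<in> A" and U: "openin X U"
    and \<xi>: "vector_field_tangent A U \<xi>" and \<eta>: "vector_field_tangent A U \<eta>"
  shows "smooth_on (coord c U) (pairing c (\<xi> c) (\<eta> c))"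
    and "x \<in> pos (coord c U) \<Longrightarrow> pairing c (\<xi> c) (\<eta> c) x = (vol_scale g c x)\<^sup>2 * g c x (\<xi> c x) (\<eta> c x)"
proof -
  interpret pc: precompact_chart "snd c ` fst c" "g c" "\<Gamma> c" by (rule precompact_chart[OF c])
  have T: "hopen (coord c U)" "coord c U \<subseteq> snd c ` fst c"
    using hopen_coord[OF c U] by (auto simp: coord_def)
  have f: "smooth_on (coord c U) (\<zeta> c)" "\<And>x. x \<in> coord c U \<Longrightarrow> x $ None = 0 \<Longrightarrow> \<zeta> c x $ None = 0"
    if \<zeta>: "vector_field_tangent A U \<zeta>" for \<zeta>
  proof -
    show "smooth_on (coord c U) (\<zeta> c)"
      using \<zeta> c unfolding vector_field_tangent_def vector_field_def by blast
    have "\<forall>x\<in>coord c (U \<inter> bdry A). \<zeta> c x $ None = 0" using \<zeta> c unfolding vector_field_tangent_def by blast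
    moreover fix x assume "x \<in> coord c U" "x $ None = 0"
    then have "x \<in> coord c (U \<inter> bdry A)" using coord_bdry_iff[OF c, of x U] by simp
    ultimately show "\<zeta> c x $ None = 0" by (rule bspec)
  qed
  show "smooth_on (coord c U) (pairing c (\<xi> c) (\<eta> c))"
    by (rule pc.smooth_tractor_pairing[where v = "\<xi> c" and w = "\<eta> c", OF T])
      (fact f(1)[OF \<xi>] f(2)[OF \<xi>] f(1)[OF \<eta>] f(2)[OF \<eta>])+
  show "pairing c (\<xi> c) (\<eta> c) x = (vol_scale g c x)\<^sup>2 * g c x (\<xi> c x) (\<eta> c x)" if "x \<in> pos (coord c U)"
    using pc.tractor_pairing_interior[of "coord c U" "\<xi> c" "\<eta> c" x] T f(1)[OF \<xi>] f(1)[OF \<eta>]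
      f(2)[OF \<xi>] f(2)[OF \<eta>] that by (simp add: vol_scale_def)
qed

text \<open>The law for volume densities, applied to the power \<open>-1/(n+2)\<close>.\<close>

lemma vol_scale_transition:
  assumes c: "c \<in> A" "c' \<in> A" and x: "x \<in> coord c (mint X A \<inter> fst c')"
  shows "vol_scale g c x = \<bar>det (matrix (bderiv (transition c c') x))\<bar> powr (- 1 / (real CARD('n) + 2))
    * vol_scale g c' (transition c c' x)"
proof -
  let ?J = "matrix (bderiv (transition c c') x)" and ?y = "transition c c' x"
  let ?m = "\<chi> i j. g c x (ax i) (ax j)" and ?m' = "\<chi> i j. g c' ?y (ax i) (ax j)"
  have x': "x \<in> coord c (fst c')" using x by (auto simp: coord_def)
  have y: "?y \<in> pos (snd c' ` fst c')"
    using transitionD(1)[OF c x] coord_mint_chart[OF c(2)] coord_mono[of "mint X A \<inter> fst c" "mint X A" c'] by auto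
  have "g c x (ax i) (ax j) = (\<Sum>l\<in>UNIV. (\<Sum>k\<in>UNIV. ?J $ k $ i * g c' ?y (ax k) (ax l)) * ?J $ l $ j)" for i j
  proof -
    let ?u = "bderiv (transition c c') x"
    have "g c x (ax i) (ax j) = g c' ?y (?u (ax i)) (?u (ax j))"
      using metric c x unfolding pseudo_metric_def sym_form_field_def by blast
    also have "\<dots> = (\<Sum>k\<in>UNIV. \<Sum>l\<in>UNIV. ?u (ax i) $ k * ?u (ax j) $ l * g c' ?y (ax k) (ax l))"
      by (rule bilinear_ax_expansion[OF metric_chart(1)[OF c(2) y]])
    also have "\<dots> = (\<Sum>l\<in>UNIV. \<Sum>k\<in>UNIV. ?u (ax i) $ k * ?u (ax j) $ l * g c' ?y (ax k) (ax l))"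
      by (rule sum.swap)
    finally show ?thesis by (simp add: matrix_def sum_distrib_left sum_distrib_right mult_ac)
  qed
  then have "?m = transpose ?J ** ?m' ** ?J"
    by (simp add: vec_eq_iff matrix_matrix_mult_def transpose_def)
  then have "det ?m = det ?J * det ?J * det ?m'" by (simp add: det_mul)
  then have "sqrt \<bar>det ?m\<bar> = \<bar>det ?J\<bar> * sqrt \<bar>det ?m'\<bar>"
    by (simp add: abs_mult real_sqrt_mult)
  then show ?thesis unfolding vol_scale_def by (simp add: powr_mult)
qed

text \<open>The boundary values of \<open>\<sigma>\<^sup>2 g(\<xi>, \<eta>)\<close> define the extension, because these functions are given by the
  smooth pairing in each chart.\<close>

lemma b_metric_exists: "\<exists>B. extends_to_b_metric X A g B"
proof -
  define u where "u \<xi> \<eta> c x = (vol_scale g c x)\<^sup>2 * g c x (\<xi> c x) (\<eta> c x)"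
    for \<xi> \<eta> :: "('a, 'n) vfield" and c x
  define B where "B \<xi> \<eta> c = bval (u \<xi> \<eta> c)" for \<xi> \<eta> c
  have "extends_to_b_metric X A g B"
    unfolding extends_to_b_metric_def
  proof (intro allI impI)
    fix U \<xi> \<eta>
    assume "openin X U \<and> vector_field_tangent A U \<xi> \<and> vector_field_tangent A U \<eta>"
    then have U: "openin X U" and \<xi>: "vector_field_tangent A U \<xi>" and \<eta>: "vector_field_tangent A U \<eta>" by auto
    have Bp: "B \<xi> \<eta> c x = pairing c (\<xi> c) (\<eta> c) x" if "c \<in> A" "x \<in> coord c U" for c x
      unfolding B_def
      by (rule bval_eq[OF hopen_coord[OF that(1) U] that(2) smooth_on_continuous[OF pairing(1)[OF that(1) U \<xi> \<eta>]]])
        (simp add: u_def pairing(2)[OF that(1) U \<xi> \<eta>])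
    have sm: "smooth_on (coord c U) (B \<xi> \<eta> c)" if c: "c \<in> A" for c
      by (rule smooth_on_eq[OF pairing(1)[OF c U \<xi> \<eta>]]) (simp add: Bp[OF c])
    have int: "B \<xi> \<eta> c x = u \<xi> \<eta> c x" if "c \<in> A" "x \<in> pos (coord c U)" for c x
      using Bp[of c x] pairing(2)[OF that(1) U \<xi> \<eta> that(2)] that pos_subset by (auto simp: u_def)
    have law: "B \<xi> \<eta> c x = \<bar>det (matrix (bderiv (transition c c') x))\<bar> powr (- 2 / (real CARD('n) + 2))
        * B \<xi> \<eta> c' (transition c c' x)"
      if c: "c \<in> A" "c' \<in> A" and x: "x \<in> coord c (U \<inter> fst c')" for c c' x
    proof -
      let ?V = "coord c (U \<inter> fst c')"
      let ?d = "\<lambda>x. det (matrix (bderiv (transition c c') x))"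
      have V: "hopen ?V" by (rule hopen_coord[OF c(1) openin_Int_chart[OF c(2) U]])
      have t: "thick ?V" by (rule thick_hopen[OF V])
      have st: "smooth_on ?V (transition c c')" by (rule smooth_transition_Int[OF c U])
      have T: "transition c c' ` ?V \<subseteq> coord c' U" using transitionD(1)[OF c] by (auto simp: coord_def)
      have smB': "smooth_on ?V (\<lambda>x. B \<xi> \<eta> c' (transition c c' x))"
        by (rule smooth_on_compose[OF t st T sm[OF c(2)]])
      have "smooth_on ?V (\<lambda>x. bderiv (transition c c') x v $ i)" for v i
        by (intro smooth_on_nth t smooth_on_bderiv V st)
      then have sd: "smooth_on ?V ?d"
        by (intro smooth_on_det t) (simp add: matrix_def)
      have d0: "?d y \<noteq> 0" if "y \<in> ?V" for y
      proof -
        have y: "y \<in> coord c (fst c')" using that by (auto simp: coord_def)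
        have l: "linear (bderiv (transition c c') y)" by (rule linear_transition_derivative[OF c y])
        have "inj (bderiv (transition c c') y)"
          by (rule inj_on_inverseI[where g = "bderiv (transition c' c) (transition c c' y)"])
            (rule transition_derivative_inverse[OF c y])
        then show ?thesis using l by (simp add: det_nz_iff_inj)
      qed
      show ?thesis
      proof (rule eq_from_pos[OF V _ _ _ x, where f = "B \<xi> \<eta> c" and g = "\<lambda>x. \<bar>?d x\<bar> powr (- 2 / (real CARD('n) + 2))
          * B \<xi> \<eta> c' (transition c c' x)"])
        show "continuous_on ?V (B \<xi> \<eta> c)"
          using smooth_on_continuous[OF sm[OF c(1)]] coord_mono[of "U \<inter> fst c'" U c] continuous_on_subset by blast
        show "continuous_on ?V (\<lambda>x. \<bar>?d x\<bar> powr (- 2 / (real CARD('n) + 2)) * B \<xi> \<eta> c' (transition c c' x))"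
          by (intro smooth_on_continuous smooth_on_mult smooth_on_abs_powr t sd smB') (use d0 in auto)
        fix y assume y: "y \<in> pos ?V"
        let ?z = "transition c c' y"
        have y1: "y \<in> pos (coord c U)" using y coord_mono[of "U \<inter> fst c'" U c] pos_mono by blast
        have y2: "y \<in> coord c (fst c')" using y by (auto simp: coord_def pos_def)
        have z: "?z \<in> pos (coord c' U)"
          using T y transition_pos[OF c y2] by (auto simp: pos_def)
        have "y \<in> coord c (U \<inter> mint X A)" using y1 coord_mint[OF c(1) U] by simp
        then have y3: "y \<in> coord c (mint X A \<inter> fst c')"
          using coordI[of "coord_inv c y" "mint X A \<inter> fst c'" c] coordD[OF c(1), of y "U \<inter> mint X A"]
            coordD(1)[OF c(1) y2] by simp
        have f: "\<zeta> c' ?z = bderiv (transition c c') y (\<zeta> c y)" if "vector_field_tangent A U \<zeta>" for \<zeta>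
          using that c y pos_subset unfolding vector_field_tangent_def vector_field_def by blast
        have "g c y (\<xi> c y) (\<eta> c y) = g c' ?z (\<xi> c' ?z) (\<eta> c' ?z)"
          using metric c y3 unfolding f[OF \<xi>] f[OF \<eta>] pseudo_metric_def sym_form_field_def by blast
        moreover have "(\<bar>?d y\<bar> powr (- 1 / (real CARD('n) + 2)))\<^sup>2 = \<bar>?d y\<bar> powr (- 2 / (real CARD('n) + 2))"
          by (simp add: power2_eq_square powr_add[symmetric])
        ultimately show "B \<xi> \<eta> c y = \<bar>?d y\<bar> powr (- 2 / (real CARD('n) + 2)) * B \<xi> \<eta> c' ?z"
          unfolding int[OF c(1) y1] int[OF c(2) z] u_def vol_scale_transition[OF c y3]
          by (simp add: power_mult_distrib)
      qed
    qed
    show "density_field A U 2 (B \<xi> \<eta>) \<and> (\<forall>c\<in>A. \<forall>x\<in>coord c (U \<inter> mint X A).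
        B \<xi> \<eta> c x = (vol_scale g c x)\<^sup>2 * g c x (\<xi> c x) (\<eta> c x))"
      unfolding density_field_def
    proof (intro conjI ballI)
      show "smooth_on (coord c U) (B \<xi> \<eta> c)" if "c \<in> A" for c by (rule sm[OF that])
      show "B \<xi> \<eta> c x = \<bar>det (matrix (bderiv (transition c c') x))\<bar> powr (- 2 / (real CARD('n) + 2))
        * B \<xi> \<eta> c' (transition c c' x)"
        if "c \<in> A" "c' \<in> A" "x \<in> coord c (U \<inter> fst c')" for c c' x by (rule law[OF that])
      show "B \<xi> \<eta> c x = (vol_scale g c x)\<^sup>2 * g c x (\<xi> c x) (\<eta> c x)"
        if "c \<in> A" "x \<in> coord c (U \<inter> mint X A)" for c x
        using int[OF that(1)] that coord_mint[OF that(1) U] by (simp add: u_def)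
    qed
  qed
  then show ?thesis by blast
qed

lemma tractor_metric_eq_pairing:
  assumes c: "c \<in> A" and U: "openin X U"
    and \<xi>: "vector_field_tangent A U \<xi>" and \<eta>: "vector_field_tangent A U \<eta>" and x: "x \<in> coord c U"
  shows "tractor_metric X A g \<xi> \<eta> c x = pairing c (\<xi> c) (\<eta> c) x"
proof -
  have ext: "extends_to_b_metric X A g (tractor_metric X A g)"
    unfolding tractor_metric_def by (rule someI_ex[OF b_metric_exists])
  show ?thesis
  proof (rule eq_from_pos[OF hopen_coord[OF c U] _ smooth_on_continuous[OF pairing(1)[OF c U \<xi> \<eta>]] _ x])
    show "continuous_on (coord c U) (tractor_metric X A g \<xi> \<eta> c)"
      using ext U \<xi> \<eta> c unfolding extends_to_b_metric_def density_field_def by (intro smooth_on_continuous) blast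
    show "tractor_metric X A g \<xi> \<eta> c y = pairing c (\<xi> c) (\<eta> c) y" if "y \<in> pos (coord c U)" for y
    proof -
      have "y \<in> coord c (U \<inter> mint X A)" using that coord_mint[OF c U] by simp
      then have "tractor_metric X A g \<xi> \<eta> c y = (vol_scale g c y)\<^sup>2 * g c y (\<xi> c y) (\<eta> c y)"
        using ext U \<xi> \<eta> c unfolding extends_to_b_metric_def by blast
      then show ?thesis using pairing(2)[OF c U \<xi> \<eta> that] by simp
    qed
  qed
qed

text \<open>On the canonical line the tractor metric is \<open>G\<^sub>0\<^sub>0\<close>, up to a positive factor: at the boundary
  \<open>\<rho> \<nu>\<close> equals \<open>x\<^sub>0 \<partial>\<^sub>0\<close> as a section of the b-tangent bundle.\<close>

lemma tractor_metric_canonical_line: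
  assumes c: "c \<in> A" and p: "p \<in> fst c" "p \<in> bdry A" and tp: "transversal_pair X A p U \<rho> \<nu>"
  defines "G \<equiv> precompact_chart.G (g c) (snd c p)"
  shows "tractor_metric X A g (scale_field \<rho> \<nu>) (scale_field \<rho> \<nu>) c (snd c p)
    = \<bar>det G\<bar> powr (- 1 / (real CARD('n) + 2)) * G $ None $ None" and "det G \<noteq> 0"
proof -
  interpret pc: precompact_chart "snd c ` fst c" "g c" "\<Gamma> c" by (rule precompact_chart[OF c])
  let ?x = "snd c p" and ?\<xi> = "scale_field \<rho> \<nu>"
  define f where "f c x = \<rho> (coord_inv c x)" for c :: "('a, 'n) chart" and x
  have U: "openin X U" and pU: "p \<in> U" and ld: "local_defining X A U \<rho>" and \<nu>: "vector_field A U \<nu>"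
    and d1: "\<And>c x. c \<in> A \<Longrightarrow> x \<in> coord c (U \<inter> bdry A) \<Longrightarrow> differential \<rho> c x (\<nu> c x) = 1"
    using tp unfolding transversal_pair_def local_defining_def by auto
  have smf: "smooth_on (coord c U) (f c)" if "c \<in> A" for c
    using ld that unfolding local_defining_def smooth_fun_def f_def o_def by blast
  have f0: "f c x = 0" if "c \<in> A" "x \<in> coord c U" "x $ None = 0" for c x
    using ld coordD[OF that(1,2)] bdry_iff[OF that(1), of "coord_inv c x"] that(3)
    unfolding local_defining_def f_def by auto
  have sm\<nu>: "smooth_on (coord c U) (\<nu> c)" if "c \<in> A" for c
    using \<nu> that unfolding vector_field_def by blast
  have \<xi>: "?\<xi> c x = f c x *\<^sub>R \<nu> c x" for c x by (simp add: scale_field_def f_def)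
  have tan: "vector_field_tangent A U ?\<xi>"
    unfolding vector_field_tangent_def vector_field_def
  proof (intro conjI ballI)
    show "smooth_on (coord c U) (?\<xi> c)" if "c \<in> A" for c
      unfolding \<xi>[abs_def] by (rule smooth_on_scaleR[OF thick_hopen[OF hopen_coord[OF that U]] smf[OF that] sm\<nu>[OF that]])
    show "?\<xi> c' (transition c c' x) = bderiv (transition c c') x (?\<xi> c x)"
      if h: "c \<in> A" "c' \<in> A" "x \<in> coord c (U \<inter> fst c')" for c c' x
    proof -
      have x: "x \<in> coord c (fst c')" using h(3) by (auto simp: coord_def)
      have "\<nu> c' (transition c c' x) = bderiv (transition c c') x (\<nu> c x)"
        using \<nu> h unfolding vector_field_def by blast
      then show ?thesis
        unfolding \<xi> linear_scale[OF linear_transition_derivative[OF h(1,2) x]]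
        by (simp add: f_def transitionD(2)[OF h])
    qed
    show "?\<xi> c x $ None = 0" if "c \<in> A" "x \<in> coord c (U \<inter> bdry A)" for c x
      using f0[OF that(1)] that(2) coord_bdry_iff[OF that(1)] by (simp add: \<xi>)
  qed
  have V: "hopen (coord c U)" by (rule hopen_coord[OF c U])
  have x: "?x \<in> coord c U" "?x $ None = 0" "?x \<in> coord c (U \<inter> bdry A)"
    using coordI[OF pU p(1)] bdry_iff[OF c p(1)] p(2) coord_bdry_iff[OF c] by auto
  have half: "?x \<in> half_space" using x(1) openin_imp_subset[OF V] by blast
  have df: "bderiv (f c) ?x v = v $ None * normal_quotient (f c) ?x" for v
    by (rule vanishing_on_boundary_derivative[OF V smf[OF c] f0[OF c] x(1,2)])
  have "differential \<rho> c ?x = bderiv (f c) ?x"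
    unfolding differential_def f_def o_def ..
  then have one: "\<nu> c ?x $ None * normal_quotient (f c) ?x = 1" using d1[OF c x(3)] df by simp
  have sm0: "smooth_on (coord c U) (\<lambda>x. \<nu> c x $ None)"
    by (rule smooth_on_nth[OF thick_hopen[OF V] sm\<nu>[OF c]])
  have "((\<lambda>x. ?\<xi> c x $ None) has_derivative
      (\<lambda>v. f c ?x * bderiv (\<lambda>x. \<nu> c x $ None) ?x v + bderiv (f c) ?x v * \<nu> c ?x $ None)) (at ?x within half_space)"
    using has_derivative_mult[OF has_bderiv[OF V smf[OF c] x(1)] has_bderiv[OF V sm0 x(1)]] by (simp add: \<xi>)
  from fun_cong[OF bderiv_eqI[OF half this], of e\<^sub>0] have "bderiv (\<lambda>x. ?\<xi> c x $ None) ?x e\<^sub>0 = 1"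
    using one f0[OF c x(1,2)] df[of e\<^sub>0] by (simp add: mult.commute axis_def)
  then have c0: "frame_component (?\<xi> c) None ?x = 1"
    using x(2) by (simp add: frame_component_def normal_quotient_def)
  have ci: "frame_component (?\<xi> c) (Some i) ?x = 0" for i
    using f0[OF c x(1,2)] by (simp add: frame_component_def \<xi>)
  show "tractor_metric X A g ?\<xi> ?\<xi> c ?x = \<bar>det G\<bar> powr (- 1 / (real CARD('n) + 2)) * G $ None $ None"
    unfolding tractor_metric_eq_pairing[OF c U tan tan x(1)] pc.tractor_pairing_def G_def
    by (simp add: sum_option c0 ci)
  show "det G \<noteq> 0" unfolding G_def by (rule pc.det_G_nonzero) (use p in blast)
qed

lemma sign_at_boundary:
  assumes c: "c \<in> A" and p: "p \<in> fst c"
    and \<epsilon>: "\<epsilon> = 1 \<and> p \<in> bdry_plus X A g \<or> \<epsilon> = - 1 \<and> p \<in> bdry_minus X A g"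
  shows "0 < \<epsilon> * precompact_chart.G (g c) (snd c p) $ None $ None"
proof -
  have pb: "p \<in> bdry A" using \<epsilon> unfolding bdry_plus_def bdry_minus_def by auto
  let ?G = "precompact_chart.G (g c) (snd c p)"
  have "\<exists>U \<rho> \<nu>. transversal_pair X A p U \<rho> \<nu> \<and>
      0 < \<epsilon> * tractor_metric X A g (scale_field \<rho> \<nu>) (scale_field \<rho> \<nu>) c (snd c p)"
    using \<epsilon>
  proof (elim disjE conjE)
    assume e: "\<epsilon> = 1" and "p \<in> bdry_plus X A g"
    then obtain U \<rho> \<nu> where "transversal_pair X A p U \<rho> \<nu>"
        "\<forall>c\<in>A. p \<in> fst c \<longrightarrow> tractor_metric X A g (scale_field \<rho> \<nu>) (scale_field \<rho> \<nu>) c (snd c p) > 0"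
      unfolding bdry_plus_def by blast
    then show ?thesis using c p e by (intro exI[of _ U] exI[of _ \<rho>] exI[of _ \<nu>]) simp
  next
    assume e: "\<epsilon> = - 1" and "p \<in> bdry_minus X A g"
    then obtain U \<rho> \<nu> where "transversal_pair X A p U \<rho> \<nu>"
        "\<forall>c\<in>A. p \<in> fst c \<longrightarrow> tractor_metric X A g (scale_field \<rho> \<nu>) (scale_field \<rho> \<nu>) c (snd c p) < 0"
      unfolding bdry_minus_def by blast
    then show ?thesis using c p e by (intro exI[of _ U] exI[of _ \<rho>] exI[of _ \<nu>]) simp
  qed
  then obtain U \<rho> \<nu> where tp: "transversal_pair X A p U \<rho> \<nu>"
      and s: "0 < \<epsilon> * tractor_metric X A g (scale_field \<rho> \<nu>) (scale_field \<rho> \<nu>) c (snd c p)" by blast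
  have "0 < \<bar>det ?G\<bar> powr (- 1 / (real CARD('n) + 2)) * (\<epsilon> * ?G $ None $ None)"
    using s tractor_metric_canonical_line(1)[OF c p pb tp] by (simp add: mult.left_commute)
  then show ?thesis
    by (metis powr_ge_zero zero_less_mult_iff not_less)
qed

end

section \<open>The normal form\<close>

theorem corollary3p7:
  fixes X :: "'a topology" and A :: "('a, 'n::finite) chart set"
    and g :: "('a, 'n) bform" and p :: 'a and \<epsilon> :: real
  assumes "CARD('n) \<ge> 2"
    and "manifold_with_boundary X A"
    and "pseudo_metric A (mint X A) g"
    and "precompact_metric X A g"
    and "asym_tangentially_ricci_flat X A g"
    and "\<epsilon> = 1 \<and> p \<in> bdry_plus X A g \<or> \<epsilon> = -1 \<and> p \<in> bdry_minus X A g"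
  shows "\<exists>U \<rho> C h. p \<in> U \<and> local_defining X A U \<rho> \<and>
    smooth_fun A U C \<and> sym_form_field A U h \<and>
    (\<forall>c\<in>A. \<forall>x\<in>coord c (U \<inter> mint X A). \<forall>v w.
       g c x v w =
         C (coord_inv c x) / (\<rho> (coord_inv c x)) ^ 4 * (differential \<rho> c x v * differential \<rho> c x w)
         + h c x v w / (\<rho> (coord_inv c x))\<^sup>2) \<and>
    (\<exists>C1. smooth_fun A U C1 \<and> (\<forall>q\<in>U. C q = \<epsilon> + \<rho> q * C1 q)) \<and>
    nondegenerate_on_bdry A U h"
proof -
  obtain \<Gamma> where "levi_civita X A g \<Gamma>" "precompact_connection X A \<Gamma>"
    using assms(4) unfolding precompact_metric_def by blast
  then interpret precompact_manifold X A g \<Gamma>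
    using assms(2,3,5) by unfold_locales
  have "p \<in> bdry A" using assms(6) unfolding bdry_plus_def bdry_minus_def by auto
  then obtain c where c: "c \<in> A" "p \<in> fst c" "snd c p $ None = 0" unfolding bdry_def by blast
  interpret pc: precompact_chart "snd c ` fst c" "g c" "\<Gamma> c" by (rule precompact_chart[OF c(1)])
  have sgn: "\<epsilon> = 1 \<or> \<epsilon> = - 1" using assms(6) by auto
  have pS: "snd c p \<in> snd c ` fst c" using c(2) by blast
  obtain V R C C1 h where N: "hopen V" "V \<subseteq> snd c ` fst c" "snd c p \<in> V"
      "smooth_on V R" "smooth_on V C" "smooth_on V C1"
      "\<forall>x\<in>V. R x = 0 \<longleftrightarrow> x $ None = 0" "\<forall>x\<in>V. x $ None = 0 \<longrightarrow> bderiv R x e\<^sub>0 \<noteq> 0"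
      "\<forall>x\<in>V. C x = \<epsilon> + R x * C1 x"
      "\<forall>x\<in>V. bilinear (h x) \<and> (\<forall>v w. h x v w = h x w v)" "\<forall>v w. smooth_on V (\<lambda>x. h x v w)"
      "\<forall>x\<in>pos V. \<forall>v w. g c x v w = C x / R x ^ 4 * (bderiv R x v * bderiv R x w) + h x v w / (R x)\<^sup>2"
      "\<forall>x\<in>V. x $ None = 0 \<longrightarrow> (\<forall>v. v $ None = 0 \<and> (\<forall>w. w $ None = 0 \<longrightarrow> h x v w = 0) \<longrightarrow> v = 0)"
    by (rule exE[OF pc.normal_form[OF pS c(3) sgn sign_at_boundary[OF c(1,2) assms(6)]]], elim exE conjE, rule that) assumption+
  note V = N(1-3) and sm = N(4-6) and h = N(10-11)
  have R: "R x = 0 \<longleftrightarrow> x $ None = 0" if "x \<in> V" for x using N(7) that by blast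
  have dR: "bderiv R x e\<^sub>0 \<noteq> 0" if "x \<in> V" "x $ None = 0" for x using N(8) that by blast
  have C: "C x = \<epsilon> + R x * C1 x" if "x \<in> V" for x using N(9) that by blast
  have gR: "g c x v w = C x / R x ^ 4 * (bderiv R x v * bderiv R x w) + h x v w / (R x)\<^sup>2"
    if "x \<in> pos V" for x v w using N(12) that by blast
  have nd: "v = 0" if "x \<in> V" "x $ None = 0" "v $ None = 0" "\<And>w. w $ None = 0 \<Longrightarrow> h x v w = 0" for x v
    using N(13) that by blast
  define U where "U = {q \<in> fst c. snd c q \<in> V}"
  have U: "openin X U" "U \<subseteq> fst c" unfolding U_def using openin_coord_inverse[OF c(1) V(1)] by auto
  have cU: "coord c U = V" unfolding coord_def U_def using V(2) by blast
  define \<rho> where "\<rho> q = R (snd c q)" for q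
  define K where "K q = C (snd c q)" for q
  have ld: "local_defining X A U \<rho>"
    unfolding \<rho>_def[abs_def] by (rule local_defining_chart[OF c(1) U]) (use cU sm(1) R dR in auto)
  have sK: "smooth_fun A U K" "smooth_fun A U (\<lambda>q. C1 (snd c q))"
    unfolding K_def[abs_def] using smooth_fun_chart[OF c(1) U] sm cU by auto
  have sh: "sym_form_field A U (chart_form c h)"
    by (rule sym_form_field_chart_form[OF c(1) U]) (use h cU in auto)
  have T: "x \<in> coord c' (fst c)" "x \<in> coord c' (U \<inter> fst c)" "transition c' c x \<in> V"
      "transition c' c x \<in> coord c (fst c')"
    if "c' \<in> A" "x \<in> coord c' U" for c' x
  proof -
    show x: "x \<in> coord c' (U \<inter> fst c)" using that U(2) by (simp add: Int_absorb2)
    then show "x \<in> coord c' (fst c)" by (auto simp: coord_def)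
    have "transition c' c x \<in> coord c (U \<inter> fst c')" by (rule transitionD(1)[OF that(1) c(1) x])
    then show "transition c' c x \<in> V" "transition c' c x \<in> coord c (fst c')"
      using cU by (auto simp: coord_def)
  qed
  have metric_form: "g c' x v w = K (coord_inv c' x) / (\<rho> (coord_inv c' x)) ^ 4
        * (differential \<rho> c' x v * differential \<rho> c' x w) + chart_form c h c' x v w / (\<rho> (coord_inv c' x))\<^sup>2"
    if c': "c' \<in> A" and x: "x \<in> coord c' (U \<inter> mint X A)" for c' x v w
  proof -
    let ?y = "transition c' c x" and ?D = "bderiv (transition c' c) x"
    have xU: "x \<in> coord c' U" and xp: "0 < x $ None"
      using x coord_mint[OF c' U(1)] by (auto simp: pos_def)
    have "x \<in> coord c' (mint X A \<inter> fst c)" using x U(2) by (auto simp: coord_def)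
    then have "g c' x v w = g c ?y (?D v) (?D w)"
      using metric c' c(1) unfolding pseudo_metric_def sym_form_field_def by blast
    moreover have "?y \<in> pos V"
      using T(3)[OF c' xU] transition_pos[OF c' c(1) T(1)[OF c' xU] xp] by (rule posI)
    moreover have "differential \<rho> c' x u = bderiv R ?y (?D u)" for u
      unfolding \<rho>_def[abs_def] by (rule differential_chart[OF c(1) c' U _ xU]) (simp add: cU sm(1))
    ultimately show ?thesis
      using gR by (simp add: K_def \<rho>_def chart_form_def transition_def)
  qed
  have nondeg: "nondegenerate_on_bdry A U (chart_form c h)"
    unfolding nondegenerate_on_bdry_def
  proof (intro ballI allI impI, elim conjE)
    fix c' x v
    assume c': "c' \<in> A" and x: "x \<in> coord c' (U \<inter> bdry A)" and v: "v $ None = 0"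
      and z: "\<forall>w. w $ None = 0 \<longrightarrow> chart_form c h c' x v w = 0"
    let ?y = "transition c' c x" and ?D = "bderiv (transition c' c) x" and ?E = "bderiv (transition c c') (transition c' c x)"
    have xU: "x \<in> coord c' U" and x0: "x $ None = 0" using x coord_bdry_iff[OF c'] by auto
    note T = T[OF c' xU]
    have y0: "?y $ None = 0" using transition_boundary[OF c' c(1) T(1)] x0 by simp
    have ret: "transition c c' ?y = x" using transitionD(3)[OF c' c(1) T(2)] .
    have "?D v = 0"
    proof (rule nd[OF T(3) y0 transition_derivative_tangent[OF c' c(1) T(1) x0 v]])
      fix w :: "'n coords" assume w: "w $ None = 0"
      have "?E w $ None = 0" by (rule transition_derivative_tangent[OF c(1) c' T(4) y0 w])
      then have "h ?y (?D v) (?D (?E w)) = 0" using z by (simp add: chart_form_def)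
      then show "h ?y (?D v) w = 0"
        using transition_derivative_inverse[OF c(1) c' T(4), of w] ret by simp
    qed
    then show "v = 0"
      using transition_derivative_inverse[OF c' c(1) T(1), of v]
        linear_0[OF linear_transition_derivative[OF c(1) c' T(4)]] by simp
  qed
  have "p \<in> U" using c V(3) by (simp add: U_def)
  moreover have "\<forall>q\<in>U. K q = \<epsilon> + \<rho> q * C1 (snd c q)" using C by (simp add: U_def K_def \<rho>_def)
  ultimately show ?thesis
    using ld sK sh metric_form nondeg
    by (intro exI[of _ U] exI[of _ \<rho>] exI[of _ K] exI[of _ "chart_form c h"] conjI
        exI[of _ "\<lambda>q. C1 (snd c q)"] ballI allI) simp_all
qed

end
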